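(* There exist constants $c, c'>0$ such that the following holds in the uniform attachment model. (a) For every $\epsilon\in(0,1/e)$ and every positive integer $K$, if there exists a root-finding procedure with output size $K$ and accuracy $\epsilon$, then $$K \geq \exp\left( c \sqrt{\log(1/\epsilon)}\right).$$ (b) There exists an algorithm, running in time polynomial in the number $n$ of vertices of the input tree, which for every $\epsilon\in(0,1/e)$ implements a root-finding procedure of accuracy $\epsilon$ with some output size $K(\epsilon)$ (not depending on $n$) satisfying $$K(\epsilon) \leq \exp\left(c' \frac{\log(1/\epsilon)}{\log\log(1/\epsilon)}\right).$$
   Context: Write $[n]=\{1,\dots,n\}$. The uniform attachment tree $\mathrm{UA}(n)$, $n\ge 2$, is the random labeled tree on vertex set $[n]$ defined inductively: $\mathrm{UA}(2)$ is the unique tree on two vertices, and $\mathrm{UA}(n+1)$ is obtained from $\mathrm{UA}(n)$ by adding the vertex $n+1$ and an edge $\{i,n+1\}$ with $i\in[n]$ chosen uniformly at random. Vertex $1$ is called the root. For a labeled tree $T$, $T^\circ$ denotes its isomorphism class, i.e. the unlabeled copy of $T$. A root-finding procedure with output size $K$ and accuracy $\epsilon$ (in the uniform attachment model) is a mapping $H$ which, given an unlabeled tree with at least $K$ vertices, outputs a set of $K$ of its vertices, such that $$\liminf_{n\to\infty} \mathbb{P}\left(1\in H(\mathrm{UA}(n)^\circ)\right)\ge 1-\epsilon .$$ The integer $K$ may depend on $\epsilon$ but not on $n$. Here the vertices of the unlabeled tree are identified with those of the labeled tree through an isomorphism that carries no information on the original labels. Concretely: $H$ may be viewed as a function from labeled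 trees on $[n]$ to $K$-subsets of $[n]$, and the event $1\in H(\mathrm{UA}(n)^\circ)$ means $\sigma(1)\in H(\sigma(\mathrm{UA}(n)))$, where $\sigma$ is a uniformly random permutation of $[n]$ independent of the tree and $\sigma(T)$ is $T$ with its vertices relabeled by $\sigma$. *)

theory Defs
  imports
    "HOL-Probability.Probability"
    "HOL-Combinatorics.Permutations"
    "HOL-Library.Log_Nat"
begin

text \<open>Graphs on \<open>{1..n}\<close> are given by their edge sets, the edges being two-element sets of vertices.\<close>

type_synonym edges = "nat set set"

definition is_cycle :: "edges \<Rightarrow> nat list \<Rightarrow> bool" where
  "is_cycle E vs \<longleftrightarrow> 3 \<le> length vs \<and> distinct vs \<and>
     (\<forall>i < length vs. {vs ! i, vs ! (Suc i mod length vs)} \<in> E)"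

definition labeled_tree :: "nat \<Rightarrow> edges \<Rightarrow> bool" where
  "labeled_tree n E \<longleftrightarrow>
     E \<subseteq> {{u, v} | u v. u \<in> {1..n} \<and> v \<in> {1..n} \<and> u \<noteq> v} \<and>
     (\<forall>u \<in> {1..n}. \<forall>v \<in> {1..n}. (u, v) \<in> {(x, y). {x, y} \<in> E}\<^sup>*) \<and>
     (\<nexists>vs. is_cycle E vs)"

text \<open>The values of \<open>UA\<close> at \<open>0\<close> and \<open>1\<close> are dummies; only the limit of large \<open>n\<close> matters.\<close>

fun UA :: "nat \<Rightarrow> edges pmf" where
  "UA 0 = return_pmf {}"
| "UA (Suc 0) = return_pmf {}"
| "UA (Suc (Suc 0)) = return_pmf {{1, 2}}"
| "UA (Suc (Suc (Suc m))) =
     bind_pmf (UA (Suc (Suc m))) (\<lambda>T.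
       map_pmf (\<lambda>i. insert {i, Suc (Suc (Suc m))} T) (pmf_of_set {1..Suc (Suc m)}))"

lemma UA_2: "UA 2 = return_pmf {{1, 2}}"
  by (simp add: numeral_2_eq_2)

lemma UA_Suc:
  assumes "2 \<le> n"
  shows "UA (Suc n) = bind_pmf (UA n) (\<lambda>T. map_pmf (\<lambda>i. insert {i, Suc n} T) (pmf_of_set {1..n}))"
proof -
  obtain m where "n = Suc (Suc m)"
    using assms by (metis add_2_eq_Suc le_Suc_ex)
  then show ?thesis by simp
qed

definition relabel :: "(nat \<Rightarrow> nat) \<Rightarrow> edges \<Rightarrow> edges" where
  "relabel \<sigma> T = (\<lambda>e. \<sigma> ` e) ` T"

text \<open>The probability that \<open>1 \<in> H (UA(n)\<^sup>\<circ>)\<close>: the procedure sees the tree only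
  after its labels have been permuted uniformly at random.\<close>

definition find_prob :: "(nat \<Rightarrow> edges \<Rightarrow> nat set) \<Rightarrow> nat \<Rightarrow> real" where
  "find_prob H n =
     measure_pmf.prob (pair_pmf (UA n) (pmf_of_set {\<sigma>. \<sigma> permutes {1..n}}))
       {(T, \<sigma>). \<sigma> 1 \<in> H n (relabel \<sigma> T)}"

definition root_finding :: "nat \<Rightarrow> real \<Rightarrow> (nat \<Rightarrow> edges \<Rightarrow> nat set) \<Rightarrow> bool" where
  "root_finding K \<epsilon> H \<longleftrightarrow>
     (\<forall>n T. K \<le> n \<longrightarrow> labeled_tree n T \<longrightarrow> H n T \<subseteq> {1..n} \<and> card (H n T) = K) \<and>
     ereal (1 - \<epsilon>) \<le> liminf (\<lambda>n. ereal (find_prob H n))"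

text \<open>Model of computation: while programs for a random access machine whose memory cells hold
  natural numbers, with the logarithmic cost criterion. Every operation is charged the bit
  lengths of its operands, including the addresses used, so that polynomial cost here means
  polynomial time on a Turing machine. \<open>Mem a\<close> is the content of the cell whose address is the
  value of \<open>a\<close>, which covers direct (\<open>Mem (Num i)\<close>) and indirect addressing. Subtraction is
  truncated and division by zero gives zero.\<close>

type_synonym store = "nat \<Rightarrow> nat"

datatype aexp =
    Num nat
  | Mem aexp
  | Plus aexp aexp
  | Minus aexp aexp
  | Times aexp aexp
  | Div aexp aexp

datatype com =
    Skip
  | Assign aexp aexp \<comment> \<open>address and new content\<close>
  | Seq com com
  | IfNZ aexp com com
  | WhileNZ aexp com

fun aval :: "aexp \<Rightarrow> store \<Rightarrow> nat" where
  "aval (Num k) s = k"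
| "aval (Mem a) s = s (aval a s)"
| "aval (Plus a b) s = aval a s + aval b s"
| "aval (Minus a b) s = aval a s - aval b s"
| "aval (Times a b) s = aval a s * aval b s"
| "aval (Div a b) s = aval a s div aval b s"

text \<open>\<open>floorlog 2 k\<close> is the number of binary digits of \<open>k\<close>, and \<open>0\<close> for \<open>k = 0\<close>.\<close>

definition bits :: "nat \<Rightarrow> nat" where
  "bits k = Suc (floorlog 2 k)"

fun acost :: "aexp \<Rightarrow> store \<Rightarrow> nat" where
  "acost (Num k) s = bits k"
| "acost (Mem a) s = acost a s + bits (aval a s) + bits (s (aval a s))"
| "acost (Plus a b) s = acost a s + acost b s + bits (aval a s) + bits (aval b s)"
| "acost (Minus a b) s = acost a s + acost b s + bits (aval a s) + bits (aval b s)"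
| "acost (Times a b) s = acost a s + acost b s + bits (aval a s) + bits (aval b s)"
| "acost (Div a b) s = acost a s + acost b s + bits (aval a s) + bits (aval b s)"

text \<open>\<open>exec c s t s'\<close>: started in \<open>s\<close>, the program \<open>c\<close> halts in \<open>s'\<close> at cost \<open>t\<close>.\<close>

inductive exec :: "com \<Rightarrow> store \<Rightarrow> nat \<Rightarrow> store \<Rightarrow> bool" where
  Skip: "exec Skip s 1 s"
| Assign: "exec (Assign a b) s
    (acost a s + acost b s + bits (aval a s) + bits (aval b s)) (s(aval a s := aval b s))"
| Seq: "exec c1 s t1 s1 \<Longrightarrow> exec c2 s1 t2 s2 \<Longrightarrow> exec (Seq c1 c2) s (t1 + t2) s2"
| IfTrue: "aval a s \<noteq> 0 \<Longrightarrow> exec c1 s t s' \<Longrightarrow>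
    exec (IfNZ a c1 c2) s (acost a s + bits (aval a s) + t) s'"
| IfFalse: "aval a s = 0 \<Longrightarrow> exec c2 s t s' \<Longrightarrow>
    exec (IfNZ a c1 c2) s (acost a s + bits (aval a s) + t) s'"
| WhileTrue: "aval a s \<noteq> 0 \<Longrightarrow> exec c s t1 s1 \<Longrightarrow> exec (WhileNZ a c) s1 t2 s2 \<Longrightarrow>
    exec (WhileNZ a c) s (acost a s + bits (aval a s) + t1 + t2) s2"
| WhileFalse: "aval a s = 0 \<Longrightarrow>
    exec (WhileNZ a c) s (acost a s + bits (aval a s)) s"

inductive_cases exec_SkipE: "exec Skip s t s'"
inductive_cases exec_AssignE: "exec (Assign a b) s t s'"
inductive_cases exec_SeqE: "exec (Seq c1 c2) s t s'"
inductive_cases exec_IfE: "exec (IfNZ a c1 c2) s t s'"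
inductive_cases exec_WhileE: "exec (WhileNZ a c) s t s'"

lemma exec_deterministic:
  assumes "exec c s t s'" and "exec c s u r"
  shows "t = u \<and> s' = r"
  using assms
proof (induction arbitrary: u r rule: exec.induct)
  case (Skip s)
  then show ?case by (auto elim: exec_SkipE)
next
  case (Assign a b s)
  then show ?case by (auto elim: exec_AssignE)
next
  case (Seq c1 s t1 s1 c2 t2 s2)
  from Seq.prems obtain v1 r1 v2 where "exec c1 s v1 r1" "exec c2 r1 v2 r" "u = v1 + v2"
    by (rule exec_SeqE) blast
  with Seq.IH show ?case by metis
next
  case (IfTrue a s c1 t s' c2)
  from IfTrue.prems IfTrue.hyps obtain v where
    "exec c1 s v r" "u = acost a s + bits (aval a s) + v"
    by (auto elim: exec_IfE)
  with IfTrue.IH show ?case by metis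
next
  case (IfFalse a s c2 t s' c1)
  from IfFalse.prems IfFalse.hyps obtain v where
    "exec c2 s v r" "u = acost a s + bits (aval a s) + v"
    by (auto elim: exec_IfE)
  with IfFalse.IH show ?case by metis
next
  case (WhileTrue a s c t1 s1 t2 s2)
  from WhileTrue.prems WhileTrue.hyps obtain v1 r1 v2 where
    "exec c s v1 r1" "exec (WhileNZ a c) r1 v2 r" "u = acost a s + bits (aval a s) + v1 + v2"
    by (auto elim: exec_WhileE)
  with WhileTrue.IH show ?case by metis
next
  case (WhileFalse a s c)
  then show ?case by (auto elim: exec_WhileE)
qed

text \<open>The input: the number of vertices, the output size, and the adjacency matrix of the tree.
  As rows and columns are numbered from \<open>1\<close> to \<open>n\<close>, the address \<open>u * n + v\<close> determines
  \<open>(u, v)\<close> and is at least \<open>2\<close>. The output is read off as the set of vertices whose cell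
  holds a nonzero number.\<close>

definition tree_input :: "nat \<Rightarrow> nat \<Rightarrow> edges \<Rightarrow> store" where
  "tree_input K n T a =
     (if a = 0 then n
      else if a = 1 then K
      else if \<exists>u \<in> {1..n}. \<exists>v \<in> {1..n}. a = u * n + v \<and> {u, v} \<in> T then 1
      else 0)"

definition vertex_output :: "nat \<Rightarrow> store \<Rightarrow> nat set" where
  "vertex_output n s = {v \<in> {1..n}. s v \<noteq> 0}"

definition poly_time_computes :: "com \<Rightarrow> (nat \<Rightarrow> nat \<Rightarrow> edges \<Rightarrow> nat set) \<Rightarrow> bool" where
  "poly_time_computes P A \<longleftrightarrow>
     (\<exists>C d. \<forall>K n T. 1 \<le> K \<longrightarrow> K \<le> n \<longrightarrow> labeled_tree n T \<longrightarrow>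
        (\<exists>t s. exec P (tree_input K n T) t s \<and> t \<le> C * n ^ d \<and> vertex_output n s = A K n T))"

end

theory Submission
  imports Defs
begin

text \<open>A tree that grows by attaching \<open>i\<close> to \<open>f i < i\<close> is the same as its parent map \<open>f\<close>, and
  \<open>UA n\<close> is the uniform distribution on parent maps. Both bounds are therefore statements about the
  numbers of pairs \<open>(f, \<sigma>)\<close> of a parent map and a hidden relabelling.

  For the lower bound, let \<open>j\<close> be a child of the root. Then moving the label \<open>j\<close> to the front turns the tree
  into another recursive tree in which \<open>j\<close> is the root; given \<open>j\<close>, no information is lost. A vertex
  \<open>k \<le> m\<close> of depth \<open>d\<close> becomes the root after \<open>d\<close> such moves, which involve \<open>d\<close> labels from \<open>{2..m}\<close>. A procedure
  sees the same unlabelled tree before and after, so the probability that it misses the root is at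
  least \<open>(m - 1)\<^sup>-\<^sup>d\<close> times the probability that it misses \<open>k\<close> while \<open>k\<close> has depth \<open>d\<close>
  (\<open>card_miss_depth_le\<close>). Among the vertices \<open>1, \<dots>, 2 K\<close> a procedure with output size \<open>K\<close>
  misses at least half, and most of these vertices have depth \<open>O(log K)\<close> because
  \<open>2\<close> to the depth of \<open>k\<close> has mean \<open>k\<close> (\<open>sum_power2_depth\<close>). Hence \<open>\<epsilon> \<ge> exp (- O(log\<^sup>2 K))\<close>.

  The procedure for the upper bound keeps the \<open>K\<close> vertices \<open>u\<close> that minimise the product, over all
  vertices \<open>w\<close>, of the size of the branch at \<open>w\<close> pointing away from \<open>u\<close>. By the hook length formula
  the number of increasing labellings with root \<open>u\<close> is inversely proportional to this product, so
  that the procedure is maximum likelihood. Along a path from the root whose vertices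
  have subtrees of sizes \<open>s\<^sub>1, \<dots>, s\<^sub>d\<close> the product is divided by \<open>\<Prod> s\<^sub>i / (n - s\<^sub>i)\<close>
  (\<open>bt_score_path\<close>), so only the vertices for which this ratio is at least \<open>1\<close> rival the root.

  Split a recursive tree into the subtree of the first child of the root and the rest, and
  repeat: the result is a binary tree whose leaves are the vertices, and every split is uniform
  (\<open>sum_bt_of\<close>). The ratio of a leaf is at most a product of one factor for each step of the path to the
  leaf (\<open>score_ratio_le\<close>), and these factors are easy to average. Markov's inequality
  for the number of rivals would only give a failure probability of order \<open>1 / K\<close>. So each leaf gets a
  second weight, depending only on the left and right turns of its path, such that
  these weights sum to at most \<open>2\<close> in every tree. If \<open>K\<close> vertices rival the root, then one of them has a
  second weight of at most \<open>2 / K\<close>, and the failure probability is at most \<open>(2 / K)\<^sup>t\<close> times the expected sum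
  of ratio\<open>\<^sup>1\<^sup>/\<^sup>4\<close> times weight\<open>\<^sup>-\<^sup>t\<close> (\<open>many_rivals_weight\<close>). This expectation is bounded uniformly in \<open>n\<close> by a doubly exponential
  function of \<open>t\<close> (\<open>shape_mean_tilted_le\<close>). With \<open>t\<close> a small multiple of \<open>log log (1 / \<epsilon>)\<close>, the
  size \<open>K = exp (O(log (1 / \<epsilon>) / log log (1 / \<epsilon>)))\<close> suffices.

  It remains to compute the products in polynomial time. Vertex \<open>x\<close> lies in the branch at \<open>w\<close> away from \<open>u\<close> exactly if \<open>w\<close> is on a shortest
  path from \<open>u\<close> to \<open>x\<close>, so the products are read off from the distances, which breadth-first rounds compute. The program
  consists of nested counting loops around single assignments, and all its memory
  cells hold at most \<open>(n + 9) ^ (n + 9)\<close>, a number with polynomially many digits.\<close>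

section \<open>Recursive trees as parent maps\<close>

text \<open>Values outside \<open>{2..n}\<close> are fixed by extensionality, which makes the set finite and of cardinality \<open>(n - 1)!\<close>.\<close>

definition parent_maps :: "nat \<Rightarrow> (nat \<Rightarrow> nat) set" where
  "parent_maps n = PiE {2..n} (\<lambda>i. {1..<i})"

definition tree_of :: "nat \<Rightarrow> (nat \<Rightarrow> nat) \<Rightarrow> edges" where
  "tree_of n f = (\<lambda>i. {f i, i}) ` {2..n}"

lemma parent_maps_1: "n \<le> 1 \<Longrightarrow> parent_maps n = {\<lambda>_. undefined}"
  by (simp add: parent_maps_def)

lemma finite_parent_maps: "finite (parent_maps n)"
  by (simp add: parent_maps_def finite_PiE)

lemma card_parent_maps: "card (parent_maps n) = fact (n - 1)"
proof -
  have "card (parent_maps n) = (\<Prod>i=2..n. i - 1)"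
    by (simp add: parent_maps_def card_PiE)
  also have "\<dots> = fact (n - 1)"
  proof (induction n)
    case (Suc n)
    show ?case
    proof (cases "n = 0")
      case False
      then have "{2..Suc n} = insert (Suc n) {2..n}" by auto
      then show ?thesis using Suc False by (simp add: fact_reduce)
    qed simp
  qed simp
  finally show ?thesis .
qed

lemma parent_maps_nonempty: "parent_maps n \<noteq> {}"
  using card_parent_maps[of n] by (metis card.empty fact_nonzero)

lemma parent_less:
  assumes "f \<in> parent_maps n" "2 \<le> i" "i \<le> n"
  shows "1 \<le> f i" "f i < i"
  using assms by (auto simp: parent_maps_def PiE_iff)

lemma parent_maps_Suc:
  assumes "1 \<le> n"
  shows "bij_betw (\<lambda>(f, i). f(Suc n := i)) (parent_maps n \<times> {1..n}) (parent_maps (Suc n))"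
proof -
  have "{2..Suc n} = insert (Suc n) {2..n}" using assms by auto
  then have eq: "parent_maps (Suc n) = (\<lambda>(i, f). f(Suc n := i)) ` ({1..n} \<times> parent_maps n)"
    unfolding parent_maps_def by (simp add: PiE_insert_eq atLeastLessThanSuc_atLeastAtMost)
  have "inj_on (\<lambda>(f, i). f(Suc n := i)) (parent_maps n \<times> {1..n})"
  proof (rule inj_onI, clarify)
    fix f i g j assume *: "f \<in> parent_maps n" "g \<in> parent_maps n" "f(Suc n := i) = g(Suc n := j)"
    have "f x = g x" for x
    proof (cases "x = Suc n")
      case True
      then have "f x = undefined" "g x = undefined"
        using *(1,2) by (auto simp: parent_maps_def PiE_def extensional_def)
      then show ?thesis by simp
    next
      case False then show ?thesis using fun_cong[OF *(3), of x] by simp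
    qed
    then show "f = g \<and> i = j" using fun_cong[OF *(3), of "Suc n"] by auto
  qed
  moreover have "(\<lambda>(f, i). f(Suc n := i)) ` (parent_maps n \<times> {1..n}) = parent_maps (Suc n)"
    unfolding eq by force
  ultimately show ?thesis by (simp add: bij_betw_def)
qed

lemma sum_parent_maps_Suc:
  assumes "1 \<le> n"
  shows "(\<Sum>f\<in>parent_maps (Suc n). F f) = (\<Sum>f\<in>parent_maps n. \<Sum>i=1..n. F (f(Suc n := i)))"
  by (subst sum.reindex_bij_betw[OF parent_maps_Suc[OF assms], symmetric])
     (simp add: sum.cartesian_product case_prod_unfold)

lemma tree_of_Suc:
  assumes "1 \<le> n"
  shows "tree_of (Suc n) (f(Suc n := i)) = insert {i, Suc n} (tree_of n f)"
proof -
  have "{2..Suc n} = insert (Suc n) {2..n}" using assms by auto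
  then show ?thesis by (auto simp: tree_of_def)
qed

lemma pair_pmf_of_set:
  assumes "finite A" "A \<noteq> {}" "finite B" "B \<noteq> {}"
  shows "pair_pmf (pmf_of_set A) (pmf_of_set B) = pmf_of_set (A \<times> B)"
proof (rule pmf_eqI)
  fix x :: "'a \<times> 'b"
  have "A \<times> B \<noteq> {}" "finite (A \<times> B)" using assms by auto
  then show "pmf (pair_pmf (pmf_of_set A) (pmf_of_set B)) x = pmf (pmf_of_set (A \<times> B)) x"
    using assms by (cases x) (simp add: pmf_pair pmf_of_set indicator_def card_cartesian_product)
qed

text \<open>The parents of \<open>2, \<dots>, n\<close> are independent and uniform, so the parent map is uniform on a product set.
  From here on probabilities are quotients of cardinalities.\<close>

lemma UA_uniform:
  assumes "2 \<le> n"
  shows "UA n = map_pmf (tree_of n) (pmf_of_set (parent_maps n))"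
  using assms
proof (induction n rule: dec_induct)
  case base
  have "parent_maps 2 = {(\<lambda>_. undefined)(2 := 1)}"
    by (simp add: parent_maps_def PiE_singleton[where A = "{2}"] extensional_def)
       (auto simp: PiE_def extensional_def Pi_def fun_eq_iff)
  then show ?case by (simp add: UA_2 tree_of_def pmf_of_set_singleton)
next
  case (step m)
  have "pmf_of_set (parent_maps (Suc m))
      = map_pmf (\<lambda>(f, i). f(Suc m := i)) (pmf_of_set (parent_maps m \<times> {1..m}))"
    using parent_maps_Suc[of m] step.hyps finite_parent_maps[of m] parent_maps_nonempty[of m]
    by (intro map_pmf_of_set_bij_betw[symmetric]) auto
  also have "pmf_of_set (parent_maps m \<times> {1..m})
      = pair_pmf (pmf_of_set (parent_maps m)) (pmf_of_set {1..m})"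
    using step.hyps finite_parent_maps[of m] parent_maps_nonempty[of m]
    by (intro pair_pmf_of_set[symmetric]) auto
  finally have "map_pmf (tree_of (Suc m)) (pmf_of_set (parent_maps (Suc m)))
     = map_pmf (\<lambda>(f, i). insert {i, Suc m} (tree_of m f))
         (pair_pmf (pmf_of_set (parent_maps m)) (pmf_of_set {1..m}))"
    using step.hyps by (simp add: map_pmf_comp case_prod_unfold tree_of_Suc del: fun_upd_apply)
  also have "\<dots> = UA (Suc m)"
    unfolding UA_Suc[OF step.hyps(1)] step.IH
    unfolding pair_pmf_def map_bind_pmf bind_map_pmf by (simp add: map_pmf_def bind_return_pmf)
  finally show ?case by simp
qed

definition samples :: "nat \<Rightarrow> ((nat \<Rightarrow> nat) \<times> (nat \<Rightarrow> nat)) set" where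
  "samples n = parent_maps n \<times> {\<sigma>. \<sigma> permutes {1..n}}"

lemma finite_samples: "finite (samples n)"
  by (simp add: samples_def finite_parent_maps finite_permutations)

lemma card_samples_pos: "card (samples n) > 0"
proof -
  have "id permutes {1..n}" by (simp add: permutes_id)
  then have "samples n \<noteq> {}" using parent_maps_nonempty[of n] unfolding samples_def by blast
  then show ?thesis using finite_samples card_gt_0_iff by blast
qed

text \<open>The outcomes in which the procedure, here a function of the edge set because \<open>n\<close> is fixed, does not return vertex \<open>k\<close>.\<close>

definition miss :: "nat \<Rightarrow> (edges \<Rightarrow> nat set) \<Rightarrow> nat \<Rightarrow> ((nat \<Rightarrow> nat) \<times> (nat \<Rightarrow> nat)) set" where
  "miss n S k = {(f, \<sigma>) \<in> samples n. \<sigma> k \<notin> S (relabel \<sigma> (tree_of n f))}"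

lemma finite_miss: "finite (miss n S k)"
  by (rule finite_subset[OF _ finite_samples[of n]]) (auto simp: miss_def)

lemma find_prob_eq:
  assumes "2 \<le> n"
  shows "find_prob H n = 1 - card (miss n (H n) 1) / card (samples n)"
proof -
  let ?P = "{\<sigma>. \<sigma> permutes {1..n}}"
  let ?E = "{(f, \<sigma>). \<sigma> 1 \<in> H n (relabel \<sigma> (tree_of n f))}"
  have fin: "finite ?P" "?P \<noteq> {}" by (auto simp: finite_permutations intro: permutes_id)
  have "pair_pmf (UA n) (pmf_of_set ?P)
     = map_pmf (\<lambda>(f, \<sigma>). (tree_of n f, \<sigma>)) (pair_pmf (pmf_of_set (parent_maps n)) (pmf_of_set ?P))"
    by (simp add: UA_uniform[OF assms] pair_map_pmf1 case_prod_unfold apfst_def map_prod_def)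
  also have "pair_pmf (pmf_of_set (parent_maps n)) (pmf_of_set ?P) = pmf_of_set (samples n)"
    unfolding samples_def
    using fin finite_parent_maps[of n] parent_maps_nonempty[of n] by (intro pair_pmf_of_set)
  finally have "find_prob H n = measure_pmf.prob (pmf_of_set (samples n)) ?E"
    unfolding find_prob_def by (simp add: vimage_def case_prod_unfold)
  also have "\<dots> = card (samples n \<inter> ?E) / card (samples n)"
    using finite_samples card_samples_pos[of n] by (intro measure_pmf_of_set) force+
  also have "card (samples n \<inter> ?E) = card (samples n) - card (samples n - ?E)"
    using finite_samples card_Diff_subset_Int[of "samples n" ?E] card_mono[OF finite_samples, of "samples n \<inter> ?E" n]
    by simp
  also have "real \<dots> = card (samples n) - real (card (samples n - ?E))"
    using card_mono[OF finite_samples, of "samples n - ?E" n] by auto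
  also have "samples n - ?E = miss n (H n) 1" by (auto simp: miss_def)
  finally show ?thesis using card_samples_pos[of n] by (simp add: field_simps)
qed

lemma labeled_tree_tree_of:
  assumes f: "f \<in> parent_maps n"
  shows "labeled_tree n (tree_of n f)"
  unfolding labeled_tree_def
proof (intro conjI)
  let ?R = "{(x, y). {x, y} \<in> tree_of n f}"
  show "tree_of n f \<subseteq> {{u, v} | u v. u \<in> {1..n} \<and> v \<in> {1..n} \<and> u \<noteq> v}"
  proof
    fix e assume "e \<in> tree_of n f"
    then obtain i where i: "2 \<le> i" "i \<le> n" "e = {f i, i}" by (auto simp: tree_of_def)
    then show "e \<in> {{u, v} | u v. u \<in> {1..n} \<and> v \<in> {1..n} \<and> u \<noteq> v}"
      using parent_less[OF f i(1,2)] by force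
  qed
  have root: "(u, 1) \<in> ?R\<^sup>*" if "u \<in> {1..n}" for u
    using that
  proof (induction u rule: less_induct)
    case (less u)
    show ?case
    proof (cases "u = 1")
      case False
      then have u: "2 \<le> u" "u \<le> n" using less.prems by auto
      then have "(u, f u) \<in> ?R" by (auto simp: tree_of_def insert_commute)
      moreover have "(f u, 1) \<in> ?R\<^sup>*"
        using less.IH[of "f u"] parent_less[OF f u] u by auto
      ultimately show ?thesis by (rule converse_rtrancl_into_rtrancl)
    qed simp
  qed
  have sym: "sym (?R\<^sup>*)" by (intro sym_rtrancl symI) (auto simp: insert_commute)
  show "\<forall>u\<in>{1..n}. \<forall>v\<in>{1..n}. (u, v) \<in> ?R\<^sup>*"
    using root sym by (meson rtrancl_trans symD)
  show "\<nexists>vs. is_cycle (tree_of n f) vs"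
  proof
    assume "\<exists>vs. is_cycle (tree_of n f) vs"
    then obtain vs where vs: "3 \<le> length vs" "distinct vs"
      and edge: "\<And>i. i < length vs \<Longrightarrow> {vs ! i, vs ! (Suc i mod length vs)} \<in> tree_of n f"
      by (auto simp: is_cycle_def)
    \<comment> \<open>The vertex of largest label on a cycle would have two neighbours of smaller label.\<close>
    define M where "M = Max (set vs)"
    have "M \<in> set vs" unfolding M_def using vs(1) by (intro Max_in) auto
    then obtain i where i: "i < length vs" "vs ! i = M" by (auto simp: in_set_conv_nth)
    have parent: "x = f M" if "{M, x} \<in> tree_of n f" "x \<in> set vs" "x \<noteq> M" for x
    proof -
      from that(1) obtain j where "j \<in> {2..n}" and e: "{M, x} = {f j, j}"
        unfolding tree_of_def by (rule imageE)
      then have j: "2 \<le> j" "j \<le> n" by auto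
      have "x \<le> M" unfolding M_def using that(2) by simp
      then show ?thesis using e parent_less[OF f j] that(3) by (auto simp: doubleton_eq_iff)
    qed
    define p where "p = (if i = 0 then length vs - 1 else i - 1)"
    define s where "s = Suc i mod length vs"
    have p: "p < length vs" "Suc p mod length vs = i" using i vs(1) by (auto simp: p_def)
    have s: "s < length vs" using vs(1) unfolding s_def by (intro mod_less_divisor) auto
    have ne: "p \<noteq> i" "s \<noteq> i" "p \<noteq> s"
      using i vs(1) by (auto simp: p_def s_def mod_Suc split: if_splits)
    have "vs ! p = f M"
      using edge[OF p(1)] p i ne vs(2) by (intro parent) (auto simp: insert_commute nth_eq_iff_index_eq)
    moreover have "vs ! s = f M"
      using edge[OF i(1)] s i ne vs(2) s_def[symmetric] by (intro parent) (auto simp: insert_commute nth_eq_iff_index_eq)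
    ultimately show False using p s ne vs(2) by (metis nth_eq_iff_index_eq)
  qed
qed

lemma relabel_edge_iff:
  assumes "inj \<sigma>"
  shows "{\<sigma> u, \<sigma> v} \<in> relabel \<sigma> E \<longleftrightarrow> {u, v} \<in> E"
proof -
  have "inj ((`) \<sigma>)" using assms by (simp add: inj_def inj_image_eq_iff)
  then show ?thesis unfolding relabel_def using inj_image_mem_iff[of "(`) \<sigma>" "{u, v}" E] by simp
qed

lemma relabel_relabel: "relabel \<sigma> (relabel \<tau> E) = relabel (\<sigma> \<circ> \<tau>) E"
  by (auto simp: relabel_def image_image image_comp)

text \<open>A procedure has to return \<open>K\<close> vertices only on trees, and it is always shown a relabelled one.\<close>

lemma labeled_tree_relabel:
  assumes T: "labeled_tree n T" and \<sigma>: "\<sigma> permutes {1..n}"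
  shows "labeled_tree n (relabel \<sigma> T)"
  unfolding labeled_tree_def
proof (intro conjI)
  note inj = permutes_inj[OF \<sigma>] and surj = permutes_surj[OF \<sigma>]
  note inS = permutes_in_image[OF \<sigma>]
  show "relabel \<sigma> T \<subseteq> {{u, v} | u v. u \<in> {1..n} \<and> v \<in> {1..n} \<and> u \<noteq> v}"
  proof
    fix e assume "e \<in> relabel \<sigma> T"
    then obtain d where d: "d \<in> T" "e = \<sigma> ` d" by (auto simp: relabel_def)
    then obtain u v where "d = {u, v}" "u \<in> {1..n}" "v \<in> {1..n}" "u \<noteq> v"
      using T unfolding labeled_tree_def by blast
    then have "e = {\<sigma> u, \<sigma> v}" "\<sigma> u \<in> {1..n}" "\<sigma> v \<in> {1..n}" "\<sigma> u \<noteq> \<sigma> v"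
      using d inj inS by (auto simp: inj_eq simp del: atLeastAtMost_iff)
    then show "e \<in> {{u, v} | u v. u \<in> {1..n} \<and> v \<in> {1..n} \<and> u \<noteq> v}" by blast
  qed
  have step: "(\<sigma> u, \<sigma> v) \<in> {(x, y). {x, y} \<in> relabel \<sigma> T}\<^sup>*" if "(u, v) \<in> {(x, y). {x, y} \<in> T}\<^sup>*" for u v
    using that
  proof induction
    case (step y z)
    then have "(\<sigma> y, \<sigma> z) \<in> {(x, y). {x, y} \<in> relabel \<sigma> T}" by (simp add: relabel_edge_iff[OF inj])
    with step.IH show ?case by (rule rtrancl_into_rtrancl)
  qed simp
  show "\<forall>u\<in>{1..n}. \<forall>v\<in>{1..n}. (u, v) \<in> {(x, y). {x, y} \<in> relabel \<sigma> T}\<^sup>*"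
  proof (intro ballI)
    fix u v assume "u \<in> {1..n}" "v \<in> {1..n}"
    moreover obtain u' v' where uv: "u = \<sigma> u'" "v = \<sigma> v'" using surj by (metis surjD)
    ultimately have "u' \<in> {1..n}" "v' \<in> {1..n}" using inS by blast+
    then have "(u', v') \<in> {(x, y). {x, y} \<in> T}\<^sup>*" using T unfolding labeled_tree_def by blast
    then show "(u, v) \<in> {(x, y). {x, y} \<in> relabel \<sigma> T}\<^sup>*" unfolding uv by (rule step)
  qed
  show "\<nexists>vs. is_cycle (relabel \<sigma> T) vs"
  proof
    assume "\<exists>vs. is_cycle (relabel \<sigma> T) vs"
    then obtain vs where vs: "is_cycle (relabel \<sigma> T) vs" by blast
    define us where "us = map (inv \<sigma>) vs"
    have "vs = map \<sigma> us" using surj by (simp add: us_def surj_f_inv_f map_idI)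
    then have nth: "vs ! i = \<sigma> (us ! i)" if "i < length us" for i using that by simp
    have len: "length vs = length us" and dist: "distinct us"
      using vs \<open>vs = map \<sigma> us\<close> by (auto simp: is_cycle_def distinct_map)
    have "{us ! i, us ! (Suc i mod length us)} \<in> T" if i: "i < length us" for i
    proof -
      have "Suc i mod length us < length us" using i by (intro mod_less_divisor) auto
      moreover have "{vs ! i, vs ! (Suc i mod length us)} \<in> relabel \<sigma> T"
        using vs i unfolding is_cycle_def len by blast
      ultimately show ?thesis using i relabel_edge_iff[OF inj] nth by simp
    qed
    then have "is_cycle T us" using vs len dist by (simp add: is_cycle_def)
    then show False using T by (auto simp: labeled_tree_def)
  qed
qed

section \<open>Moving the root, and the lower bound\<close>

text \<open>The test \<open>f k < k\<close> makes the recursion terminate for every \<open>f\<close>; a parent map satisfies it at every vertex but the root.\<close>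

function depth :: "(nat \<Rightarrow> nat) \<Rightarrow> nat \<Rightarrow> nat" where
  "depth f k = (if 1 < k \<and> f k < k then Suc (depth f (f k)) else 0)"
  by pat_completeness auto
termination by (relation "Wellfounded.measure snd") auto

text \<open>The child of the root whose subtree contains \<open>k\<close>.\<close>

function branch_top :: "(nat \<Rightarrow> nat) \<Rightarrow> nat \<Rightarrow> nat" where
  "branch_top f k = (if 1 < f k \<and> f k < k then branch_top f (f k) else k)"
  by pat_completeness auto
termination by (relation "Wellfounded.measure snd") auto

declare depth.simps [simp del] branch_top.simps [simp del]

lemma depth_1 [simp]: "depth f (Suc 0) = 0"
  by (simp add: depth.simps)

lemma depth_parent:
  assumes "f \<in> parent_maps n" "2 \<le> k" "k \<le> n"
  shows "depth f k = Suc (depth f (f k))"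
  using assms parent_less[OF assms] by (simp add: depth.simps[of f k])

text \<open>The cycle that gives label \<open>1\<close> to \<open>j\<close> and raises the labels \<open>1, \<dots>, j - 1\<close> by one, followed by its inverse.\<close>

definition to_front :: "nat \<Rightarrow> nat \<Rightarrow> nat" where
  "to_front j x = (if x = j then 1 else if 1 \<le> x \<and> x < j then Suc x else x)"

definition from_front :: "nat \<Rightarrow> nat \<Rightarrow> nat" where
  "from_front j y = (if y = 1 then j else if 2 \<le> y \<and> y \<le> j then y - 1 else y)"

lemma from_to_front: "1 \<le> j \<Longrightarrow> from_front j (to_front j x) = x"
  by (auto simp: to_front_def from_front_def)

lemma to_from_front: "1 \<le> j \<Longrightarrow> to_front j (from_front j x) = x"
  by (auto simp: to_front_def from_front_def)

lemma from_front_permutes: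
  assumes "1 \<le> j" "j \<le> n"
  shows "from_front j permutes {1..n}"
proof (rule bij_imp_permutes)
  show "bij_betw (from_front j) {1..n} {1..n}"
    by (rule bij_betwI[where g = "to_front j"])
       (use assms in \<open>auto simp: from_to_front to_from_front\<close>, auto simp: to_front_def from_front_def)
  show "from_front j x = x" if "x \<notin> {1..n}" for x
    using that assms by (auto simp: from_front_def)
qed

text \<open>The parent map of the tree after \<open>to_front j\<close>, for a child \<open>j\<close> of the root: the old root, now labelled \<open>2\<close>,
  hangs off the new one, and all other vertices keep their parents.\<close>

definition reroot :: "nat \<Rightarrow> nat \<Rightarrow> (nat \<Rightarrow> nat) \<Rightarrow> (nat \<Rightarrow> nat)" where
  "reroot n j f = restrict (\<lambda>y. if y = 2 then 1 else to_front j (f (from_front j y))) {2..n}"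

lemma reroot_at:
  assumes "2 \<le> j" "j \<le> n" "2 \<le> i" "i \<le> n" "i \<noteq> j"
  shows "to_front j i \<in> {3..n}" "reroot n j f (to_front j i) = to_front j (f i)"
proof -
  show *: "to_front j i \<in> {3..n}" using assms by (auto simp: to_front_def)
  show "reroot n j f (to_front j i) = to_front j (f i)"
    using * assms by (simp add: reroot_def from_to_front)
qed

text \<open>Only the edge between \<open>j\<close> and the root changes its orientation. On all other edges the parent stays the smaller end, since
  \<open>to_front j\<close> changes the relative order of \<open>j\<close> only, and moves it down.\<close>

lemma reroot_parent_maps:
  assumes f: "f \<in> parent_maps n" and j: "2 \<le> j" "j \<le> n" "f j = 1"
  shows "reroot n j f \<in> parent_maps n"
  unfolding parent_maps_def
proof (rule PiE_I)
  fix y assume y: "y \<in> {2..n}"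
  show "reroot n j f y \<in> {1..<y}"
  proof (cases "y = 2")
    case False
    define x where "x = from_front j y"
    have x: "2 \<le> x" "x \<le> n" "x \<noteq> j" "y = to_front j x"
      using y j False by (auto simp: x_def from_front_def to_front_def)
    show ?thesis
      using reroot_at(2)[OF j(1,2) x(1-3), of f] parent_less[OF f x(1,2)] x j
      unfolding x(4) by (auto simp: to_front_def)
  qed (use y in \<open>simp add: reroot_def\<close>)
qed (auto simp: reroot_def)

lemma tree_of_reroot:
  assumes f: "f \<in> parent_maps n" and j: "2 \<le> j" "j \<le> n" "f j = 1"
  shows "tree_of n (reroot n j f) = relabel (to_front j) (tree_of n f)"
proof -
  have split: "{2..n} = insert j ({2..n} - {j})" using j by auto
  have img: "{3..n} = to_front j ` ({2..n} - {j})"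
  proof
    show "{3..n} \<subseteq> to_front j ` ({2..n} - {j})"
    proof
      fix y assume "y \<in> {3..n}"
      then have "from_front j y \<in> {2..n} - {j}" "to_front j (from_front j y) = y"
        using j by (auto simp: from_front_def to_front_def)
      then show "y \<in> to_front j ` ({2..n} - {j})" by (metis imageI)
    qed
    show "to_front j ` ({2..n} - {j}) \<subseteq> {3..n}"
      by (rule image_subsetI, rule reroot_at(1)[OF j(1,2)]) auto
  qed
  have "{2..n} = insert 2 {3..n}" using j by auto
  then have "tree_of n (reroot n j f)
      = insert {1, 2} ((\<lambda>i. {reroot n j f i, i}) ` {3..n})"
    unfolding tree_of_def using j by (simp add: reroot_def)
  also have "(\<lambda>i. {reroot n j f i, i}) ` {3..n} = (\<lambda>i. {to_front j (f i), to_front j i}) ` ({2..n} - {j})"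
    unfolding img image_image using reroot_at(2)[OF j(1,2), of _ f] by (intro image_cong refl) auto
  also have "{1, 2} = {to_front j (f j), to_front j j}"
    using j by (auto simp: to_front_def)
  also have "insert \<dots> ((\<lambda>i. {to_front j (f i), to_front j i}) ` ({2..n} - {j}))
     = (\<lambda>i. {to_front j (f i), to_front j i}) ` insert j ({2..n} - {j})"
    by (rule image_insert[symmetric])
  also have "insert j ({2..n} - {j}) = {2..n}" by (rule split[symmetric])
  finally show ?thesis by (simp add: relabel_def tree_of_def image_image)
qed

lemma inj_on_reroot:
  assumes j: "2 \<le> j" "j \<le> n"
  shows "inj_on (reroot n j) {f \<in> parent_maps n. f j = 1}"
proof (rule inj_onI)
  fix f g assume fg: "f \<in> {f \<in> parent_maps n. f j = 1}" "g \<in> {f \<in> parent_maps n. f j = 1}"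
    and eq: "reroot n j f = reroot n j g"
  show "f = g"
  proof (rule PiE_ext)
    show "f \<in> PiE {2..n} (\<lambda>i. {1..<i})" "g \<in> PiE {2..n} (\<lambda>i. {1..<i})"
      using fg by (auto simp: parent_maps_def)
    fix i assume i: "i \<in> {2..n}"
    show "f i = g i"
    proof (cases "i = j")
      case False
      then have "to_front j (f i) = to_front j (g i)"
        using reroot_at(2)[OF j, of i f] reroot_at(2)[OF j, of i g] eq i by simp
      then show ?thesis using from_to_front[of j] j by (metis Suc_le_eq add_2_eq_Suc' le_Suc_ex trans_le_add1 le_trans one_le_numeral)
    qed (use fg in simp)
  qed
qed

lemma branch_top_props:
  assumes f: "f \<in> parent_maps n" and "2 \<le> k" "k \<le> n"
  shows "2 \<le> branch_top f k" "branch_top f k \<le> k" "f (branch_top f k) = 1"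
  proof -
  have "2 \<le> branch_top f k \<and> branch_top f k \<le> k \<and> f (branch_top f k) = 1"
    using assms(2,3)
  proof (induction k rule: less_induct)
    case (less k)
    note p = parent_less[OF f less.prems]
    show ?case
      using less.IH[of "f k"] less.prems p by (cases "f k = 1") (auto simp: branch_top.simps[of f k])
  qed
  then show "2 \<le> branch_top f k" "branch_top f k \<le> k" "f (branch_top f k) = 1" by auto
qed
lemma depth_reroot:
  assumes f: "f \<in> parent_maps n" and "2 \<le> k" "k \<le> n"
  defines "j \<equiv> branch_top f k"
  shows "depth f k = Suc (depth (reroot n j f) (to_front j k))"
  using assms(2,3) unfolding j_def
proof (induction k rule: less_induct)
  case (less k)
  note p = parent_less[OF f less.prems]
  note dk = depth_parent[OF f less.prems]
  show ?case
  proof (cases "f k = 1")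
    case True
    then have "branch_top f k = k" by (simp add: branch_top.simps)
    then show ?thesis using True dk by (simp add: to_front_def)
  next
    case False
    define j where "j = branch_top f (f k)"
    have top: "branch_top f k = j" using False p by (simp add: branch_top.simps[of f k] j_def)
    have fk: "2 \<le> f k" "f k \<le> n" "f k < k" using False p less.prems by auto
    have j: "2 \<le> j" "j \<le> f k" "f j = 1" unfolding j_def using branch_top_props[OF f fk(1,2)] by auto
    have IH: "depth f (f k) = Suc (depth (reroot n j f) (to_front j (f k)))"
      using less.IH[OF fk(3,1,2)] by (simp add: j_def)
    have tk: "to_front j k = k" using j fk by (simp add: to_front_def)
    have "depth (reroot n j f) k = Suc (depth (reroot n j f) (reroot n j f k))"
      using reroot_parent_maps[OF f j(1) _ j(3)] fk j less.prems by (intro depth_parent) auto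
    also have "reroot n j f k = to_front j (f k)"
      using reroot_at(2)[of j n k f] tk j fk less.prems by simp
    finally show ?thesis using top tk dk IH by simp
  qed
qed

text \<open>Rerooting at the child \<open>j\<close> of the root above \<open>k\<close> and composing \<open>\<sigma>\<close> with the inverse cycle does not change the tree that
  the procedure sees, nor the vertex \<open>\<sigma> k\<close>, but brings \<open>k\<close> one step closer to the root. For fixed \<open>j\<close> this is injective, and
  \<open>j \<in> {2..m}\<close>, so each step costs a factor of \<open>m - 1\<close>.\<close>

lemma card_miss_depth_le:
  assumes "m \<le> n" "1 \<le> k" "k \<le> m"
  shows "card {(f, \<sigma>) \<in> miss n S k. depth f k = d} \<le> (m - 1) ^ d * card (miss n S 1)"
  using assms
proof (induction d arbitrary: k)
  case 0
  have "{(f, \<sigma>) \<in> miss n S k. depth f k = 0} \<subseteq> miss n S 1"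
  proof (cases "k = 1")
    case False
    then show ?thesis using 0 depth_parent[of _ n k] by (auto simp: miss_def samples_def)
  qed auto
  then show ?case using card_mono[OF finite_miss] by simp
next
  case (Suc d)
  define X where "X j = {(f, \<sigma>) \<in> miss n S k. depth f k = Suc d \<and> branch_top f k = j}" for j
  have X_le: "card (X j) \<le> (m - 1) ^ d * card (miss n S 1)" if j: "j \<in> {2..m}" for j
  proof (cases "k = 1")
    case True
    then show ?thesis by (simp add: X_def)
  next
    case False
    define g :: "(nat \<Rightarrow> nat) \<times> (nat \<Rightarrow> nat) \<Rightarrow> (nat \<Rightarrow> nat) \<times> (nat \<Rightarrow> nat)"
      where "g = (\<lambda>(f, \<sigma>). (reroot n j f, \<sigma> \<circ> from_front j))"
    have jn: "2 \<le> j" "j \<le> n" and k: "2 \<le> k" "k \<le> n" using j Suc.prems False by auto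
    have Xf: "f \<in> parent_maps n" "f j = 1" "\<sigma> permutes {1..n}" if "(f, \<sigma>) \<in> X j" for f \<sigma>
      using that branch_top_props(3)[OF _ k] by (auto simp: X_def miss_def samples_def)
    have "inj_on g (X j)"
    proof (rule inj_onI, clarify)
      fix f \<sigma> f' \<sigma>' assume *: "(f, \<sigma>) \<in> X j" "(f', \<sigma>') \<in> X j" "g (f, \<sigma>) = g (f', \<sigma>')"
      then have "f = f'"
        using inj_onD[OF inj_on_reroot[OF jn], of f f'] Xf[OF *(1)] Xf[OF *(2)] by (auto simp: g_def)
      moreover have "\<sigma> x = \<sigma>' x" for x
      proof -
        have "(\<sigma> \<circ> from_front j) (to_front j x) = (\<sigma>' \<circ> from_front j) (to_front j x)"
          using *(3) by (simp add: g_def)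
        then show ?thesis using jn by (simp add: from_to_front)
      qed
      ultimately show "f = f' \<and> \<sigma> = \<sigma>'" by auto
    qed
    moreover have "g ` X j \<subseteq> {(f, \<sigma>) \<in> miss n S (to_front j k). depth f (to_front j k) = d}"
    proof clarify
      fix f \<sigma> h \<tau> assume *: "(f, \<sigma>) \<in> X j" "(h, \<tau>) = g (f, \<sigma>)"
      have h: "h = reroot n j f" "\<tau> = \<sigma> \<circ> from_front j" using *(2) by (auto simp: g_def)
      note f = Xf[OF *(1)]
      have "\<tau> \<circ> to_front j = \<sigma>" using jn by (auto simp: h from_to_front)
      then have "relabel \<tau> (tree_of n h) = relabel \<sigma> (tree_of n f)"
        unfolding h(1) tree_of_reroot[OF f(1) jn f(2)] relabel_relabel by simp
      moreover have "\<tau> (to_front j k) = \<sigma> k" using jn by (simp add: h from_to_front)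
      moreover have "h \<in> parent_maps n" unfolding h by (rule reroot_parent_maps[OF f(1) jn f(2)])
      moreover have "\<tau> permutes {1..n}"
        unfolding h using jn f(3) by (intro permutes_compose from_front_permutes) auto
      moreover have "depth h (to_front j k) = d"
        using depth_reroot[OF f(1) k] *(1) by (auto simp: X_def h)
      ultimately show "(h, \<tau>) \<in> miss n S (to_front j k) \<and> depth h (to_front j k) = d"
        using *(1) by (auto simp: X_def miss_def samples_def)
    qed
    moreover have "finite {(f, \<sigma>) \<in> miss n S (to_front j k). depth f (to_front j k) = d}"
      by (rule finite_subset[OF _ finite_miss]) auto
    ultimately have "card (X j) \<le> card {(f, \<sigma>) \<in> miss n S (to_front j k). depth f (to_front j k) = d}"
      using card_inj_on_le by blast
    also have "\<dots> \<le> (m - 1) ^ d * card (miss n S 1)"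
      using Suc.prems j by (intro Suc.IH) (auto simp: to_front_def)
    finally show ?thesis .
  qed
  have "{(f, \<sigma>) \<in> miss n S k. depth f k = Suc d} \<subseteq> (\<Union>j\<in>{2..m}. X j)"
  proof clarify
    fix f \<sigma> assume *: "(f, \<sigma>) \<in> miss n S k" "depth f k = Suc d"
    then have f: "f \<in> parent_maps n" and "k \<noteq> 1" by (auto simp: miss_def samples_def)
    then have "2 \<le> k" "k \<le> n" using Suc.prems by auto
    then have "branch_top f k \<in> {2..m}"
      using branch_top_props[OF f] Suc.prems by (meson atLeastAtMost_iff le_trans)
    then show "(f, \<sigma>) \<in> (\<Union>j\<in>{2..m}. X j)" using * by (auto simp: X_def)
  qed
  then have "card {(f, \<sigma>) \<in> miss n S k. depth f k = Suc d} \<le> card (\<Union>j\<in>{2..m}. X j)"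
    by (intro card_mono) (auto simp: X_def intro: finite_subset[OF _ finite_miss])
  also have "\<dots> \<le> (\<Sum>j\<in>{2..m}. card (X j))" by (intro card_UN_le) simp
  also have "\<dots> \<le> (\<Sum>j\<in>{2..m}. (m - 1) ^ d * card (miss n S 1))" by (intro sum_mono X_le)
  also have "\<dots> = (m - 1) ^ Suc d * card (miss n S 1)" by simp
  finally show ?case .
qed

lemma depth_fun_upd:
  assumes f: "f \<in> parent_maps n" and "k \<le> n"
  shows "depth (f(Suc n := i)) k = depth f k"
  using assms(2)
proof (induction k rule: less_induct)
  case (less k)
  then show ?case
    using parent_less[OF f, of k]
    by (subst (1 2) depth.simps) (auto simp del: fun_upd_apply simp: fun_upd_other)
qed

text \<open>The parent of \<open>n + 1\<close> is uniform on \<open>{1..n}\<close>, and averaging \<open>2 * i\<close> over \<open>i \<le> n\<close> gives \<open>n + 1\<close>.\<close>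

lemma sum_power2_depth:
  assumes "1 \<le> k" "k \<le> n"
  shows "(\<Sum>f\<in>parent_maps n. 2 ^ depth f k) = k * card (parent_maps n)"
  using assms
proof (induction n arbitrary: k)
  case (Suc n)
  show ?case
  proof (cases "n = 0")
    case True
    then show ?thesis using Suc.prems by (simp add: parent_maps_1)
  next
    case False
    then have n: "1 \<le> n" by simp
    have card: "card (parent_maps (Suc n)) = n * card (parent_maps n)"
      using n by (simp add: card_parent_maps fact_reduce)
    have *: "(\<Sum>f\<in>parent_maps (Suc n). 2 ^ depth f k)
        = (\<Sum>f\<in>parent_maps n. \<Sum>i=1..n. (2::nat) ^ depth (f(Suc n := i)) k)"
      by (rule sum_parent_maps_Suc[OF n])
    show ?thesis
    proof (cases "k = Suc n")
      case False
      then have k: "k \<le> n" using Suc.prems by simp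
      show ?thesis unfolding * card
        using Suc.IH[OF Suc.prems(1) k] depth_fun_upd[OF _ k]
        by (simp add: sum_distrib_left[symmetric])
    next
      case True
      have "depth (f(Suc n := i)) k = Suc (depth f i)" if "f \<in> parent_maps n" "i \<in> {1..n}" for f i
        using that depth_fun_upd[of f n i i] n True by (subst depth.simps) auto
      then have "(\<Sum>f\<in>parent_maps n. \<Sum>i=1..n. (2::nat) ^ depth (f(Suc n := i)) k)
          = (\<Sum>f\<in>parent_maps n. \<Sum>i=1..n. 2 * 2 ^ depth f i)"
        by (intro sum.cong refl) simp
      also have "\<dots> = (\<Sum>i=1..n. 2 * (\<Sum>f\<in>parent_maps n. 2 ^ depth f i))"
        by (subst sum.swap) (simp add: sum_distrib_left)
      also have "\<dots> = (\<Sum>i=1..n. 2 * (i * card (parent_maps n)))"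
        using Suc.IH by (intro sum.cong refl) auto
      also have "\<dots> = 2 * (\<Sum>i=1..n. i) * card (parent_maps n)"
        by (simp add: sum_distrib_left sum_distrib_right mult.assoc)
      also have "2 * (\<Sum>i=1..n. i) = n * Suc n"
        using gauss_sum_from_Suc_0[of n, where 'a = nat] by simp
      finally show ?thesis unfolding * card using True by (simp add: algebra_simps del: fun_upd_apply)
    qed
  qed
qed simp

lemma card_deep_le:
  assumes "1 \<le> k" "k \<le> n"
  shows "2 ^ Suc D * card {(f, \<sigma>) \<in> samples n. D < depth f k} \<le> k * card (samples n)"
proof -
  let ?P = "{\<sigma>. \<sigma> permutes {1..n}}"
  have "{(f, \<sigma>) \<in> samples n. D < depth f k} = {f \<in> parent_maps n. D < depth f k} \<times> ?P"
    by (auto simp: samples_def)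
  moreover have "2 ^ Suc D * card {f \<in> parent_maps n. D < depth f k}
      \<le> (\<Sum>f\<in>{f \<in> parent_maps n. D < depth f k}. 2 ^ depth f k)"
  proof -
    have "(\<Sum>f\<in>{f \<in> parent_maps n. D < depth f k}. (2::nat) ^ Suc D)
      \<le> (\<Sum>f\<in>{f \<in> parent_maps n. D < depth f k}. 2 ^ depth f k)"
      by (intro sum_mono power_increasing) auto
    then show ?thesis by (simp add: mult.commute)
  qed
  moreover have "\<dots> \<le> (\<Sum>f\<in>parent_maps n. 2 ^ depth f k)"
    using finite_parent_maps by (intro sum_mono2) auto
  ultimately show ?thesis
    unfolding sum_power2_depth[OF assms]
    by (simp add: samples_def card_cartesian_product mult.assoc[symmetric] del: power_Suc)
qed

lemma sum_miss:
  assumes S: "\<And>T. labeled_tree n T \<Longrightarrow> card (S T) = K \<and> finite (S T)" and "m \<le> n"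
  shows "(m - K) * card (samples n) \<le> (\<Sum>k=1..m. card (miss n S k))"
proof -
  have "(m - K) * card (samples n) = (\<Sum>x\<in>samples n. m - K)" by simp
  also have "\<dots> \<le> (\<Sum>x\<in>samples n. card {k \<in> {1..m}. x \<in> miss n S k})"
  proof (rule sum_mono, clarify)
    fix f \<sigma> assume x: "(f, \<sigma>) \<in> samples n"
    then have f: "f \<in> parent_maps n" and \<sigma>: "\<sigma> permutes {1..n}" by (auto simp: samples_def)
    let ?S = "S (relabel \<sigma> (tree_of n f))"
    have K: "card ?S = K" "finite ?S"
      using S labeled_tree_relabel[OF labeled_tree_tree_of[OF f] \<sigma>] by blast+
    have "card {k \<in> {1..m}. \<sigma> k \<in> ?S} \<le> K"
      unfolding K(1)[symmetric] using K(2) permutes_inj_on[OF \<sigma>]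
      by (intro card_inj_on_le[of \<sigma>]) auto
    moreover have "m = card {k \<in> {1..m}. \<sigma> k \<in> ?S} + card {k \<in> {1..m}. \<sigma> k \<notin> ?S}"
      by (subst card_Un_disjoint[symmetric]) (auto intro!: arg_cong[where f = card, of "{1..m}", simplified])
    moreover have "{k \<in> {1..m}. (f, \<sigma>) \<in> miss n S k} = {k \<in> {1..m}. \<sigma> k \<notin> ?S}"
      using x by (auto simp: miss_def)
    ultimately show "m - K \<le> card {k \<in> {1..m}. (f, \<sigma>) \<in> miss n S k}" by simp
  qed
  also have "\<dots> = (\<Sum>k=1..m. card {x \<in> samples n. x \<in> miss n S k})"
    using sum_multicount_gen[of "samples n" "{1..m}" "\<lambda>x k. x \<in> miss n S k" "\<lambda>k. card {x \<in> samples n. x \<in> miss n S k}"]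
    by (simp add: finite_samples)
  also have "\<dots> = (\<Sum>k=1..m. card (miss n S k))"
    by (intro sum.cong refl arg_cong[where f = card]) (auto simp: miss_def)
  finally show ?thesis .
qed

lemma sum_power_le: "1 \<le> m \<Longrightarrow> (\<Sum>d\<le>D. (m - 1) ^ d) \<le> (m::nat) ^ D"
proof (induction D)
  case (Suc D)
  then have "(\<Sum>d\<le>Suc D. (m - 1) ^ d) \<le> m ^ D + (m - 1) * (m - 1) ^ D" by simp
  also have "\<dots> \<le> m ^ D + (m - 1) * m ^ D" by (intro add_mono mult_mono power_mono) auto
  also have "\<dots> = m ^ Suc D" using Suc.prems by (cases m) auto
  finally show ?case .
qed simp

text \<open>The condition on \<open>D\<close> makes depths beyond \<open>D\<close> have probability at most \<open>1 / 4\<close> for each of the first \<open>2 * K\<close> vertices, while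
  their average probability of being missed is at least \<open>1 / 2\<close>.\<close>

lemma error_ge:
  assumes S: "\<And>T. labeled_tree n T \<Longrightarrow> card (S T) = K \<and> finite (S T)"
    and K: "1 \<le> K" "2 * K \<le> n" and D: "8 * K \<le> 2 ^ Suc D"
  shows "card (samples n) \<le> 4 * (2 * K) ^ D * card (miss n S 1)"
proof -
  define N where "N = card (samples n)"
  define m where "m = 2 * K"
  have one: "4 * card (miss n S k) \<le> 4 * (m ^ D * card (miss n S 1)) + N" if k: "k \<in> {1..m}" for k
  proof -
    let ?E = "\<lambda>d. {(f, \<sigma>) \<in> miss n S k. depth f k = d}"
    let ?F = "{(f, \<sigma>) \<in> samples n. D < depth f k}"
    have "miss n S k \<subseteq> (\<Union>d\<in>{..D}. ?E d) \<union> ?F"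
      by (auto simp: miss_def)
    then have "card (miss n S k) \<le> card ((\<Union>d\<in>{..D}. ?E d) \<union> ?F)"
      by (intro card_mono) (auto intro: finite_subset[OF _ finite_miss] finite_subset[OF _ finite_samples])
    also have "\<dots> \<le> card (\<Union>d\<in>{..D}. ?E d) + card ?F" by (rule card_Un_le)
    also have "card (\<Union>d\<in>{..D}. ?E d) \<le> (\<Sum>d\<le>D. card (?E d))" by (intro card_UN_le) simp
    also have "\<dots> \<le> (\<Sum>d\<le>D. (m - 1) ^ d * card (miss n S 1))"
      using k K m_def by (intro sum_mono card_miss_depth_le) auto
    also have "\<dots> \<le> m ^ D * card (miss n S 1)"
      unfolding sum_distrib_right[symmetric] using K m_def by (intro mult_right_mono sum_power_le) auto
    finally have "card (miss n S k) \<le> m ^ D * card (miss n S 1) + card ?F" by simp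
    moreover have "4 * card ?F \<le> N"
    proof -
      have "8 * K * card ?F \<le> 2 ^ Suc D * card ?F" by (intro mult_right_mono D) simp
      also have "\<dots> \<le> k * N" unfolding N_def using k K m_def by (intro card_deep_le) auto
      also have "\<dots> \<le> 2 * K * N" using k m_def by (intro mult_right_mono) auto
      finally have "(2 * K) * (4 * card ?F) \<le> (2 * K) * N" by (simp add: mult_ac)
      then show ?thesis using K by (subst (asm) mult_le_cancel1) auto
    qed
    ultimately show ?thesis by simp
  qed
  have "4 * (K * N) \<le> (\<Sum>k=1..m. 4 * card (miss n S k))"
    using sum_miss[of n S K m] S K m_def N_def by (simp add: sum_distrib_left[symmetric])
  also have "\<dots> \<le> (\<Sum>k=1..m. 4 * (m ^ D * card (miss n S 1)) + N)" by (intro sum_mono one)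
  also have "\<dots> = 2 * K * (4 * (m ^ D * card (miss n S 1)) + N)" by (simp add: m_def)
  finally have "(2 * K) * (2 * N) \<le> (2 * K) * (4 * (m ^ D * card (miss n S 1)) + N)" by (simp add: mult_ac)
  then have "2 * N \<le> 4 * (m ^ D * card (miss n S 1)) + N" using K by (subst (asm) mult_le_cancel1) auto
  then show ?thesis by (simp add: N_def m_def mult.assoc)
qed

text \<open>For \<open>K = 1\<close> the general bound is too weak to contradict \<open>\<epsilon> < 1 / e\<close>. It is enough to compare the
  vertices \<open>1\<close> and \<open>2\<close>, which play symmetric roles.\<close>

lemma error_ge_singleton:
  assumes S: "\<And>T. labeled_tree n T \<Longrightarrow> card (S T) = 1 \<and> finite (S T)" and "2 \<le> n"
  shows "card (samples n) \<le> 2 * card (miss n S 1)"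
proof -
  have "(2 - 1) * card (samples n) \<le> (\<Sum>k=1..2. card (miss n S k))"
    using S assms(2) by (intro sum_miss) auto
  also have "\<dots> = card (miss n S 1) + card (miss n S 2)"
    by (simp add: numeral_2_eq_2)
  also have "miss n S 2 = {(f, \<sigma>) \<in> miss n S 2. depth f 2 = 1}"
  proof -
    have "depth f 2 = 1" if "f \<in> parent_maps n" for f
    proof -
      have "f 2 = 1" using parent_less[OF that, of 2] assms(2) by simp
      then show ?thesis using depth_parent[OF that, of 2] assms(2) by simp
    qed
    then show ?thesis by (auto simp: miss_def samples_def)
  qed
  also have "card \<dots> \<le> (2 - 1) ^ 1 * card (miss n S 1)"
    using assms(2) by (intro card_miss_depth_le) auto
  finally show ?thesis by simp
qed

lemma root_finding_error_ge:
  assumes H: "root_finding K \<epsilon> H" and K: "1 \<le> K" and D: "8 * K \<le> 2 ^ Suc D"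
  shows "1 / (4 * (2 * real K) ^ D) \<le> \<epsilon>" and "K = 1 \<Longrightarrow> 1 / 2 \<le> \<epsilon>"
proof -
  have main: "\<delta> \<le> \<epsilon>" if \<delta>: "\<And>n. n0 \<le> n \<Longrightarrow> \<delta> * card (samples n) \<le> card (miss n (H n) 1)" and n0: "2 \<le> n0" for \<delta> :: real and n0
  proof -
    have "find_prob H n \<le> 1 - \<delta>" if "n0 \<le> n" for n
    proof -
      have "find_prob H n = 1 - card (miss n (H n) 1) / card (samples n)"
        using n0 that by (intro find_prob_eq) simp
      moreover have "\<delta> \<le> card (miss n (H n) 1) / card (samples n)"
        using \<delta>[OF that] card_samples_pos[of n] by (simp add: pos_le_divide_eq)
      ultimately show ?thesis by simp
    qed
    then have "\<forall>\<^sub>F n in sequentially. ereal (find_prob H n) \<le> ereal (1 - \<delta>)"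
      by (auto simp: eventually_sequentially)
    then have "limsup (\<lambda>n. ereal (find_prob H n)) \<le> ereal (1 - \<delta>)" by (rule Limsup_bounded)
    then have "liminf (\<lambda>n. ereal (find_prob H n)) \<le> ereal (1 - \<delta>)"
      by (meson Liminf_le_Limsup order_trans trivial_limit_sequentially)
    moreover have "ereal (1 - \<epsilon>) \<le> liminf (\<lambda>n. ereal (find_prob H n))"
      using H unfolding root_finding_def by blast
    ultimately have "ereal (1 - \<epsilon>) \<le> ereal (1 - \<delta>)" by (rule order_trans[rotated])
    then show ?thesis by simp
  qed
  have S: "card (H n T) = K \<and> finite (H n T)" if "K \<le> n" "labeled_tree n T" for n T
    using H that finite_subset[of "H n T" "{1..n}"] unfolding root_finding_def by auto
  show "1 / (4 * (2 * real K) ^ D) \<le> \<epsilon>"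
  proof (rule main[of "2 * K"])
    fix n assume n: "2 * K \<le> n"
    have "card (samples n) \<le> 4 * (2 * K) ^ D * card (miss n (H n) 1)"
      using n K D S by (intro error_ge) auto
    then have "real (card (samples n)) \<le> real (4 * (2 * K) ^ D * card (miss n (H n) 1))"
      by (simp only: of_nat_le_iff)
    then show "1 / (4 * (2 * real K) ^ D) * card (samples n) \<le> card (miss n (H n) 1)"
      using K by (simp add: field_simps)
  qed (use K in simp)
  show "1 / 2 \<le> \<epsilon>" if "K = 1"
  proof (rule main[of 2])
    fix n :: nat assume n: "2 \<le> n"
    have "card (samples n) \<le> 2 * card (miss n (H n) 1)"
      using n S that by (intro error_ge_singleton) auto
    then show "1 / 2 * real (card (samples n)) \<le> card (miss n (H n) 1)" by simp
  qed simp
qed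

lemma root_finding_lower_bound:
  fixes \<epsilon> :: real
  assumes \<epsilon>: "0 < \<epsilon>" "\<epsilon> < 1 / exp 1" and K: "1 \<le> K" and H: "root_finding K \<epsilon> H"
  shows "exp (1 / 4 * sqrt (ln (1 / \<epsilon>))) \<le> real K"
proof -
  have "K \<noteq> 1"
  proof
    assume "K = 1"
    moreover obtain D :: nat where "8 * K \<le> 2 ^ Suc D"
      using less_exp[of "8 * K"] by (metis less_or_eq_imp_le order_trans power_increasing one_le_numeral le_SucI order_refl)
    ultimately have "1 / 2 \<le> \<epsilon>" using root_finding_error_ge(2)[OF H K] by simp
    moreover have "1 / exp 1 < (1 / 2 :: real)"
      using exp_ge_add_one_self[of 1] exp_gt_one[of 1] e_approx_32 by (simp add: field_simps abs_if split: if_splits)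
    ultimately show False using \<epsilon> by simp
  qed
  \<comment> \<open>With \<open>l = ln K\<close> and \<open>D = O(l)\<close>, both factors of \<open>D * ln (2 * K)\<close> are \<open>O(l)\<close>; the constants use \<open>l \<ge> 2 / 3\<close>.\<close>
  then have K2: "2 \<le> K" using K by simp
  define l where "l = ln (real K)"
  have "ln 2 \<ge> (2/3 :: real)" using ln2_ge_two_thirds by simp
  moreover have "ln 2 \<le> l" using K2 by (simp add: l_def)
  ultimately have l: "2/3 \<le> l" by simp
  \<comment> \<open>The least \<open>D\<close> with \<open>8 * K \<le> 2 ^ Suc D\<close>.\<close>
  define D where "D = nat \<lceil>log 2 (4 * real K)\<rceil>"
  have log: "log 2 (4 * real K) = 2 + log 2 K"
    using K by (simp add: log_mult) (simp add: log_def ln_realpow[of 2 2, simplified])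
  have logK: "log 2 (real K) \<le> 3/2 * l" "0 \<le> log 2 (real K)"
    using l K \<open>ln 2 \<ge> 2/3\<close> by (auto simp: log_def l_def[symmetric] field_simps)
  have "8 * real K \<le> 2 ^ Suc D"
  proof -
    have "4 * real K = 2 powr log 2 (4 * real K)" using K by simp
    also have "\<dots> \<le> 2 powr real D"
      unfolding D_def by (intro powr_mono of_nat_ceiling) auto
    finally show ?thesis by (simp add: powr_realpow)
  qed
  then have "real (8 * K) \<le> real (2 ^ Suc D)" by simp
  then have D: "8 * K \<le> 2 ^ Suc D" by (simp only: of_nat_le_iff)
  have "real D \<le> 3 + log 2 K" unfolding D_def using log logK by linarith
  also have "\<dots> \<le> 6 * l" using l logK by simp
  finally have D6: "real D \<le> 6 * l" .
  have "1 / (4 * (2 * real K) ^ D) \<le> \<epsilon>" using root_finding_error_ge(1)[OF H K D] .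
  then have "1 / \<epsilon> \<le> 4 * (2 * real K) ^ D" using \<epsilon> K by (simp add: field_simps)
  then have "ln (1 / \<epsilon>) \<le> ln (4 * (2 * real K) ^ D)" using \<epsilon> K by (subst ln_le_cancel_iff) auto
  also have "\<dots> = ln 4 + D * (ln 2 + l)" using K by (simp add: ln_mult ln_realpow l_def algebra_simps)
  also have "\<dots> \<le> 2 * l + (6 * l) * (l + l)"
    using D6 l \<open>ln 2 \<le> l\<close> ln_realpow[of 2 2] by (intro add_mono mult_mono) auto
  also have "\<dots> \<le> (4 * l)\<^sup>2" using l by (simp add: power2_eq_square algebra_simps)
  finally have "sqrt (ln (1 / \<epsilon>)) \<le> 4 * l" using l by (intro real_le_lsqrt) auto
  then have "exp (1 / 4 * sqrt (ln (1 / \<epsilon>))) \<le> exp l" by simp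
  also have "exp l = real K" using K by (simp add: l_def)
  finally show ?thesis .
qed

section \<open>Recursive trees as binary trees\<close>

text \<open>In \<open>Nd a b\<close> the tree \<open>a\<close> encodes the subtree of the first child of the root and \<open>b\<close> the tree without this
  subtree, so that \<open>a\<close> and \<open>b\<close> are joined by the edge between their roots, and the root of \<open>Nd a b\<close> is that of \<open>b\<close>.\<close>

datatype (leaves: 'a) bt = Lf 'a | Nd "'a bt" "'a bt"

fun nleaves :: "'a bt \<Rightarrow> nat" where
  "nleaves (Lf x) = 1"
| "nleaves (Nd a b) = nleaves a + nleaves b"

fun distinct_leaves :: "'a bt \<Rightarrow> bool" where
  "distinct_leaves (Lf x) = True"
| "distinct_leaves (Nd a b) \<longleftrightarrow> distinct_leaves a \<and> distinct_leaves b \<and> leaves a \<inter> leaves b = {}"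

fun bt_root :: "'a bt \<Rightarrow> 'a" where
  "bt_root (Lf x) = x"
| "bt_root (Nd a b) = bt_root b"

fun bt_edges :: "'a bt \<Rightarrow> 'a set set" where
  "bt_edges (Lf x) = {}"
| "bt_edges (Nd a b) = insert {bt_root a, bt_root b} (bt_edges a \<union> bt_edges b)"

text \<open>Attaching a new vertex \<open>j\<close> to \<open>i\<close>: the youngest child of \<open>i\<close> is split off last, right above the leaf \<open>i\<close>.\<close>

fun split_leaf :: "'a \<Rightarrow> 'a \<Rightarrow> 'a bt \<Rightarrow> 'a bt" where
  "split_leaf i j (Lf x) = (if x = i then Nd (Lf j) (Lf x) else Lf x)"
| "split_leaf i j (Nd a b) = Nd (split_leaf i j a) (split_leaf i j b)"

fun bt_of :: "(nat \<Rightarrow> nat) \<Rightarrow> nat \<Rightarrow> nat bt" where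
  "bt_of f 0 = Lf 1"
| "bt_of f (Suc n) = (if n = 0 then Lf 1 else split_leaf (f (Suc n)) (Suc n) (bt_of f n))"

lemma nleaves_pos: "0 < nleaves B"
  by (induction B) auto

lemma finite_leaves: "finite (leaves B)"
  by (induction B) auto

lemma card_leaves: "distinct_leaves B \<Longrightarrow> card (leaves B) = nleaves B"
  by (induction B) (auto simp: card_Un_disjoint finite_leaves)

lemma nleaves_map [simp]: "nleaves (map_bt g B) = nleaves B"
  by (induction B) auto

lemma bt_root_in_leaves: "bt_root B \<in> leaves B"
  by (induction B) auto

lemma split_leaf_id: "i \<notin> leaves B \<Longrightarrow> split_leaf i j B = B"
  by (induction B) auto

lemma leaves_split_leaf: "i \<in> leaves B \<Longrightarrow> leaves (split_leaf i j B) = insert j (leaves B)"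
proof (induction B)
  case (Nd a b)
  then show ?case
    by (cases "i \<in> leaves a"; cases "i \<in> leaves b") (auto simp: split_leaf_id)
qed auto

lemma distinct_split_leaf:
  "distinct_leaves B \<Longrightarrow> j \<notin> leaves B \<Longrightarrow> distinct_leaves (split_leaf i j B)"
proof (induction B)
  case (Nd a b)
  then show ?case
    by (cases "i \<in> leaves a"; cases "i \<in> leaves b") (auto simp: split_leaf_id leaves_split_leaf)
qed auto

lemma bt_root_split_leaf: "bt_root (split_leaf i j B) = bt_root B"
  by (induction B) auto

lemma bt_edges_split_leaf:
  "i \<in> leaves B \<Longrightarrow> bt_edges (split_leaf i j B) = insert {i, j} (bt_edges B)"
proof (induction B)
  case (Nd a b)
  then show ?case
    by (cases "i \<in> leaves a"; cases "i \<in> leaves b")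
       (auto simp: split_leaf_id leaves_split_leaf bt_root_split_leaf)
qed (auto simp: insert_commute)

lemma bt_of_props:
  assumes "1 \<le> n" "f \<in> parent_maps n"
  shows "leaves (bt_of f n) = {1..n}" "distinct_leaves (bt_of f n)" "bt_root (bt_of f n) = 1"
    "bt_edges (bt_of f n) = tree_of n f"
proof -
  have "leaves (bt_of f k) = {1..k} \<and> distinct_leaves (bt_of f k) \<and> bt_root (bt_of f k) = 1
     \<and> bt_edges (bt_of f k) = tree_of k f" if "1 \<le> k" "k \<le> n" for k
    using that
  proof (induction k rule: dec_induct)
    case base
    show ?case by (simp add: tree_of_def)
  next
    case (step k)
    then have "f (Suc k) \<in> {1..k}" using parent_less[OF assms(2), of "Suc k"] by auto
    moreover have "tree_of (Suc k) f = insert {f (Suc k), Suc k} (tree_of k f)"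
      using tree_of_Suc[OF step.hyps(1), of f "f (Suc k)"] by simp
    ultimately show ?case using step
      by (auto simp: leaves_split_leaf distinct_split_leaf bt_root_split_leaf bt_edges_split_leaf)
  qed
  then show "leaves (bt_of f n) = {1..n}" "distinct_leaves (bt_of f n)" "bt_root (bt_of f n) = 1"
    "bt_edges (bt_of f n) = tree_of n f" using assms by auto
qed

lemma bt_of_fun_upd: "k \<le> n \<Longrightarrow> bt_of (f(Suc n := i)) k = bt_of f k"
  by (induction k) auto

section \<open>The law of the shape of a recursive tree\<close>

text \<open>The expectation of \<open>F\<close> for the random binary tree with \<open>n\<close> leaves whose splits are uniform: the left part
  has \<open>k\<close> leaves with probability \<open>1 / (n - 1)\<close>, and the two parts are independent of the same kind.\<close>

function shape_mean :: "nat \<Rightarrow> (unit bt \<Rightarrow> real) \<Rightarrow> real" where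
  "shape_mean n F = (if n \<le> 1 then F (Lf ())
     else (\<Sum>k=1..<n. shape_mean k (\<lambda>a. shape_mean (n - k) (\<lambda>b. F (Nd a b)))) / (real n - 1))"
  by pat_completeness auto
termination by (relation "Wellfounded.measure fst") auto

declare shape_mean.simps [simp del]

text \<open>The effect of attaching one more vertex on the shape, summed over all choices of its parent.\<close>

fun split_sum :: "(unit bt \<Rightarrow> real) \<Rightarrow> unit bt \<Rightarrow> real" where
  "split_sum F (Lf x) = F (Nd (Lf x) (Lf x))"
| "split_sum F (Nd a b) = split_sum (\<lambda>a'. F (Nd a' b)) a + split_sum (\<lambda>b'. F (Nd a b')) b"

lemma shape_mean_1: "shape_mean (Suc 0) F = F (Lf ())"
  by (simp add: shape_mean.simps)

lemma shape_mean_rec: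
  "2 \<le> n \<Longrightarrow> shape_mean n F =
    (\<Sum>k=1..<n. shape_mean k (\<lambda>a. shape_mean (n - k) (\<lambda>b. F (Nd a b)))) / (real n - 1)"
  by (subst shape_mean.simps) simp

lemma shape_mean_linear: "shape_mean n (\<lambda>a. c * F a + G a) = c * shape_mean n F + shape_mean n G"
proof (induction n arbitrary: F G rule: less_induct)
  case (less n)
  show ?case
  proof (cases "n \<le> 1")
    case False
    then have n: "2 \<le> n" by simp
    show ?thesis unfolding shape_mean_rec[OF n] using less.IH
      by (simp add: sum.distrib add_divide_distrib sum_distrib_left)
  qed (simp add: shape_mean.simps)
qed

lemma shape_mean_const: "shape_mean n (\<lambda>a. c) = c"
proof (induction n rule: less_induct)
  case (less n)
  show ?case
  proof (cases "n \<le> 1")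
    case False
    then have n: "2 \<le> n" by simp
    show ?thesis unfolding shape_mean_rec[OF n] using less.IH n
      by (simp add: of_nat_diff)
  qed (simp add: shape_mean.simps)
qed

lemma shape_mean_add: "shape_mean n (\<lambda>a. F a + G a) = shape_mean n F + shape_mean n G"
  using shape_mean_linear[of n 1 F G] by simp

lemma shape_mean_mult: "shape_mean n (\<lambda>a. c * F a) = c * shape_mean n F"
  using shape_mean_linear[of n c F "\<lambda>_. 0"] by (simp add: shape_mean_const)

lemma shape_mean_cong:
  assumes "1 \<le> n" "\<And>a. nleaves a = n \<Longrightarrow> F a = G a"
  shows "shape_mean n F = shape_mean n G"
  using assms
proof (induction n arbitrary: F G rule: less_induct)
  case (less n)
  show ?case
  proof (cases "n = 1")
    case False
    then have n: "2 \<le> n" using less.prems by simp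
    have "shape_mean k (\<lambda>a. shape_mean (n - k) (\<lambda>b. F (Nd a b)))
        = shape_mean k (\<lambda>a. shape_mean (n - k) (\<lambda>b. G (Nd a b)))" if "k \<in> {1..<n}" for k
      using that by (intro less.IH less.prems) auto
    then show ?thesis unfolding shape_mean_rec[OF n] by simp
  qed (use less.prems in \<open>simp add: shape_mean_1\<close>)
qed

lemma shape_mean_split_sum: "shape_mean n (\<lambda>b. split_sum (F b) a) = split_sum (\<lambda>a'. shape_mean n (\<lambda>b. F b a')) a"
  by (induction a arbitrary: F) (auto simp: shape_mean_add)

text \<open>Splitting a uniformly chosen leaf preserves the family of uniformly splitting trees. The chosen leaf is on the left with
  probability \<open>k / n\<close>, so the new left part has size \<open>k\<close> with weight proportional to
  \<open>(k - 1) + (n - k)\<close>, which does not depend on \<open>k\<close>.\<close>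

lemma shape_mean_Suc:
  assumes "1 \<le> n"
  shows "shape_mean n (split_sum F) = n * shape_mean (Suc n) F"
  using assms
proof (induction n arbitrary: F rule: less_induct)
  case (less n)
  show ?case
  proof (cases "n = 1")
    case True
    then show ?thesis by (simp add: shape_mean_1 shape_mean_rec)
  next
    case False
    then have n: "2 \<le> n" using less.prems by simp
    define T where "T i j = shape_mean i (\<lambda>a. shape_mean j (\<lambda>b. F (Nd a b)))" for i j
    have summand: "shape_mean k (\<lambda>a. shape_mean (n - k) (\<lambda>b. split_sum F (Nd a b)))
       = k * T (Suc k) (n - k) + (n - k) * T k (Suc n - k)" if k: "k \<in> {1..<n}" for k
    proof -
      have "shape_mean k (\<lambda>a. shape_mean (n - k) (\<lambda>b. split_sum F (Nd a b)))
        = shape_mean k (\<lambda>a. split_sum (\<lambda>a'. shape_mean (n - k) (\<lambda>b. F (Nd a' b))) a)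
        + shape_mean k (\<lambda>a. shape_mean (n - k) (\<lambda>b. split_sum (\<lambda>b'. F (Nd a b')) b))"
        by (simp add: shape_mean_add shape_mean_split_sum)
      also have "\<dots> = k * T (Suc k) (n - k)
        + shape_mean k (\<lambda>a. (n - k) * shape_mean (Suc (n - k)) (\<lambda>b. F (Nd a b)))"
      proof -
        have "shape_mean (n - k) (\<lambda>b. split_sum (\<lambda>b'. F (Nd a b')) b)
            = (n - k) * shape_mean (Suc (n - k)) (\<lambda>b. F (Nd a b))" for a
          using k by (intro less.IH) auto
        then show ?thesis
          using less.IH[of k "\<lambda>a'. shape_mean (n - k) (\<lambda>b. F (Nd a' b))"] k by (simp add: T_def)
      qed
      also have "\<dots> = k * T (Suc k) (n - k) + (n - k) * T k (Suc n - k)"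
        using k by (simp add: shape_mean_mult T_def Suc_diff_le)
      finally show ?thesis .
    qed
    have "(real n - 1) * shape_mean n (split_sum F)
        = (\<Sum>k=1..<n. k * T (Suc k) (n - k) + (n - k) * T k (Suc n - k))"
      unfolding shape_mean_rec[OF n] using n summand by simp
    also have "\<dots> = (\<Sum>k=1..<n. k * T (Suc k) (n - k)) + (\<Sum>k=1..<n. (n - k) * T k (Suc n - k))"
      by (rule sum.distrib)
    also have "(\<Sum>k=1..<n. k * T (Suc k) (n - k)) = (\<Sum>k=1..<Suc n. (k - 1) * T k (Suc n - k))"
    proof -
      have "(\<Sum>k=1..<Suc n. (k - 1) * T k (Suc n - k)) = (\<Sum>k=0..<n. (Suc k - 1) * T (Suc k) (Suc n - Suc k))"
        unfolding One_nat_def by (rule sum.shift_bounds_Suc_ivl)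
      also have "\<dots> = (\<Sum>k=1..<n. k * T (Suc k) (n - k))"
        using n by (simp add: sum.atLeast_Suc_lessThan)
      finally show ?thesis by simp
    qed
    also have "(\<Sum>k=1..<n. (n - k) * T k (Suc n - k)) = (\<Sum>k=1..<Suc n. (n - k) * T k (Suc n - k))"
      using n by simp
    also have "(\<Sum>k=1..<Suc n. (k - 1) * T k (Suc n - k)) + \<dots> = (\<Sum>k=1..<Suc n. (real n - 1) * T k (Suc n - k))"
      unfolding sum.distrib[symmetric]
    proof (intro sum.cong refl)
      fix k assume "k \<in> {1..<Suc n}"
      then have "real (k - 1) + real (n - k) = real n - 1" by (auto simp: of_nat_diff)
      then show "real (k - 1) * T k (Suc n - k) + real (n - k) * T k (Suc n - k) = (real n - 1) * T k (Suc n - k)"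
        by (metis distrib_right)
    qed
    also have "\<dots> = (real n - 1) * (n * shape_mean (Suc n) F)"
      using n by (simp add: shape_mean_rec[of "Suc n"] T_def sum_distrib_left[symmetric] del: sum.op_ivl_Suc)
    finally show ?thesis using n by simp
  qed
qed

abbreviation shape :: "'a bt \<Rightarrow> unit bt" where
  "shape \<equiv> map_bt (\<lambda>_. ())"

lemma sum_split_leaf:
  assumes "distinct_leaves B"
  shows "(\<Sum>i\<in>leaves B. F (shape (split_leaf i j B))) = split_sum F (shape B)"
  using assms
proof (induction B arbitrary: F)
  case (Nd a b)
  have dis: "leaves a \<inter> leaves b = {}" using Nd.prems by simp
  have outside: "i \<in> leaves a \<Longrightarrow> split_leaf i j b = b" "i \<in> leaves b \<Longrightarrow> split_leaf i j a = a" for i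
    using dis by (auto intro: split_leaf_id)
  have "(\<Sum>i\<in>leaves (Nd a b). F (shape (split_leaf i j (Nd a b))))
     = (\<Sum>i\<in>leaves a. F (shape (split_leaf i j (Nd a b)))) + (\<Sum>i\<in>leaves b. F (shape (split_leaf i j (Nd a b))))"
    using dis by (simp add: sum.union_disjoint finite_leaves)
  also have "(\<Sum>i\<in>leaves a. F (shape (split_leaf i j (Nd a b)))) = (\<Sum>i\<in>leaves a. F (Nd (shape (split_leaf i j a)) (shape b)))"
    using outside(1) by simp
  also have "(\<Sum>i\<in>leaves b. F (shape (split_leaf i j (Nd a b)))) = (\<Sum>i\<in>leaves b. F (Nd (shape a) (shape (split_leaf i j b))))"
    using outside(2) by simp
  finally show ?case
    using Nd.IH(1)[of "\<lambda>a'. F (Nd a' (shape b))"] Nd.IH(2)[of "\<lambda>b'. F (Nd (shape a) b')"] Nd.prems by simp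
qed simp

text \<open>Attaching to a uniform vertex is splitting a uniform leaf, so \<open>shape_mean_Suc\<close> drives the induction.\<close>

lemma sum_bt_of:
  assumes "1 \<le> n"
  shows "(\<Sum>f\<in>parent_maps n. F (shape (bt_of f n))) = card (parent_maps n) * shape_mean n F"
  using assms
proof (induction n arbitrary: F rule: dec_induct)
  case base
  show ?case by (simp add: parent_maps_1 shape_mean_1)
next
  case (step n)
  have "(\<Sum>f\<in>parent_maps (Suc n). F (shape (bt_of f (Suc n))))
    = (\<Sum>f\<in>parent_maps n. \<Sum>i=1..n. F (shape (split_leaf i (Suc n) (bt_of f n))))"
    using step.hyps by (subst sum_parent_maps_Suc) (auto simp: bt_of_fun_upd simp del: fun_upd_apply simp add: fun_upd_same)
  also have "\<dots> = (\<Sum>f\<in>parent_maps n. split_sum F (shape (bt_of f n)))"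
  proof (intro sum.cong refl)
    fix f assume "f \<in> parent_maps n"
    note p = bt_of_props[OF step.hyps(1) this]
    show "(\<Sum>i=1..n. F (shape (split_leaf i (Suc n) (bt_of f n)))) = split_sum F (shape (bt_of f n))"
      using sum_split_leaf[OF p(2)] unfolding p(1) .
  qed
  also have "\<dots> = card (parent_maps n) * (n * shape_mean (Suc n) F)"
    using step.IH[of "split_sum F"] shape_mean_Suc[OF step.hyps(1), of F] by simp
  also have "\<dots> = card (parent_maps (Suc n)) * shape_mean (Suc n) F"
    using step.hyps by (simp add: card_parent_maps fact_reduce)
  finally show ?case .
qed

section \<open>Weights of root-to-leaf paths\<close>

fun leaf_depth :: "'a bt \<Rightarrow> 'a \<Rightarrow> nat" where
  "leaf_depth (Lf x) u = 0"
| "leaf_depth (Nd a b) u = (if u \<in> leaves a then Suc (leaf_depth a u) else leaf_depth b u)"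

type_synonym step_weight = "nat \<Rightarrow> nat \<Rightarrow> nat \<Rightarrow> real"

text \<open>The factor of a step is applied to the number of left steps from there to the leaf, counting the step
  itself, and to the sizes of the left and the right part. Left steps are the edges of the recursive tree on the path from the root.\<close>

fun path_weight :: "step_weight \<Rightarrow> step_weight \<Rightarrow> 'a bt \<Rightarrow> 'a \<Rightarrow> real" where
  "path_weight l r (Lf x) u = 1"
| "path_weight l r (Nd a b) u =
     (if u \<in> leaves a then l (Suc (leaf_depth a u)) (nleaves a) (nleaves b) * path_weight l r a u
      else r (leaf_depth b u) (nleaves a) (nleaves b) * path_weight l r b u)"

fun weight_sum :: "step_weight \<Rightarrow> step_weight \<Rightarrow> nat \<Rightarrow> 'a bt \<Rightarrow> real" where
  "weight_sum l r m (Lf x) = (if m = 0 then 1 else 0)"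
| "weight_sum l r m (Nd a b) =
     (if m = 0 then 0 else l m (nleaves a) (nleaves b) * weight_sum l r (m - 1) a)
     + r m (nleaves a) (nleaves b) * weight_sum l r m b"

lemma leaf_depth_less: "leaf_depth B u < nleaves B"
proof (induction B)
  case (Nd a b)
  then show ?case using nleaves_pos[of a] nleaves_pos[of b] by auto
qed auto

lemma weight_sum_map [simp]: "weight_sum l r m (map_bt g B) = weight_sum l r m B"
  by (induction B arbitrary: m) auto

lemma sum_path_weight:
  assumes "distinct_leaves B"
  shows "(\<Sum>u | u \<in> leaves B \<and> leaf_depth B u = m. path_weight l r B u) = weight_sum l r m B"
  using assms
proof (induction B arbitrary: m)
  case (Lf x)
  then show ?case by (cases "m = 0") (auto simp: if_distrib cong: if_cong)
next
  case (Nd a b)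
  have dis: "leaves a \<inter> leaves b = {}" using Nd.prems by simp
  let ?A = "{u \<in> leaves a. Suc (leaf_depth a u) = m}" and ?B = "{u \<in> leaves b. leaf_depth b u = m}"
  have eq: "{u. u \<in> leaves (Nd a b) \<and> leaf_depth (Nd a b) u = m} = ?A \<union> ?B" using dis by auto
  have "(\<Sum>u | u \<in> leaves (Nd a b) \<and> leaf_depth (Nd a b) u = m. path_weight l r (Nd a b) u)
     = (\<Sum>u\<in>?A. path_weight l r (Nd a b) u) + (\<Sum>u\<in>?B. path_weight l r (Nd a b) u)"
    unfolding eq using dis by (intro sum.union_disjoint) (auto simp: finite_leaves)
  also have "(\<Sum>u\<in>?A. path_weight l r (Nd a b) u)
     = (\<Sum>u\<in>?A. l m (nleaves a) (nleaves b) * path_weight l r a u)"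
    by (intro sum.cong refl) auto
  also have "\<dots> = (if m = 0 then 0 else l m (nleaves a) (nleaves b) * weight_sum l r (m - 1) a)"
    using Nd.IH(1)[of "m - 1"] Nd.prems by (cases m) (auto simp: sum_distrib_left[symmetric])
  also have "(\<Sum>u\<in>?B. path_weight l r (Nd a b) u)
     = (\<Sum>u\<in>?B. r m (nleaves a) (nleaves b) * path_weight l r b u)"
    using dis by (intro sum.cong refl) auto
  also have "\<dots> = r m (nleaves a) (nleaves b) * weight_sum l r m b"
    using Nd.IH(2)[of m] Nd.prems by (auto simp: sum_distrib_left[symmetric])
  finally show ?case by simp
qed

lemma sum_leaves_by_depth:
  assumes "nleaves B \<le> N"
  shows "(\<Sum>u\<in>leaves B. g u) = (\<Sum>m<N. \<Sum>u | u \<in> leaves B \<and> leaf_depth B u = m. (g u :: real))"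
proof -
  have "(\<Sum>u\<in>leaves B. g u) = (\<Sum>m<N. sum g {u \<in> leaves B. leaf_depth B u = m})"
    using leaf_depth_less[of B] assms
    by (intro sum.group[symmetric]) (auto simp: finite_leaves intro: less_le_trans)
  then show ?thesis by simp
qed

lemma path_weight_mult:
  "path_weight l r B u * path_weight l' r' B u
     = path_weight (\<lambda>m p q. l m p q * l' m p q) (\<lambda>m p q. r m p q * r' m p q) B u"
  by (induction B) auto

lemma path_weight_power:
  "path_weight l r B u ^ t = path_weight (\<lambda>m p q. l m p q ^ t) (\<lambda>m p q. r m p q ^ t) B u"
  by (induction B) (auto simp: power_mult_distrib)

lemma path_weight_inverse:
  "inverse (path_weight l r B u) = path_weight (\<lambda>m p q. inverse (l m p q)) (\<lambda>m p q. inverse (r m p q)) B u"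
  by (induction B) auto

lemma path_weight_pos:
  assumes "\<And>m p q. 0 < p \<Longrightarrow> 0 < q \<Longrightarrow> 0 < l m p q" "\<And>m p q. 0 < p \<Longrightarrow> 0 < q \<Longrightarrow> 0 < r m p q"
  shows "0 < path_weight l r B u"
  by (induction B) (auto simp: assms nleaves_pos)

lemma path_weight_powr:
  assumes "\<And>m p q. 0 < p \<Longrightarrow> 0 < q \<Longrightarrow> 0 < l m p q" "\<And>m p q. 0 < p \<Longrightarrow> 0 < q \<Longrightarrow> 0 < r m p q"
  shows "path_weight l r B u powr s = path_weight (\<lambda>m p q. l m p q powr s) (\<lambda>m p q. r m p q powr s) B u"
  by (induction B) (auto simp: powr_mult assms nleaves_pos path_weight_pos less_imp_le)

text \<open>Induction on the tree: a left step contributes \<open>l m * (1 / 2) ^ (m - 1)\<close> and a right step \<open>r m * (1 / 2) ^ m\<close>.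
  The bound is deterministic, so that it can feed a pigeonhole argument inside the expectation.\<close>

lemma weight_sum_le:
  fixes l r :: "nat \<Rightarrow> real"
  assumes "\<And>m. 0 \<le> l m" "\<And>m. 0 \<le> r m" "r 0 \<le> 1" "\<And>m. 1 \<le> m \<Longrightarrow> 2 * l m + r m \<le> 1"
  shows "weight_sum (\<lambda>m p q. l m) (\<lambda>m p q. r m) m B \<le> (1 / 2) ^ m" (is "?W m B \<le> _")
proof (induction B arbitrary: m)
  case (Nd a b)
  show ?case
  proof (cases m)
    case 0
    have "r 0 * ?W 0 b \<le> r 0 * 1"
      using Nd(2)[of 0] assms by (intro mult_left_mono) auto
    then show ?thesis using 0 assms(3) by simp
  next
    case (Suc k)
    have "?W m (Nd a b)
      = l m * ?W k a + r m * ?W m b"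
      by (simp add: Suc)
    also have "\<dots> \<le> l m * (1 / 2) ^ k + r m * (1 / 2) ^ m"
      by (intro add_mono mult_left_mono Nd assms)
    also have "\<dots> = (2 * l m + r m) * (1 / 2) ^ m" by (simp add: Suc algebra_simps)
    also have "\<dots> \<le> 1 * (1 / 2) ^ m" using assms(4)[of m] Suc by (intro mult_right_mono) auto
    finally show ?thesis by simp
  qed
qed auto

lemma sum_const_path_weight_le_2:
  fixes l r :: "nat \<Rightarrow> real"
  assumes "distinct_leaves B"
    and "\<And>m. 0 \<le> l m" "\<And>m. 0 \<le> r m" "r 0 \<le> 1" "\<And>m. 1 \<le> m \<Longrightarrow> 2 * l m + r m \<le> 1"
  shows "(\<Sum>u\<in>leaves B. path_weight (\<lambda>m p q. l m) (\<lambda>m p q. r m) B u) \<le> 2"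
proof -
  have "(\<Sum>u\<in>leaves B. path_weight (\<lambda>m p q. l m) (\<lambda>m p q. r m) B u)
     = (\<Sum>m<nleaves B. weight_sum (\<lambda>m p q. l m) (\<lambda>m p q. r m) m B)"
    by (subst sum_leaves_by_depth[OF order_refl]) (simp add: sum_path_weight[OF assms(1)])
  also have "\<dots> \<le> (\<Sum>m<nleaves B. (1 / 2) ^ m)" using assms by (intro sum_mono weight_sum_le) auto
  also have "\<dots> \<le> 2" by (simp add: sum_gp_strict)
  finally show ?thesis .
qed

section \<open>Expected weight sums\<close>

text \<open>The weights of the parts are independent given the sizes, so \<open>Z\<close> has to dominate
  the recursion in which the step factors are replaced by bounds \<open>L\<close> and \<open>R\<close> on their averages over the split.\<close>

lemma shape_mean_weight_sum_le:
  assumes l0: "\<And>m p q. 0 \<le> l m p q" and r0: "\<And>m p q. 0 \<le> r m p q" and r1: "\<And>p q. r 0 p q = 1"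
    and L: "\<And>m n. 1 \<le> m \<Longrightarrow> 2 \<le> n \<Longrightarrow> (\<Sum>k=1..<n. l m k (n - k)) \<le> L m * (real n - 1)"
    and R: "\<And>m n. 1 \<le> m \<Longrightarrow> 2 \<le> n \<Longrightarrow> (\<Sum>k=1..<n. r m k (n - k)) \<le> R m * (real n - 1)"
    and Z0: "Z 0 = 1" and Znn: "\<And>m. 0 \<le> Z m"
    and Z: "\<And>m. 1 \<le> m \<Longrightarrow> L m * Z (m - 1) + R m * Z m \<le> Z m"
    and n: "1 \<le> n"
  shows "shape_mean n (weight_sum l r m) \<le> Z m"
  using n
proof (induction m arbitrary: n)
  case 0
  have "weight_sum l r 0 B = 1" for B :: "unit bt" by (induction B) (auto simp: r1)
  then have "weight_sum l r 0 = (\<lambda>B :: unit bt. 1)" by (intro ext)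
  then show ?case using Z0 shape_mean_const[of n 1] by simp
next
  case (Suc j)
  define m where "m = Suc j"
  have "1 \<le> n \<Longrightarrow> shape_mean n (weight_sum l r m) \<le> Z m"
  proof (induction n rule: less_induct)
    case (less n)
    show ?case
    proof (cases "n = 1")
      case True
      then show ?thesis using Znn by (simp add: shape_mean_1 m_def)
    next
      case False
      then have n: "2 \<le> n" using less.prems by simp
      have "shape_mean k (\<lambda>a. shape_mean (n - k) (\<lambda>b. weight_sum l r m (Nd a b)))
          \<le> l m k (n - k) * Z j + r m k (n - k) * Z m" if k: "k \<in> {1..<n}" for k
      proof -
        have "shape_mean k (\<lambda>a. shape_mean (n - k) (\<lambda>b. weight_sum l r m (Nd a b)))
          = shape_mean k (\<lambda>a. shape_mean (n - k) (\<lambda>b. l m k (n - k) * weight_sum l r j a + r m k (n - k) * weight_sum l r m b))"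
          using k by (intro shape_mean_cong) (auto simp: m_def)
        also have "\<dots> = l m k (n - k) * shape_mean k (weight_sum l r j) + r m k (n - k) * shape_mean (n - k) (weight_sum l r m)"
          by (simp add: shape_mean_add shape_mean_mult shape_mean_const)
        also have "\<dots> \<le> l m k (n - k) * Z j + r m k (n - k) * Z m"
          using k l0 r0 Suc.IH[of k] less.IH[of "n - k"] by (intro add_mono mult_left_mono) auto
        finally show ?thesis .
      qed
      then have "(\<Sum>k=1..<n. shape_mean k (\<lambda>a. shape_mean (n - k) (\<lambda>b. weight_sum l r m (Nd a b))))
          \<le> (\<Sum>k=1..<n. l m k (n - k) * Z j + r m k (n - k) * Z m)"
        by (rule sum_mono)
      then have "(real n - 1) * shape_mean n (weight_sum l r m)
          \<le> (\<Sum>k=1..<n. l m k (n - k) * Z j + r m k (n - k) * Z m)"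
        unfolding shape_mean_rec[OF n] using n by (simp del: weight_sum.simps)
      also have "\<dots> = (\<Sum>k=1..<n. l m k (n - k)) * Z j + (\<Sum>k=1..<n. r m k (n - k)) * Z m"
        by (simp add: sum.distrib sum_distrib_right)
      also have "\<dots> \<le> L m * (real n - 1) * Z j + R m * (real n - 1) * Z m"
        using L[of m n] R[of m n] n Znn by (intro add_mono mult_right_mono) (auto simp: m_def)
      also have "\<dots> = (real n - 1) * (L m * Z j + R m * Z m)" by (simp add: algebra_simps)
      also have "\<dots> \<le> (real n - 1) * Z m" using Z[of m] n by (intro mult_left_mono) (auto simp: m_def)
      finally show ?thesis using n by simp
    qed
  qed
  then show ?case using Suc.prems by (simp add: m_def)
qed

section \<open>Averages over a uniform split\<close>

text \<open>Step factors whose product along the path to a leaf bounds the ratio of the scores of the root and of the leaf. A step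
  shrinks the current part by \<open>p / (p + q)\<close> or \<open>q / (p + q)\<close>, and this enters the subtree sizes of
  all \<open>m\<close> vertices still to come. The factor \<open>(p + q) / q\<close> of a left step dominates \<open>1 / (1 - p / N)\<close>,
  where \<open>p\<close> is the size of the subtree that is entered and \<open>N\<close> that of the whole tree.\<close>

definition lik_l :: step_weight where
  "lik_l m p q = (real p / real (p + q)) ^ m * (real (p + q) / real q)"

definition lik_r :: step_weight where
  "lik_r m p q = (real q / real (p + q)) ^ m"

lemma lik_pos: "0 < p \<Longrightarrow> 0 < q \<Longrightarrow> 0 < lik_l m p q" "0 < p \<Longrightarrow> 0 < q \<Longrightarrow> 0 < lik_r m p q"
  by (auto simp: lik_l_def lik_r_def)

lemma sum_inverse_sqrt_le: "(\<Sum>i=1..<n. sqrt (1 / real i)) \<le> 2 * sqrt (real n - 1)" if "1 \<le> n"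
  using that
proof (induction n rule: dec_induct)
  case (step n)
  have "sqrt (1 / real n) \<le> 2 * (sqrt n - sqrt (real n - 1))"
  proof -
    have "1 = (sqrt n - sqrt (real n - 1)) * (sqrt n + sqrt (real n - 1))"
      using step.hyps by (simp add: algebra_simps)
    also have "\<dots> \<le> (sqrt n - sqrt (real n - 1)) * (2 * sqrt n)"
      using step.hyps by (intro mult_left_mono) auto
    finally show ?thesis using step.hyps by (simp add: real_sqrt_divide field_simps)
  qed
  then show ?case using step by simp
qed simp

lemma sum_sqrt_le:
  assumes "2 \<le> n"
  shows "(\<Sum>i=1..<n. sqrt (real n / real i)) \<le> 4 * (real n - 1)"
proof -
  have "(\<Sum>i=1..<n. sqrt (real n / real i)) = sqrt n * (\<Sum>i=1..<n. sqrt (1 / real i))"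
    by (simp add: sum_distrib_left real_sqrt_divide)
  also have "\<dots> \<le> (2 * sqrt (real n - 1)) * (2 * sqrt (real n - 1))"
  proof (intro mult_mono sum_inverse_sqrt_le)
    have "sqrt n \<le> sqrt (4 * (real n - 1))" using assms by (intro real_sqrt_le_mono) auto
    also have "\<dots> = 2 * sqrt (real n - 1)" by (simp only: real_sqrt_mult real_sqrt_four)
    finally show "sqrt n \<le> 2 * sqrt (real n - 1)" .
  qed (use assms in \<open>auto intro: sum_nonneg\<close>)
  also have "\<dots> = 4 * (real n - 1)" using assms by simp
  finally show ?thesis .
qed

lemma fourth_power_root:
  fixes y :: real
  assumes "0 < y"
  shows "(y ^ 4) powr (1 / 4) = y"
  using assms powr_powr[of y 4 "1 / 4"] by (simp add: powr_numeral)

lemma one_minus_power_bound: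
  fixes x :: real
  assumes "0 \<le> x" "x \<le> 1"
  shows "(1 - x) ^ m * (real m * x) \<le> 1"
proof -
  have "(1 - x) ^ m * (real m * x) \<le> (1 - x) ^ m * (1 + x) ^ m"
    using Bernoulli_inequality[of x m] assms by (intro mult_left_mono) auto
  also have "\<dots> = (1 - x\<^sup>2) ^ m"
    by (simp add: power_mult_distrib[symmetric] power2_eq_square algebra_simps)
  also have "\<dots> \<le> 1" using assms by (intro power_le_one) (auto simp: power_le_one)
  finally show ?thesis .
qed

text \<open>With \<open>x = q / (p + q)\<close>, Bernoulli's inequality gives \<open>(1 - x) ^ m \<le> 1 / (m * x)\<close>. The fourth
  root turns the product with \<open>1 / x\<close> into \<open>1 / sqrt x\<close>, which is integrable, and keeps some decay in \<open>m\<close>.\<close>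

lemma quarter_power_bound:
  assumes "1 \<le> m" "0 < p" "0 < q"
  shows "lik_l m p q powr (1 / 4)
      \<le> real m powr (- 1 / 4) * sqrt (real (p + q) / real q)"
proof -
  define x where "x = real q / real (p + q)"
  have x: "0 < x" "x < 1" using assms by (auto simp: x_def)
  have p: "real p / real (p + q) = 1 - x" using assms by (simp add: x_def field_simps)
  have q: "real (p + q) / real q = 1 / x" by (simp add: x_def)
  have "(1 - x) ^ m * (1 / x) \<le> 1 / real m * (1 / x)\<^sup>2"
    using one_minus_power_bound[of x m] x assms(1) by (simp add: field_simps power2_eq_square)
  then have "((1 - x) ^ m * (1 / x)) powr (1 / 4) \<le> (1 / real m * (1 / x)\<^sup>2) powr (1 / 4)"
    using x by (intro powr_mono2) auto
  also have "\<dots> = (1 / real m) powr (1 / 4) * ((1 / x)\<^sup>2) powr (1 / 4)"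
    by (rule powr_mult)
  also have "((1 / x)\<^sup>2) powr (1 / 4) = sqrt (1 / x)"
    using x by (simp add: powr_half_sqrt[symmetric] powr_powr flip: powr_numeral)
  also have "(1 / real m) powr (1 / 4) = real m powr (- 1 / 4)"
    using assms(1) by (simp add: powr_divide powr_minus_divide)
  finally show ?thesis unfolding lik_l_def p q .
qed

lemma sum_left_weight_le:
  assumes "1 \<le> m" "2 \<le> n"
  shows "(\<Sum>k=1..<n. lik_l m k (n - k) powr (1 / 4))
      \<le> 4 * real m powr (- 1 / 4) * (real n - 1)"
proof -
  have "(\<Sum>k=1..<n. lik_l m k (n - k) powr (1 / 4))
    \<le> (\<Sum>k=1..<n. real m powr (- 1 / 4) * sqrt (real (k + (n - k)) / real (n - k)))"
    using assms by (intro sum_mono quarter_power_bound) auto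
  also have "\<dots> = real m powr (- 1 / 4) * (\<Sum>k=1..<n. sqrt (real n / real (n - k)))"
    by (auto simp: sum_distrib_left intro!: sum.cong)
  also have "(\<Sum>k=1..<n. sqrt (real n / real (n - k))) = (\<Sum>k=1..<n. sqrt (real n / real k))"
    by (rule sum.reindex_bij_witness[of _ "\<lambda>k. n - k" "\<lambda>k. n - k"]) auto
  also have "real m powr (- 1 / 4) * \<dots> \<le> real m powr (- 1 / 4) * (4 * (real n - 1))"
    using assms by (intro mult_left_mono sum_sqrt_le) auto
  finally show ?thesis by (simp only: mult_ac)
qed

text \<open>The first bound decays in \<open>m\<close>; the second one is below \<open>1\<close> for all \<open>m\<close>, which is what the small
  values of \<open>m\<close> need.\<close>

lemma sum_right_weight_le:
  assumes "1 \<le> m" "2 \<le> n"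
  shows "(\<Sum>k=1..<n. lik_r m k (n - k) powr (1 / 4)) \<le> 4 * real m powr (- 1 / 4) * (real n - 1)"
    and "(\<Sum>k=1..<n. lik_r m k (n - k) powr (1 / 4)) \<le> 7 / 8 * (real n - 1)"
proof -
  have eq: "(\<Sum>k=1..<n. lik_r m k (n - k) powr (1 / 4))
    = (\<Sum>k=1..<n. ((real k / real n) ^ m) powr (1 / 4))"
    unfolding lik_r_def by (rule sum.reindex_bij_witness[of _ "\<lambda>k. n - k" "\<lambda>k. n - k"]) auto
  have "(\<Sum>k=1..<n. ((real k / real n) ^ m) powr (1 / 4))
     \<le> (\<Sum>k=1..<n. lik_l m k (n - k) powr (1 / 4))"
  proof (intro sum_mono powr_mono2)
    fix k assume k: "k \<in> {1..<n}"
    then have "(real k / real n) ^ m * 1 \<le> (real k / real n) ^ m * (real n / real (n - k))"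
      by (intro mult_left_mono) auto
    then show "(real k / real n) ^ m \<le> lik_l m k (n - k)" using k by (simp add: lik_l_def)
  qed auto
  then show "(\<Sum>k=1..<n. lik_r m k (n - k) powr (1 / 4)) \<le> 4 * real m powr (- 1 / 4) * (real n - 1)"
    unfolding eq using sum_left_weight_le[OF assms] by linarith
  have "((real k / real n) ^ m) powr (1 / 4) \<le> 3 / 4 + real k / (4 * real n)" if k: "k \<in> {1..<n}" for k
  proof -
    define x where "x = real k / real n"
    have x: "0 < x" "x < 1" using k by (auto simp: x_def)
    have "x ^ m \<le> x ^ 1" using x assms by (intro power_decreasing) auto
    also have "x ^ 1 = 1 + real 4 * ((x - 1) / 4)" by (simp add: field_simps)
    also have "\<dots> \<le> (1 + (x - 1) / 4) ^ 4"
      using x by (intro Bernoulli_inequality) simp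
    finally have "(x ^ m) powr (1 / 4) \<le> ((1 + (x - 1) / 4) ^ 4) powr (1 / 4)"
      using x by (intro powr_mono2) auto
    also have "\<dots> = 1 + (x - 1) / 4"
      using x by (intro fourth_power_root) (simp add: field_simps)
    finally show ?thesis by (simp add: x_def field_simps)
  qed
  then have "(\<Sum>k=1..<n. ((real k / real n) ^ m) powr (1 / 4)) \<le> (\<Sum>k=1..<n. 3 / 4 + real k / (4 * real n))"
    by (intro sum_mono) auto
  also have "\<dots> = 3 / 4 * (real n - 1) + (\<Sum>k=1..<n. real k) / (4 * real n)"
    using assms by (simp add: sum.distrib sum_divide_distrib of_nat_diff)
  also have "(\<Sum>k=1..<n. real k) = real n * (real n - 1) / 2"
    using assms(2) by (induction n rule: dec_induct) (auto simp: field_simps numeral_2_eq_2)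
  also have "3 / 4 * (real n - 1) + real n * (real n - 1) / 2 / (4 * real n) = 7 / 8 * (real n - 1)"
    using assms by (simp add: field_simps)
  finally show "(\<Sum>k=1..<n. lik_r m k (n - k) powr (1 / 4)) \<le> 7 / 8 * (real n - 1)"
    unfolding eq .
qed

section \<open>Counting the rivals of the root\<close>

text \<open>All leaves whose score can be as good as that of the root, judged by the bound on the ratio.\<close>

abbreviation rivals :: "'a bt \<Rightarrow> 'a set" where
  "rivals B \<equiv> {u \<in> leaves B. 1 \<le> path_weight lik_l lik_r B u}"

text \<open>A power below \<open>1\<close> of the ratio is needed, as \<open>1 / (1 - x)\<close> is not integrable on the unit interval.\<close>

definition tilt_l :: "nat \<Rightarrow> (nat \<Rightarrow> real) \<Rightarrow> step_weight" where
  "tilt_l t \<beta> m p q = lik_l m p q powr (1 / 4) * inverse (\<beta> m) ^ t"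

definition tilt_r :: "nat \<Rightarrow> (nat \<Rightarrow> real) \<Rightarrow> step_weight" where
  "tilt_r t \<alpha> m p q = lik_r m p q powr (1 / 4) * inverse (\<alpha> m) ^ t"

text \<open>The word weights given by \<open>\<beta>\<close> and \<open>\<alpha>\<close> add up to at most \<open>2\<close>, so one of \<open>K\<close> rivals has a word weight of at
  most \<open>2 / K\<close>. Its term alone makes the right-hand side at least \<open>1\<close>.\<close>

lemma many_rivals_weight:
  fixes \<alpha> \<beta> :: "nat \<Rightarrow> real"
  assumes B: "distinct_leaves B" "nleaves B \<le> N"
    and \<alpha>: "\<And>m. 0 < \<alpha> m" and \<beta>: "\<And>m. 0 < \<beta> m" and "\<alpha> 0 \<le> 1" "\<And>m. 1 \<le> m \<Longrightarrow> 2 * \<beta> m + \<alpha> m \<le> 1"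
    and K: "1 \<le> K" "K \<le> card (rivals B)"
  shows "1 \<le> (2 / real K) ^ t * (\<Sum>m<N. weight_sum (tilt_l t \<beta>) (tilt_r t \<alpha>) m B)"
proof -
  let ?\<eta> = "path_weight (\<lambda>m p q. \<beta> m) (\<lambda>m p q. \<alpha> m) B"
  let ?\<omega> = "path_weight lik_l lik_r B"
  let ?S = "{u \<in> leaves B. 1 \<le> ?\<omega> u}"
  have \<eta>_pos: "0 < ?\<eta> u" for u by (intro path_weight_pos \<alpha> \<beta>)
  have \<omega>_pos: "0 < ?\<omega> u" for u by (intro path_weight_pos lik_pos)
  have "\<exists>u\<in>?S. ?\<eta> u \<le> 2 / K"
  proof (rule ccontr)
    assume "\<not> (\<exists>u\<in>?S. ?\<eta> u \<le> 2 / K)"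
    then have *: "\<And>u. u \<in> ?S \<Longrightarrow> 2 / K < ?\<eta> u" by force
    have "?S \<noteq> {}" using K by (metis card.empty not_one_le_zero order_trans)
    then have "(\<Sum>u\<in>?S. 2 / real K) < (\<Sum>u\<in>?S. ?\<eta> u)"
      using finite_leaves[of B] by (intro sum_strict_mono *) auto
    also have "\<dots> \<le> (\<Sum>u\<in>leaves B. ?\<eta> u)"
      using finite_leaves[of B] \<eta>_pos by (intro sum_mono2) (auto intro: less_imp_le)
    also have "\<dots> \<le> 2" using assms by (intro sum_const_path_weight_le_2) (auto intro: less_imp_le)
    finally have "card ?S * 2 < 2 * real K" using K(1) by (simp add: field_simps)
    then show False using K(2) by simp
  qed
  then obtain u where u: "u \<in> leaves B" "1 \<le> ?\<omega> u" "?\<eta> u \<le> 2 / K" by auto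
  define T where "T v = ?\<omega> v powr (1 / 4) * inverse (?\<eta> v) ^ t" for v
  have T_pos: "0 \<le> T v" for v using \<eta>_pos[of v] by (simp add: T_def)
  have T_eq: "T v = path_weight (tilt_l t \<beta>) (tilt_r t \<alpha>) B v" for v
    unfolding T_def tilt_l_def tilt_r_def path_weight_inverse path_weight_power
    by (subst path_weight_powr) (auto simp: lik_pos path_weight_mult)
  have "1 = (2 / real K) ^ t * (1 * inverse (2 / K) ^ t)"
    using K(1) by (simp add: power_mult_distrib[symmetric])
  also have "\<dots> \<le> (2 / real K) ^ t * T u"
    unfolding T_def using u \<eta>_pos[of u] K(1)
    by (intro mult_left_mono mult_mono power_mono le_imp_inverse_le ge_one_powr_ge_zero) auto
  also have "\<dots> \<le> (2 / real K) ^ t * (\<Sum>v\<in>leaves B. T v)"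
    using u T_pos finite_leaves[of B] by (intro mult_left_mono member_le_sum) auto
  also have "(\<Sum>v\<in>leaves B. T v) = (\<Sum>m<N. weight_sum (tilt_l t \<beta>) (tilt_r t \<alpha>) m B)"
    unfolding T_eq by (subst sum_leaves_by_depth[OF B(2)]) (simp add: sum_path_weight[OF B(1)])
  finally show ?thesis .
qed

text \<open>From \<open>m = moment_cutoff t\<close> on, the decay \<open>m powr (- 1 / 4)\<close> of the averages beats the
  constants \<open>2 ^ t\<close> and \<open>4 ^ t\<close> that the word weights \<open>1 / 2\<close> and \<open>1 / 4\<close> produce.\<close>

definition moment_cutoff :: "nat \<Rightarrow> nat" where
  "moment_cutoff t = 2 ^ (8 * t + 16)"

definition moment_base :: "nat \<Rightarrow> real" where
  "moment_base t = 60 * (32 * real t) ^ t"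

text \<open>Both regimes satisfy \<open>2 * word_l t m + word_r t m = 1\<close> for \<open>m \<ge> 1\<close>. Below the cutoff a right step must be nearly free,
  because its average is only known to be at most \<open>7 / 8\<close>; the price is a small weight for left steps.\<close>

definition word_r :: "nat \<Rightarrow> nat \<Rightarrow> real" where
  "word_r t m = (if m = 0 then 1 else if m < moment_cutoff t then 1 - 1 / (16 * real t) else 1 / 2)"

definition word_l :: "nat \<Rightarrow> nat \<Rightarrow> real" where
  "word_l t m = (if m < moment_cutoff t then 1 / (32 * real t) else 1 / 4)"

text \<open>Below the cutoff every left step costs a factor of \<open>moment_base t\<close>, above it the bound is halved, so that the sum over \<open>m\<close> converges.\<close>

definition moment_bound :: "nat \<Rightarrow> nat \<Rightarrow> real" where
  "moment_bound t m = moment_base t ^ min m (moment_cutoff t) * (1 / 2) ^ (m - moment_cutoff t)"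

lemma cutoff_root: "moment_cutoff t \<le> m \<Longrightarrow> real m powr (- 1 / 4) \<le> 1 / (16 * 4 ^ t)"
proof -
  assume m: "moment_cutoff t \<le> m"
  have eq: "real (moment_cutoff t) = (16 * 4 ^ t) ^ 4"
    by (simp add: moment_cutoff_def power_add power_mult power_mult_distrib)
      (simp add: power_mult[symmetric] mult.commute power_numeral_reduce flip: power_mult_distrib)
  have "real m powr (- 1 / 4) = 1 / real m powr (1 / 4)" by (simp add: powr_minus_divide)
  also have "\<dots> \<le> 1 / real (moment_cutoff t) powr (1 / 4)"
    using m by (intro divide_left_mono powr_mono2 mult_pos_pos) (auto simp: moment_cutoff_def intro: less_le_trans[of 0 "2 ^ (8 * t + 16)"])
  also have "real (moment_cutoff t) powr (1 / 4) = 16 * 4 ^ t"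
    unfolding eq by (intro fourth_power_root) simp
  finally show ?thesis .
qed

lemma shape_mean_tilted_le:
  assumes t: "1 \<le> t" and n: "1 \<le> n"
  shows "shape_mean n (weight_sum (tilt_l t (word_l t)) (tilt_r t (word_r t)) m) \<le> moment_bound t m"
proof (rule shape_mean_weight_sum_le[OF _ _ _ _ _ _ _ _ n])
  let ?c = "moment_cutoff t"
  define L where "L m = (4 * real m powr (- 1 / 4)) * inverse (word_l t m) ^ t" for m
  define R where "R m = (if m < ?c then 14 / 15 else 1 / 2 :: real)" for m
  have c1: "1 \<le> ?c" by (simp add: moment_cutoff_def)
  have base: "1 \<le> moment_base t"
    using t one_le_power[of "32 * real t" t] by (simp add: moment_base_def)
  have wl: "0 < word_l t m" for m using t by (simp add: word_l_def)
  have wr: "0 < word_r t m" for m using t by (simp add: word_r_def field_simps)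
  show "0 \<le> tilt_l t (word_l t) m p q" for m p q using wl[of m] by (simp add: tilt_l_def)
  show "0 \<le> tilt_r t (word_r t) m p q" for m p q using wr[of m] by (simp add: tilt_r_def)
  show "tilt_r t (word_r t) 0 p q = 1" for p q by (simp add: tilt_r_def lik_r_def word_r_def)
  show "moment_bound t 0 = 1" by (simp add: moment_bound_def)
  show "0 \<le> moment_bound t m" for m using base by (simp add: moment_bound_def)
  show "(\<Sum>k=1..<n. tilt_l t (word_l t) m k (n - k)) \<le> L m * (real n - 1)" if mn: "1 \<le> m" "2 \<le> n" for m n
  proof -
    have "(\<Sum>k=1..<n. tilt_l t (word_l t) m k (n - k))
       = (\<Sum>k=1..<n. lik_l m k (n - k) powr (1 / 4)) * inverse (word_l t m) ^ t"
      by (simp add: tilt_l_def sum_distrib_right)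
    also have "\<dots> \<le> (4 * real m powr (- 1 / 4) * (real n - 1)) * inverse (word_l t m) ^ t"
      using wl[of m] by (intro mult_right_mono sum_left_weight_le mn) auto
    finally show ?thesis by (simp add: L_def mult_ac)
  qed
  show "(\<Sum>k=1..<n. tilt_r t (word_r t) m k (n - k)) \<le> R m * (real n - 1)" if mn: "1 \<le> m" "2 \<le> n" for m n
  proof -
    have eq: "(\<Sum>k=1..<n. tilt_r t (word_r t) m k (n - k))
       = (\<Sum>k=1..<n. lik_r m k (n - k) powr (1 / 4)) * inverse (word_r t m) ^ t"
      by (simp add: tilt_r_def sum_distrib_right)
    show ?thesis
    proof (cases "m < ?c")
      case True
      \<comment> \<open>Bernoulli: \<open>(1 - 1 / (16 * t)) ^ t \<ge> 15 / 16\<close>, and \<open>7 / 8 * (16 / 15) = 14 / 15\<close> is below \<open>1\<close>.\<close>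
      have "15 / 16 = 1 + real t * (- (1 / (16 * real t)))" using t by simp
      also have "\<dots> \<le> (1 + - (1 / (16 * real t))) ^ t"
        using t by (intro Bernoulli_inequality) (simp add: field_simps)
      also have "\<dots> = word_r t m ^ t" using True mn by (simp add: word_r_def)
      finally have "inverse (word_r t m ^ t) \<le> inverse (15 / 16)" by (intro le_imp_inverse_le) auto
      then have inv: "inverse (word_r t m) ^ t \<le> 16 / 15" by (simp add: power_inverse)
      have "(\<Sum>k=1..<n. tilt_r t (word_r t) m k (n - k)) \<le> (7 / 8 * (real n - 1)) * (16 / 15)"
        unfolding eq using inv wr[of m] mn
        by (intro mult_mono sum_right_weight_le(2)) auto
      then show ?thesis using True by (simp add: R_def)
    next
      case False
      have "(\<Sum>k=1..<n. tilt_r t (word_r t) m k (n - k)) \<le> (4 * real m powr (- 1 / 4) * (real n - 1)) * 2 ^ t"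
        unfolding eq using False mn
        by (intro mult_mono sum_right_weight_le(1)) (auto simp: word_r_def)
      also have "\<dots> \<le> (4 * (1 / (16 * 4 ^ t)) * (real n - 1)) * 2 ^ t"
        using False mn cutoff_root[of t m] by (intro mult_mono) auto
      also have "\<dots> = (1 / 4) * ((2 ^ t / 4 ^ t) * (real n - 1))" by simp
      also have "\<dots> \<le> (1 / 4) * (1 * (real n - 1))"
        using mn by (intro mult_left_mono mult_right_mono) (auto simp: power_mono)
      also have "\<dots> \<le> R m * (real n - 1)" using False mn by (simp add: R_def)
      finally show ?thesis .
    qed
  qed
  show "L m * moment_bound t (m - 1) + R m * moment_bound t m \<le> moment_bound t m" if m: "1 \<le> m" for m
  proof (cases "m < ?c")
    case True
    have "real m powr (- 1 / 4) \<le> 1" using m powr_mono[of "- 1 / 4" 0 "real m"] by simp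
    then have "L m \<le> 4 * (32 * real t) ^ t" using True by (simp add: L_def word_l_def mult_left_le_one_le)
    then have "L m * moment_bound t (m - 1) \<le> 4 * (32 * real t) ^ t * moment_bound t (m - 1)"
      using base by (intro mult_right_mono) (auto simp: moment_bound_def)
    also have "\<dots> = moment_bound t m / 15"
    proof -
      obtain k where "m = Suc k" using m by (cases m) auto
      then show ?thesis using True by (simp add: moment_bound_def moment_base_def min_def)
    qed
    finally show ?thesis using True by (simp add: R_def)
  next
    case False
    have "L m \<le> 4 * (1 / (16 * 4 ^ t)) * 4 ^ t"
      using False cutoff_root[of t m] unfolding L_def by (intro mult_mono) (auto simp: word_l_def)
    then have "L m \<le> 1 / 4" by simp
    then have "L m * moment_bound t (m - 1) \<le> 1 / 4 * moment_bound t (m - 1)"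
      using base by (intro mult_right_mono) (auto simp: moment_bound_def)
    also have "moment_bound t (m - 1) \<le> 2 * moment_bound t m"
    proof (cases "m = ?c")
      case True
      then have "moment_bound t m = moment_base t * moment_bound t (m - 1)"
        using m power_minus_mult[of ?c "moment_base t"] c1 by (simp add: moment_bound_def mult.commute)
      moreover have "1 * moment_bound t (m - 1) \<le> moment_base t * moment_bound t (m - 1)"
        using base by (intro mult_right_mono) (auto simp: moment_bound_def)
      moreover have "0 \<le> moment_bound t m" using base by (simp add: moment_bound_def)
      ultimately show ?thesis by simp
    next
      case False
      then have "Suc (m - 1 - ?c) = m - ?c" "min (m - 1) ?c = ?c" "min m ?c = ?c" using \<open>\<not> m < ?c\<close> by auto
      then have "moment_bound t m = moment_base t ^ ?c * (1 / 2) ^ Suc (m - 1 - ?c)"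
        "moment_bound t (m - 1) = moment_base t ^ ?c * (1 / 2) ^ (m - 1 - ?c)"
        by (simp_all only: moment_bound_def)
      then show ?thesis by simp
    qed
    finally show ?thesis using False by (simp add: R_def)
  qed
qed

lemma sum_moment_bound:
  assumes "1 \<le> t"
  shows "(\<Sum>m<N. moment_bound t m) \<le> (real (moment_cutoff t) + 2) * moment_base t ^ moment_cutoff t"
proof -
  let ?c = "moment_cutoff t" and ?G = "moment_base t"
  have base: "1 \<le> ?G"
    using assms one_le_power[of "32 * real t" t] by (simp add: moment_base_def)
  have "(\<Sum>m<N. moment_bound t m) \<le> (\<Sum>m<?c + N. moment_bound t m)"
    using base by (intro sum_mono2) (auto simp: moment_bound_def)
  also have "\<dots> = (\<Sum>m<?c. moment_bound t m) + (\<Sum>m<N. moment_bound t (?c + m))"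
    by (induction N) auto
  also have "(\<Sum>m<?c. moment_bound t m) \<le> (\<Sum>m<?c. ?G ^ ?c)"
    using base by (intro sum_mono) (auto simp: moment_bound_def min_def intro: power_increasing)
  also have "(\<Sum>m<N. moment_bound t (?c + m)) = ?G ^ ?c * (\<Sum>m<N. (1 / 2) ^ m)"
    by (simp add: moment_bound_def sum_distrib_left min_absorb2)
  also have "\<dots> \<le> ?G ^ ?c * 2" using base by (intro mult_left_mono) (auto simp: sum_gp_strict)
  finally show ?thesis by (simp add: algebra_simps)
qed

definition failure_bound :: "nat \<Rightarrow> nat \<Rightarrow> real" where
  "failure_bound t K = (2 / real K) ^ t * ((real (moment_cutoff t) + 2) * moment_base t ^ moment_cutoff t)"

text \<open>Markov's inequality for the tilted sum, whose mean is computed with the law of the shape.\<close>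

lemma card_many_rivals_le:
  assumes t: "1 \<le> t" and n: "1 \<le> n" and K: "1 \<le> K"
  shows "real (card {f \<in> parent_maps n. K \<le> card (rivals (bt_of f n))})
    \<le> failure_bound t K * card (parent_maps n)"
    (is "real (card ?E) \<le> _")
proof -
  let ?W = "weight_sum (tilt_l t (word_l t)) (tilt_r t (word_r t))"
  let ?X = "\<lambda>f. (2 / real K) ^ t * (\<Sum>m<n. ?W m (bt_of f n))"
  have wl: "0 < word_l t m" for m using t by (simp add: word_l_def)
  have wr: "0 < word_r t m" for m using t by (simp add: word_r_def field_simps)
  have W_nn: "0 \<le> ?W m B" for m and B :: "nat bt"
    using wl wr by (induction B arbitrary: m) (auto simp: tilt_l_def tilt_r_def less_imp_le intro!: add_nonneg_nonneg mult_nonneg_nonneg)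
  have "real (card ?E) = (\<Sum>f\<in>?E. 1)" by simp
  also have "\<dots> \<le> (\<Sum>f\<in>?E. ?X f)"
  proof (rule sum_mono)
    fix f assume f: "f \<in> ?E"
    note p = bt_of_props[OF n, of f]
    show "1 \<le> ?X f"
    proof (rule many_rivals_weight)
      show "distinct_leaves (bt_of f n)" "nleaves (bt_of f n) \<le> n"
        using p f card_leaves[of "bt_of f n"] by auto
      show "word_r t 0 \<le> 1" by (simp add: word_r_def)
      show "2 * word_l t m + word_r t m \<le> 1" if "1 \<le> m" for m
        using that t by (simp add: word_l_def word_r_def field_simps)
      show "K \<le> card {u \<in> leaves (bt_of f n). 1 \<le> path_weight lik_l lik_r (bt_of f n) u}"
        using f p(1) by simp
    qed (use K wl wr in auto)
  qed
  also have "\<dots> \<le> (\<Sum>f\<in>parent_maps n. ?X f)"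
    using finite_parent_maps W_nn by (intro sum_mono2) (auto intro!: sum_nonneg mult_nonneg_nonneg)
  also have "\<dots> = (2 / real K) ^ t * (\<Sum>m<n. \<Sum>f\<in>parent_maps n. ?W m (shape (bt_of f n)))"
    by (subst sum.swap) (simp add: sum_distrib_left)
  also have "\<dots> = (2 / real K) ^ t * (\<Sum>m<n. card (parent_maps n) * shape_mean n (?W m))"
    by (subst sum_bt_of[OF n]) simp
  also have "\<dots> \<le> (2 / real K) ^ t * (\<Sum>m<n. card (parent_maps n) * moment_bound t m)"
    using t n by (intro mult_left_mono sum_mono shape_mean_tilted_le) auto
  also have "\<dots> = (2 / real K) ^ t * (card (parent_maps n) * (\<Sum>m<n. moment_bound t m))"
    by (simp add: sum_distrib_left)
  also have "\<dots> \<le> (2 / real K) ^ t * (card (parent_maps n) * ((real (moment_cutoff t) + 2) * moment_base t ^ moment_cutoff t))"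
    using t by (intro mult_left_mono sum_moment_bound) auto
  finally show ?thesis by (simp add: failure_bound_def mult_ac)
qed

section \<open>The procedure\<close>

definition adjacency :: "nat \<Rightarrow> edges \<Rightarrow> (nat \<times> nat) set" where
  "adjacency n T = {(x, y). x \<in> {1..n} \<and> y \<in> {1..n} \<and> {x, y} \<in> T}"

text \<open>One plus the distance, so that \<open>0\<close> can mean that \<open>v\<close> is not within \<open>n\<close> steps of \<open>u\<close>.\<close>

definition level :: "nat \<Rightarrow> edges \<Rightarrow> nat \<Rightarrow> nat \<Rightarrow> nat" where
  "level n T u v =
     (if \<exists>k\<le>n. (u, v) \<in> adjacency n T ^^ k then Suc (LEAST k. (u, v) \<in> adjacency n T ^^ k) else 0)"

text \<open>Here \<open>d\<close> is one plus a distance, and the set consists of the \<open>x\<close> for which \<open>w\<close> is on a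
  shortest path from \<open>u\<close>.\<close>

definition branch_prod :: "'a set \<Rightarrow> ('a \<Rightarrow> 'a \<Rightarrow> nat) \<Rightarrow> 'a \<Rightarrow> nat" where
  "branch_prod V d u = (\<Prod>w\<in>V. card {x \<in> V. Suc (d u x) = d u w + d w x})"

abbreviation score :: "nat \<Rightarrow> edges \<Rightarrow> nat \<Rightarrow> nat" where
  "score n T \<equiv> branch_prod {1..n} (level n T)"

text \<open>Ties between equal scores are broken by the label, as \<open>u \<le> n\<close>.\<close>

definition rank_key :: "nat \<Rightarrow> edges \<Rightarrow> nat \<Rightarrow> nat" where
  "rank_key n T u = score n T u * Suc n + u"

definition adam_set :: "nat \<Rightarrow> nat \<Rightarrow> edges \<Rightarrow> nat set" where
  "adam_set K n T = {u \<in> {1..n}. card {v \<in> {1..n}. rank_key n T v < rank_key n T u} < K}"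

lemma rank_key_less_iff:
  assumes "u \<in> {1..n}" "v \<in> {1..n}"
  shows "rank_key n T v < rank_key n T u \<longleftrightarrow>
    score n T v < score n T u \<or>
    score n T v = score n T u \<and> v < u"
proof -
  have less: "a * Suc n + v < b * Suc n + u" if "a < b" "v \<in> {1..n}" "u \<in> {1..n}" for a b u v
  proof -
    have "Suc a * Suc n \<le> b * Suc n" using that by (intro mult_right_mono) auto
    then show ?thesis using that by simp
  qed
  show ?thesis
    using less[of "score n T v" "score n T u" v u]
      less[of "score n T u" "score n T v" u v] assms
    unfolding rank_key_def by (cases "score n T v" "score n T u" rule: linorder_cases) auto
qed

lemma card_lowest:
  fixes key :: "'a \<Rightarrow> nat"
  assumes "finite S" "inj_on key S" "K \<le> card S"
  shows "card {u \<in> S. card {v \<in> S. key v < key u} < K} = K"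
proof -
  let ?r = "\<lambda>u. card {v \<in> S. key v < key u}"
  have mono: "?r u < ?r v" if "u \<in> S" "v \<in> S" "key u < key v" for u v
  proof (rule psubset_card_mono)
    show "{w \<in> S. key w < key u} \<subset> {w \<in> S. key w < key v}" using that by auto
  qed (use assms in simp)
  have inj: "inj_on ?r S"
  proof (rule inj_onI)
    fix u v assume uv: "u \<in> S" "v \<in> S" "?r u = ?r v"
    then have "key u = key v"
      using mono[of u v] mono[of v u] by (cases "key u" "key v" rule: linorder_cases) simp_all
    then show "u = v" using inj_onD[OF assms(2)] uv by blast
  qed
  have sub: "?r ` S \<subseteq> {..<card S}"
  proof
    fix i assume "i \<in> ?r ` S"
    then obtain u where u: "u \<in> S" "i = ?r u" by auto
    have "?r u < card S" using u assms(1) by (intro psubset_card_mono) auto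
    then show "i \<in> {..<card S}" using u by simp
  qed
  have "?r ` S = {..<card S}"
    using sub card_image[OF inj] by (intro card_subset_eq) auto
  have "?r ` {u \<in> S. ?r u < K} = {..<K}"
  proof
    show "{..<K} \<subseteq> ?r ` {u \<in> S. ?r u < K}"
    proof
      fix i assume i: "i \<in> {..<K}"
      then have "i \<in> ?r ` S" unfolding \<open>?r ` S = {..<card S}\<close> using assms(3) by simp
      then obtain u where "u \<in> S" "i = ?r u" by (rule imageE) simp
      then show "i \<in> ?r ` {u \<in> S. ?r u < K}" using i by blast
    qed
  qed blast
  then show ?thesis
    using card_image[OF inj_on_subset[OF inj, of "{u \<in> S. ?r u < K}"]] by simp
qed

lemma adam_set:
  assumes "K \<le> n"
  shows "adam_set K n T \<subseteq> {1..n}" "card (adam_set K n T) = K"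
proof -
  show "adam_set K n T \<subseteq> {1..n}" by (auto simp: adam_set_def)
  have "inj_on (rank_key n T) {1..n}"
  proof (rule inj_onI)
    fix u v assume "u \<in> {1..n}" "v \<in> {1..n}" "rank_key n T u = rank_key n T v"
    then show "u = v" using rank_key_less_iff[of u n v T] rank_key_less_iff[of v n u T]
      by (metis less_irrefl linorder_neqE_nat)
  qed
  then show "card (adam_set K n T) = K"
    unfolding adam_set_def using assms by (intro card_lowest) auto
qed

text \<open>Only keys smaller than that of \<open>u\<close> can displace \<open>u\<close> from the output, hence a miss produces \<open>K\<close> vertices of at most its score.\<close>

lemma adam_set_missed:
  assumes "u \<in> {1..n}" "u \<notin> adam_set K n T"
  shows "K \<le> card {v \<in> {1..n}. score n T v \<le> score n T u}"
proof -
  have "K \<le> card {v \<in> {1..n}. rank_key n T v < rank_key n T u}"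
    using assms by (simp add: adam_set_def)
  also have "\<dots> \<le> card {v \<in> {1..n}. score n T v \<le> score n T u}"
    using rank_key_less_iff[OF assms(1)] by (intro card_mono) auto
  finally show ?thesis .
qed

lemma level_relabel:
  assumes \<sigma>: "\<sigma> permutes {1..n}"
  shows "level n (relabel \<sigma> T) (\<sigma> u) (\<sigma> v) = level n T u v"
proof -
  have adj: "(\<sigma> x, \<sigma> y) \<in> adjacency n (relabel \<sigma> T) \<longleftrightarrow> (x, y) \<in> adjacency n T" for x y
    by (simp only: adjacency_def mem_Collect_eq prod.case relabel_edge_iff[OF permutes_inj[OF \<sigma>]]
        permutes_in_image[OF \<sigma>])
  have "(\<sigma> u, \<sigma> v) \<in> adjacency n (relabel \<sigma> T) ^^ k \<longleftrightarrow> (u, v) \<in> adjacency n T ^^ k" for k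
  proof (induction k arbitrary: v)
    case 0
    show ?case using permutes_inj[OF \<sigma>] by (simp add: inj_eq)
  next
    case (Suc k)
    show ?case
    proof
      assume "(\<sigma> u, \<sigma> v) \<in> adjacency n (relabel \<sigma> T) ^^ Suc k"
      then obtain w' where w': "(\<sigma> u, w') \<in> adjacency n (relabel \<sigma> T) ^^ k" "(w', \<sigma> v) \<in> adjacency n (relabel \<sigma> T)"
        by auto
      obtain w where "w' = \<sigma> w" using permutes_surj[OF \<sigma>] by (metis surjD)
      then show "(u, v) \<in> adjacency n T ^^ Suc k" using w' Suc.IH adj by auto
    qed (use Suc.IH adj in auto)
  qed
  then show ?thesis by (simp add: level_def)
qed

lemma card_permuted:
  assumes \<sigma>: "\<sigma> permutes S"
  shows "card {x \<in> S. P x} = card {x \<in> S. P (\<sigma> x)}"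
proof -
  have "{x \<in> S. P x} = \<sigma> ` {x \<in> S. P (\<sigma> x)}"
  proof
    show "{x \<in> S. P x} \<subseteq> \<sigma> ` {x \<in> S. P (\<sigma> x)}"
    proof
      fix x assume x: "x \<in> {x \<in> S. P x}"
      obtain y where y: "x = \<sigma> y" using permutes_surj[OF \<sigma>] by (metis surjD)
      then have "y \<in> S" using x permutes_in_image[OF \<sigma>, of y] by blast
      then show "x \<in> \<sigma> ` {x \<in> S. P (\<sigma> x)}" using x y by blast
    qed
    show "\<sigma> ` {x \<in> S. P (\<sigma> x)} \<subseteq> {x \<in> S. P x}" using permutes_in_image[OF \<sigma>] by blast
  qed
  then show ?thesis by (simp add: card_image[OF permutes_inj_on[OF \<sigma>]])
qed

lemma score_relabel:
  assumes \<sigma>: "\<sigma> permutes {1..n}"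
  shows "score n (relabel \<sigma> T) (\<sigma> u) = score n T u"
proof -
  let ?d = "level n (relabel \<sigma> T)"
  have bij: "bij_betw \<sigma> {1..n} {1..n}" by (rule permutes_imp_bij[OF \<sigma>])
  have "branch_prod {1..n} ?d (\<sigma> u)
     = (\<Prod>w\<in>{1..n}. card {x \<in> {1..n}. Suc (?d (\<sigma> u) x) = ?d (\<sigma> u) (\<sigma> w) + ?d (\<sigma> w) x})"
    unfolding branch_prod_def by (rule prod.reindex_bij_betw[OF bij, symmetric])
  also have "\<dots> = score n T u"
    unfolding branch_prod_def
  proof (intro prod.cong refl)
    fix w
    show "card {x \<in> {1..n}. Suc (?d (\<sigma> u) x) = ?d (\<sigma> u) (\<sigma> w) + ?d (\<sigma> w) x}
      = card {x \<in> {1..n}. Suc (level n T u x) = level n T u w + level n T w x}"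
      by (subst card_permuted[OF \<sigma>]) (simp add: level_relabel[OF \<sigma>])
  qed
  finally show ?thesis .
qed

section \<open>Distances in a binary tree\<close>

fun bt_dist :: "'a bt \<Rightarrow> 'a \<Rightarrow> 'a \<Rightarrow> nat" where
  "bt_dist (Lf x) u v = 0"
| "bt_dist (Nd a b) u v =
     (if u \<in> leaves a then (if v \<in> leaves a then bt_dist a u v else Suc (leaf_depth a u + leaf_depth b v))
      else (if v \<in> leaves a then Suc (leaf_depth b u + leaf_depth a v) else bt_dist b u v))"

lemma bt_dist_sym: "bt_dist B u v = bt_dist B v u"
  by (induction B) auto

lemma bt_dist_self: "bt_dist B u u = 0"
  by (induction B) auto

lemma bt_dist_0: "u \<in> leaves B \<Longrightarrow> v \<in> leaves B \<Longrightarrow> bt_dist B u v = 0 \<Longrightarrow> u = v"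
  by (induction B) (auto split: if_splits)

lemma root_notin_left: "distinct_leaves (Nd a b) \<Longrightarrow> bt_root b \<notin> leaves a"
  using bt_root_in_leaves[of b] by auto

lemma leaf_depth_root: "distinct_leaves B \<Longrightarrow> leaf_depth B (bt_root B) = 0"
proof (induction B)
  case (Nd a b)
  then show ?case using root_notin_left[of a b] by simp
qed auto

lemma bt_dist_root: "distinct_leaves B \<Longrightarrow> bt_dist B u (bt_root B) = leaf_depth B u"
proof (induction B)
  case (Nd a b)
  then show ?case using root_notin_left[of a b] by (simp add: leaf_depth_root)
qed auto

lemma bt_dist_less: "bt_dist B u v < nleaves B"
proof (induction B)
  case (Nd a b)
  then show ?case
    using leaf_depth_less[of a u] leaf_depth_less[of b v] leaf_depth_less[of a v] leaf_depth_less[of b u] by auto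
qed auto

lemma bt_edges_subset: "e \<in> bt_edges B \<Longrightarrow> e \<subseteq> leaves B"
  by (induction B) (auto simp: bt_root_in_leaves)

lemma bt_dist_step:
  assumes "distinct_leaves B" "{v, w} \<in> bt_edges B"
  shows "bt_dist B u w \<le> Suc (bt_dist B u v)"
  using assms
proof (induction B arbitrary: u v w)
  case (Nd a b)
  have d: "distinct_leaves a" "distinct_leaves b" "leaves a \<inter> leaves b = {}" using Nd.prems by auto
  note r = root_notin_left[OF Nd.prems(1)] leaf_depth_root[OF d(1)] leaf_depth_root[OF d(2)]
    bt_root_in_leaves[of a] bt_dist_root[OF d(1)] bt_dist_root[OF d(2)]
  from Nd.prems(2) consider "{v, w} = {bt_root a, bt_root b}" | "{v, w} \<in> bt_edges a" | "{v, w} \<in> bt_edges b"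
    by auto
  then show ?case
  proof cases
    case 1
    then show ?thesis using r by (auto simp: doubleton_eq_iff)
  next
    case 2
    then have "v \<in> leaves a" "w \<in> leaves a" using bt_edges_subset[of "{v, w}" a] by auto
    moreover have "leaf_depth a w \<le> Suc (leaf_depth a v)"
      using Nd.IH(1)[OF d(1) 2, of "bt_root a"] by (simp add: bt_dist_sym[of a "bt_root a"] r)
    ultimately show ?thesis using Nd.IH(1)[OF d(1) 2] by auto
  next
    case 3
    then have "v \<in> leaves b" "w \<in> leaves b" using bt_edges_subset[of "{v, w}" b] by auto
    then have "v \<notin> leaves a" "w \<notin> leaves a" using d(3) by auto
    moreover have "leaf_depth b w \<le> Suc (leaf_depth b v)"
      using Nd.IH(2)[OF d(2) 3, of "bt_root b"] by (simp add: bt_dist_sym[of b "bt_root b"] r)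
    ultimately show ?thesis using Nd.IH(2)[OF d(2) 3] by auto
  qed
qed simp

definition bt_adj :: "'a bt \<Rightarrow> ('a \<times> 'a) set" where
  "bt_adj B = {(x, y). {x, y} \<in> bt_edges B}"

lemma bt_walk:
  assumes "distinct_leaves B" "u \<in> leaves B" "v \<in> leaves B"
  shows "(u, v) \<in> bt_adj B ^^ bt_dist B u v"
  using assms
proof (induction B arbitrary: u v)
  case (Nd a b)
  have d: "distinct_leaves a" "distinct_leaves b" "leaves a \<inter> leaves b = {}" using Nd.prems by auto
  let ?R = "bt_adj (Nd a b)"
  have mono: "bt_adj a ^^ k \<subseteq> ?R ^^ k" "bt_adj b ^^ k \<subseteq> ?R ^^ k" for k
    by (induction k) (auto simp: bt_adj_def)
  have edge: "(bt_root a, bt_root b) \<in> ?R" "(bt_root b, bt_root a) \<in> ?R"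
    by (auto simp: bt_adj_def insert_commute)
  have up: "(x, bt_root a) \<in> ?R ^^ leaf_depth a x" "(bt_root a, x) \<in> ?R ^^ leaf_depth a x" if "x \<in> leaves a" for x
    using Nd.IH(1)[OF d(1), of x "bt_root a"] Nd.IH(1)[OF d(1), of "bt_root a" x] that mono(1)
    by (auto simp: bt_root_in_leaves bt_dist_root[OF d(1)] bt_dist_sym[of a "bt_root a"])
  have up': "(x, bt_root b) \<in> ?R ^^ leaf_depth b x" "(bt_root b, x) \<in> ?R ^^ leaf_depth b x" if "x \<in> leaves b" for x
    using Nd.IH(2)[OF d(2), of x "bt_root b"] Nd.IH(2)[OF d(2), of "bt_root b" x] that mono(2)
    by (auto simp: bt_root_in_leaves bt_dist_root[OF d(2)] bt_dist_sym[of b "bt_root b"])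
  have via: "(x, z) \<in> ?R ^^ Suc (i + j)" if "(x, p) \<in> ?R ^^ i" "(p, q) \<in> ?R" "(q, z) \<in> ?R ^^ j" for x z p q i j
  proof -
    have "(x, q) \<in> ?R ^^ Suc i" using that(1,2) by auto
    then have "(x, z) \<in> ?R ^^ Suc i O ?R ^^ j" using that(3) by blast
    then show ?thesis by (simp only: relpow_add[symmetric] add_Suc)
  qed
  consider "u \<in> leaves a" "v \<in> leaves a" | "u \<in> leaves a" "v \<in> leaves b" | "u \<in> leaves b" "v \<in> leaves a"
    | "u \<in> leaves b" "v \<in> leaves b" using Nd.prems by auto
  then show ?case
  proof cases
    case 1
    then show ?thesis using Nd.IH(1)[OF d(1), of u v] mono(1) by auto
  next
    case 2
    then have "v \<notin> leaves a" using d(3) by auto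
    then show ?thesis using 2 via[OF up(1) edge(1) up'(2)] by (simp del: relpow.simps)
  next
    case 3
    then have "u \<notin> leaves a" using d(3) by auto
    then show ?thesis using 3 via[OF up'(1) edge(2) up(2)] by (simp del: relpow.simps)
  next
    case 4
    then have "u \<notin> leaves a" "v \<notin> leaves a" using d(3) by auto
    then show ?thesis using 4 Nd.IH(2)[OF d(2), of u v] mono(2) by auto
  qed
qed (simp add: bt_adj_def)

lemma bt_dist_le_walk:
  assumes "distinct_leaves B" "(u, v) \<in> bt_adj B ^^ k"
  shows "bt_dist B u v \<le> k"
  using assms(2)
proof (induction k arbitrary: v)
  case 0
  then show ?case by (simp add: bt_dist_self)
next
  case (Suc k)
  then obtain w where "(u, w) \<in> bt_adj B ^^ k" "{w, v} \<in> bt_edges B" by (auto simp: bt_adj_def)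
  then show ?case using Suc.IH[of w] bt_dist_step[OF assms(1), of w v u] by simp
qed

text \<open>The distance of the binary tree changes by at most one across an edge, so no walk is shorter, and \<open>bt_walk\<close> attains it.\<close>

lemma level_bt_dist:
  assumes f: "f \<in> parent_maps n" and n: "1 \<le> n" and uv: "u \<in> {1..n}" "v \<in> {1..n}"
  shows "level n (tree_of n f) u v = Suc (bt_dist (bt_of f n) u v)"
proof -
  note p = bt_of_props[OF n f]
  define B where "B = bt_of f n"
  have adj: "adjacency n (tree_of n f) = bt_adj B"
    using bt_edges_subset[of _ B] p by (fastforce simp: adjacency_def bt_adj_def B_def)
  have walk: "(u, v) \<in> bt_adj B ^^ bt_dist B u v" using p uv by (intro bt_walk) (auto simp: B_def)
  have "bt_dist B u v \<le> n" using bt_dist_less[of B u v] card_leaves[of B] p by (simp add: B_def)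
  then have "\<exists>k\<le>n. (u, v) \<in> bt_adj B ^^ k" using walk by blast
  moreover have "(LEAST k. (u, v) \<in> bt_adj B ^^ k) = bt_dist B u v"
    using walk bt_dist_le_walk[of B u v] p by (intro Least_equality) (auto simp: B_def)
  ultimately show ?thesis by (simp add: level_def adj B_def)
qed

section \<open>Scores along a path\<close>

text \<open>For an edge between \<open>p\<close> and \<open>q\<close> that separates \<open>A\<close> from the rest, the branch at \<open>w\<close> is the same seen from \<open>p\<close> or from \<open>q\<close>,
  except at \<open>w = p\<close> and \<open>w = q\<close>, where it is everything from one end and a side of the edge from the other.\<close>

lemma branch_prod_edge:
  assumes V: "finite V" "A \<subseteq> V" "p \<in> A" "q \<in> V - A"
    and sym: "\<And>x y. d x y = d y x" and self: "\<And>x. d x x = (0::nat)"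
    and zero: "\<And>x y. x \<in> V \<Longrightarrow> y \<in> V \<Longrightarrow> d x y = 0 \<Longrightarrow> x = y"
    and cut: "\<And>x y. x \<in> A \<Longrightarrow> y \<in> V - A \<Longrightarrow> d x y = d x p + 1 + d q y"
  shows "branch_prod V (\<lambda>x y. Suc (d x y)) p * card A = branch_prod V (\<lambda>x y. Suc (d x y)) q * card (V - A)"
proof -
  define c where "c u w = card {x \<in> V. d u x = d u w + d w x}" for u w
  have bp: "branch_prod V (\<lambda>x y. Suc (d x y)) u = (\<Prod>w\<in>V. c u w)" for u
    by (simp add: branch_prod_def c_def)
  \<comment> \<open>The common part of the two products.\<close>
  define R where "R u = (\<Prod>w\<in>V - {p, q}. c u w)" for u
  have pq: "p \<in> V" "q \<in> V" "p \<noteq> q" using V by auto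
  have dpq: "d p y = Suc (d q y)" if "y \<in> V - A" for y using cut[of p y] that V self by simp
  have dqp: "d q x = Suc (d p x)" if "x \<in> A" for x
    using cut[of x q] that V self sym[of x q] sym[of x p] by simp
  have R: "R p = R q" unfolding R_def
  proof (intro prod.cong refl)
    fix w assume w: "w \<in> V - {p, q}"
    show "c p w = c q w" unfolding c_def
    proof (intro arg_cong[where f = card] Collect_cong conj_cong refl)
      fix x assume x: "x \<in> V"
      show "d p x = d p w + d w x \<longleftrightarrow> d q x = d q w + d w x"
      proof (cases "w \<in> A"; cases "x \<in> A")
        assume "w \<in> A" "x \<notin> A"
        moreover have "d p w \<noteq> 0" using zero[of p w] w pq by auto
        ultimately show ?thesis
          using cut[of w x] dpq[of x] dqp[of w] x sym[of w p] by simp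
      next
        assume "w \<notin> A" "x \<in> A"
        moreover have "d q w \<noteq> 0" using zero[of q w] w pq by auto
        ultimately show ?thesis
          using cut[of x w] dpq[of w] dqp[of x] w sym[of x w] sym[of x p] by simp
      qed (use dpq dqp w x in auto)
    qed
  qed
  have "c p p = card V" "c q q = card V" by (simp_all add: c_def self)
  moreover have "c q p = card A"
  proof -
    have "{x \<in> V. d q x = d q p + d p x} = A"
      using V dqp[of p] dqp dpq self by (auto intro: ccontr)
    then show ?thesis by (simp add: c_def)
  qed
  moreover have "c p q = card (V - A)"
  proof -
    have "{x \<in> V. d p x = d p q + d q x} = V - A"
      using V dpq[of q] dqp dpq self by (auto intro: ccontr)
    then show ?thesis by (simp add: c_def)
  qed
  moreover have "(\<Prod>w\<in>V. c u w) = c u p * (c u q * R u)" for u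
  proof -
    have "V = insert p (insert q (V - {p, q}))" using pq by auto
    then have "(\<Prod>w\<in>V. c u w) = (\<Prod>w\<in>insert p (insert q (V - {p, q})). c u w)" by simp
    then show ?thesis using V pq by (simp add: R_def)
  qed
  ultimately show ?thesis by (simp add: bp R)
qed

lemma branch_prod_pos:
  assumes "finite V" "\<And>x. d x x = (0::nat)"
  shows "0 < branch_prod V (\<lambda>x y. Suc (d x y)) u"
  unfolding branch_prod_def
proof (rule prod_pos)
  fix w assume "w \<in> V"
  then have "w \<in> {x \<in> V. Suc (Suc (d u x)) = Suc (d u w) + Suc (d w x)}" using assms by simp
  then show "0 < card {x \<in> V. Suc (Suc (d u x)) = Suc (d u w) + Suc (d w x)}"
    using assms(1) by (intro card_gt_0_iff[THEN iffD2]) auto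
qed

inductive subtree :: "'a bt \<Rightarrow> 'a bt \<Rightarrow> bool" where
  refl: "subtree s s"
| left: "subtree s a \<Longrightarrow> subtree s (Nd a b)"
| right: "subtree s b \<Longrightarrow> subtree s (Nd a b)"

lemma subtree_leaves: "subtree s B \<Longrightarrow> leaves s \<subseteq> leaves B"
  by (induction rule: subtree.induct) auto

lemma subtree_children:
  assumes "subtree (Nd a b) B"
  shows "subtree a B" "subtree b B"
proof -
  have "subtree a B \<and> subtree b B"
    using assms by (induction "Nd a b" B rule: subtree.induct) (auto intro: subtree.intros)
  then show "subtree a B" "subtree b B" by auto
qed

lemma subtree_distinct: "subtree s B \<Longrightarrow> distinct_leaves B \<Longrightarrow> distinct_leaves s"
  by (induction rule: subtree.induct) auto

lemma root_notin_subtree_left: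
  assumes "subtree (Nd p q) B" "distinct_leaves B"
  shows "bt_root B \<notin> leaves p"
  using assms
proof (induction "Nd p q" B rule: subtree.induct)
  case refl
  then show ?case using root_notin_left[of p q] by simp
next
  case (left a b)
  then show ?case using subtree_leaves[of "Nd p q" a] root_notin_left[of a b] by auto
qed simp

text \<open>In a subtree \<open>Nd p q\<close> the edge between the two roots is the only way out of the leaves of \<open>p\<close>.\<close>

lemma bt_dist_cut:
  assumes "subtree (Nd p q) B" "distinct_leaves B" "x \<in> leaves p" "y \<in> leaves B - leaves p"
  shows "bt_dist B x y = bt_dist B x (bt_root p) + 1 + bt_dist B (bt_root q) y"
  using assms
proof (induction "Nd p q" B arbitrary: y rule: subtree.induct)
  case refl
  then show ?case
    using root_notin_left[of p q] bt_root_in_leaves[of p] bt_dist_root[of p x] bt_dist_root[of q y]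
    by (auto simp: bt_dist_sym[of q "bt_root q"])
next
  case (left a b)
  note sub = subtree_leaves[OF left.hyps(1)]
  have r: "bt_root p \<in> leaves a" "bt_root q \<in> leaves a" "x \<in> leaves a"
    using sub bt_root_in_leaves[of p] bt_root_in_leaves[of q] left.prems by auto
  show ?case
  proof (cases "y \<in> leaves a")
    case True
    then show ?thesis using left r by auto
  next
    case False
    have "bt_root a \<in> leaves a - leaves p"
      using root_notin_subtree_left[OF left.hyps(1)] left.prems bt_root_in_leaves[of a] by auto
    then have "leaf_depth a x = bt_dist a x (bt_root p) + 1 + leaf_depth a (bt_root q)"
      using left.hyps(2)[of "bt_root a"] left.prems by (simp add: bt_dist_root)
    then show ?thesis using False r by simp
  qed
next
  case (right b a)
  note sub = subtree_leaves[OF right.hyps(1)]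
  have "leaves a \<inter> leaves b = {}" using right.prems by simp
  then have r: "bt_root p \<notin> leaves a" "bt_root q \<notin> leaves a" "x \<notin> leaves a"
    using sub bt_root_in_leaves[of p] bt_root_in_leaves[of q] right.prems by auto
  show ?case
  proof (cases "y \<in> leaves a")
    case False
    then show ?thesis using right r by auto
  next
    case True
    have "bt_root b \<in> leaves b - leaves p"
      using root_notin_subtree_left[OF right.hyps(1)] right.prems bt_root_in_leaves[of b] by auto
    then have "leaf_depth b x = bt_dist b x (bt_root p) + 1 + leaf_depth b (bt_root q)"
      using right.hyps(2)[of "bt_root b"] right.prems by (simp add: bt_dist_root)
    then show ?thesis using True r by simp
  qed
qed

abbreviation bt_score :: "'a bt \<Rightarrow> 'a \<Rightarrow> nat" where
  "bt_score B \<equiv> branch_prod (leaves B) (\<lambda>x y. Suc (bt_dist B x y))"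

abbreviation score_ratio :: "nat \<Rightarrow> 'a bt \<Rightarrow> 'a \<Rightarrow> real" where
  "score_ratio N \<equiv> path_weight (\<lambda>m p q. real p / (real N - real p)) (\<lambda>m p q. 1)"

text \<open>The edges of the path are those between the parts of the nodes at which it turns left; the telescoping
  product of \<open>branch_prod_edge\<close> over them is the ratio.\<close>

lemma bt_score_path:
  assumes B: "distinct_leaves B" and s: "subtree s B" "u \<in> leaves s"
  defines "\<phi> \<equiv> bt_score B"
  shows "real (\<phi> u) * score_ratio (nleaves B) s u = \<phi> (bt_root s)"
  using s
proof (induction s)
  case (Nd a b)
  note ch = subtree_children[OF Nd.prems(1)]
  let ?w = "score_ratio (nleaves B)"
  show ?case
  proof (cases "u \<in> leaves a")
    case True
    have dis: "distinct_leaves (Nd a b)" by (rule subtree_distinct[OF Nd.prems(1) B])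
    have sub: "leaves a \<subseteq> leaves B" "leaves b \<subseteq> leaves B" using ch subtree_leaves by auto
    have ra: "bt_root a \<in> leaves a" and rb: "bt_root b \<in> leaves B - leaves a"
      using bt_root_in_leaves[of a] bt_root_in_leaves[of b] sub root_notin_left[OF dis] by auto
    have "\<phi> (bt_root a) * card (leaves a) = \<phi> (bt_root b) * card (leaves B - leaves a)"
      unfolding \<phi>_def
      using finite_leaves[of B] sub ra rb bt_dist_cut[OF Nd.prems(1) B] bt_dist_0[of _ B]
      by (intro branch_prod_edge) (auto simp: bt_dist_self intro: bt_dist_sym)
    moreover have "card (leaves a) = nleaves a" using dis by (simp add: card_leaves)
    moreover have "card (leaves B - leaves a) = nleaves B - nleaves a"
      using sub dis B finite_leaves[of a] by (simp add: card_Diff_subset card_leaves)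
    moreover have less: "nleaves a < nleaves B"
    proof -
      have "card (leaves a) < card (leaves B)"
        using finite_leaves[of B] sub rb by (intro psubset_card_mono) auto
      then show ?thesis using dis B by (simp add: card_leaves)
    qed
    ultimately have "real (\<phi> (bt_root a)) * nleaves a = \<phi> (bt_root b) * (real (nleaves B) - nleaves a)"
      by (metis of_nat_mult of_nat_diff less_imp_le)
    moreover have "real (nleaves B) - nleaves a > 0" using less by simp
    moreover have "real (\<phi> u) * ?w a u = \<phi> (bt_root a)" using Nd.IH(1)[OF ch(1) True] .
    ultimately have "real (\<phi> u) * (real (nleaves a) / (real (nleaves B) - nleaves a) * ?w a u) = \<phi> (bt_root b)"
      by (simp add: field_simps)
    then show ?thesis using True by simp
  next
    case False
    then show ?thesis using Nd.IH(2)[OF ch(2)] Nd.prems by simp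
  qed
qed simp

text \<open>With \<open>n = p + q\<close>, the size of the current part, the left-step factor \<open>p / (N - p)\<close> is at most \<open>p / N * (n / (n - p))\<close>, because \<open>n \<le> N\<close>. The remaining
  powers of \<open>p / N\<close> telescope, which is why the induction carries the power of \<open>nleaves s / N\<close>.\<close>

lemma score_ratio_le:
  assumes "nleaves s \<le> N"
  shows "score_ratio N s u
    \<le> (real (nleaves s) / real N) ^ leaf_depth s u * path_weight lik_l lik_r s u"
  using assms
proof (induction s)
  case (Nd a b)
  let ?w = "score_ratio N"
  let ?\<omega> = "path_weight lik_l lik_r"
  define p q where "p = real (nleaves a)" and "q = real (nleaves b)"
  have pq: "0 < p" "0 < q" "p + q \<le> real N" using nleaves_pos[of a] nleaves_pos[of b] Nd.prems by (auto simp: p_def q_def)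
  have scale: "((p + q) / N) ^ k * (x / (p + q)) ^ k = (x / N) ^ k" for x k
    using pq by (simp add: power_mult_distrib[symmetric])
  have \<omega>: "0 < ?\<omega> t u" for t :: "'a bt" by (intro path_weight_pos lik_pos)
  show ?case
  proof (cases "u \<in> leaves a")
    case True
    let ?m = "leaf_depth a u"
    have "?w (Nd a b) u = p / (N - p) * ?w a u" using True by (simp add: p_def)
    also have "\<dots> \<le> (p / N * ((p + q) / q)) * ((p / N) ^ ?m * ?\<omega> a u)"
    proof (rule mult_mono)
      have "p * (N * q) \<le> p * ((p + q) * (N - p))"
        using pq mult_nonneg_nonneg[of p "N - (p + q)"] by (intro mult_left_mono) (auto simp: algebra_simps)
      then show "p / (N - p) \<le> p / N * ((p + q) / q)" using pq by (simp add: field_simps)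
      show "?w a u \<le> (p / N) ^ ?m * ?\<omega> a u" using Nd.IH(1) Nd.prems by (simp add: p_def)
      show "0 \<le> ?w a u"
        using Nd.prems
      proof (induction a)
        case (Nd c d)
        then show ?case by auto
      qed auto
    qed (use pq in auto)
    also have "\<dots> = (p / N) ^ Suc ?m * ((p + q) / q) * ?\<omega> a u" by simp
    also have "\<dots> = ((p + q) / N) ^ Suc ?m * (lik_l (Suc ?m) (nleaves a) (nleaves b) * ?\<omega> a u)"
      unfolding scale[of "Suc ?m" p, symmetric] by (simp only: lik_l_def p_def q_def of_nat_add mult_ac)
    finally show ?thesis using True by (simp add: p_def q_def)
  next
    case False
    let ?m = "leaf_depth b u"
    have "?w (Nd a b) u \<le> (q / N) ^ ?m * ?\<omega> b u" using False Nd.IH(2) Nd.prems by (simp add: q_def)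
    also have "\<dots> = ((p + q) / N) ^ ?m * (lik_r ?m (nleaves a) (nleaves b) * ?\<omega> b u)"
      unfolding scale[of ?m q, symmetric] by (simp only: lik_r_def p_def q_def of_nat_add mult_ac)
    finally show ?thesis using False by (simp add: p_def q_def)
  qed
qed simp

lemma rival_if_score_le:
  assumes B: "distinct_leaves B" and u: "u \<in> leaves B"
    and le: "bt_score B u \<le> bt_score B (bt_root B)"
  shows "1 \<le> path_weight lik_l lik_r B u"
proof -
  let ?\<phi> = "bt_score B"
  let ?w = "score_ratio (nleaves B) B u"
  have "real (?\<phi> u) * 1 \<le> real (?\<phi> u) * ?w"
    using bt_score_path[OF B subtree.refl u] le by simp
  moreover have "0 < ?\<phi> u" using finite_leaves[of B] by (intro branch_prod_pos) (auto simp: bt_dist_self)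
  ultimately have "1 \<le> ?w" by (subst (asm) mult_le_cancel_left_pos) auto
  also have "\<dots> \<le> path_weight lik_l lik_r B u"
    using score_ratio_le[of B "nleaves B" u] nleaves_pos[of B] by simp
  finally show ?thesis .
qed

lemma find_prob_adam_set_ge:
  assumes t: "1 \<le> t" and K: "1 \<le> K" and n: "2 \<le> n"
  shows "1 - failure_bound t K
     \<le> find_prob (adam_set K) n"
proof -
  let ?P = "{\<sigma>. \<sigma> permutes {1..n}}"
  let ?E = "{f \<in> parent_maps n. K \<le> card (rivals (bt_of f n))}"
  have "miss n (adam_set K n) 1 \<subseteq> ?E \<times> ?P"
  proof (rule subsetI)
    fix x assume "x \<in> miss n (adam_set K n) 1"
    then obtain f \<sigma> where x: "x = (f, \<sigma>)"
      and *: "(f, \<sigma>) \<in> samples n" "\<sigma> 1 \<notin> adam_set K n (relabel \<sigma> (tree_of n f))" by (auto simp: miss_def)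
    then have f: "f \<in> parent_maps n" and \<sigma>: "\<sigma> permutes {1..n}" by (auto simp: samples_def)
    define B where "B = bt_of f n"
    have n1: "1 \<le> n" using n by simp
    note p = bt_of_props[OF n1 f, folded B_def]
    let ?b = "score n (tree_of n f)"
    let ?b' = "score n (relabel \<sigma> (tree_of n f))"
    have "\<sigma> 1 \<in> {1..n}" using permutes_in_image[OF \<sigma>, of 1] n by auto
    from adam_set_missed[OF this *(2)]
    have "K \<le> card {v \<in> {1..n}. ?b' v \<le> ?b' (\<sigma> 1)}" .
    also have "\<dots> = card {u \<in> {1..n}. ?b u \<le> ?b 1}"
      by (subst card_permuted[OF \<sigma>]) (simp only: score_relabel[OF \<sigma>])
    also have "\<dots> \<le> card (rivals B)"
    proof (rule card_mono)
      have b: "?b u = bt_score B u" if "u \<in> {1..n}" for u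
        unfolding branch_prod_def p(1)
        using that by (intro prod.cong refl arg_cong[where f = card] Collect_cong conj_cong)
          (simp_all add: level_bt_dist[OF f n1, folded B_def])
      have "1 \<in> {1..n}" using n by simp
      note b1 = b[OF this]
      show "{u \<in> {1..n}. ?b u \<le> ?b 1} \<subseteq> rivals B"
      proof
        fix u assume "u \<in> {u \<in> {1..n}. ?b u \<le> ?b 1}"
        then have u: "u \<in> {1..n}" "?b u \<le> ?b 1" by auto
        have "1 \<le> path_weight lik_l lik_r B u"
          using u(2) unfolding b[OF u(1)] b1
          by (intro rival_if_score_le) (use p u in auto)
        then show "u \<in> rivals B" using u(1) p(1) by simp
      qed
    qed (simp add: finite_leaves)
    finally show "x \<in> ?E \<times> ?P" using f \<sigma> by (simp add: B_def x)
  qed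
  then have "card (miss n (adam_set K n) 1) \<le> card (?E \<times> ?P)"
    by (intro card_mono) (auto simp: finite_parent_maps finite_permutations)
  then have "real (card (miss n (adam_set K n) 1)) \<le> real (card ?E) * card ?P"
    by (simp add: card_cartesian_product flip: of_nat_mult)
  also have "\<dots> \<le> failure_bound t K * card (parent_maps n) * card ?P"
    using n by (intro mult_right_mono card_many_rivals_le[OF t _ K]) auto
  also have "\<dots> = failure_bound t K * card (samples n)"
    by (simp add: samples_def card_cartesian_product)
  finally show ?thesis
    using card_samples_pos[of n] by (subst find_prob_eq[OF n]) (simp add: field_simps)
qed

section \<open>The output size\<close>

text \<open>\<open>K\<close> is chosen such that \<open>failure_bound t K \<le> \<epsilon>\<close>. The last term is a generous bound on the logarithm of the moment bound,
  divided by \<open>t\<close>.\<close>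

lemma adam_set_root_finding:
  fixes \<epsilon> :: real
  assumes \<epsilon>: "0 < \<epsilon>" "\<epsilon> < 1" and t: "1 \<le> t"
  obtains K where "1 \<le> K" "root_finding K \<epsilon> (adam_set K)"
    "ln (real K) \<le> 2 + ln (1 / \<epsilon>) / real t + 100 * 2 ^ 16 * 2 ^ (9 * t)"
proof -
  define c where "c = real (moment_cutoff t)"
  define G where "G = moment_base t"
  define M where "M = (c + 2) * G ^ moment_cutoff t"
  define y where "y = (M / \<epsilon>) powr (1 / t)"
  define K where "K = nat \<lceil>2 * y\<rceil>"
  have c: "1 \<le> c" by (simp add: c_def moment_cutoff_def)
  have G: "1 \<le> G" using t one_le_power[of "32 * real t" t] by (simp add: G_def moment_base_def)
  have M: "1 \<le> M" using c one_le_power[OF G] mult_mono[of 1 "c + 2" 1 "G ^ moment_cutoff t"] by (simp add: M_def)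
  have M\<epsilon>: "1 \<le> M / \<epsilon>" using M \<epsilon> by (simp add: field_simps)
  have y: "1 \<le> y" using M\<epsilon> unfolding y_def by (intro ge_one_powr_ge_zero) auto
  have K: "2 * y \<le> real K" "real K \<le> 3 * y" unfolding K_def using y by linarith+
  have K1: "1 \<le> K" using K y by linarith
  have "y ^ t = y powr real t" using y by (simp add: powr_realpow)
  then have "y ^ t = M / \<epsilon>" using M M\<epsilon> \<epsilon> t by (simp add: y_def powr_powr)
  have "(2 / real K) ^ t \<le> (1 / y) ^ t" using K y by (intro power_mono) (auto simp: field_simps)
  also have "\<dots> = \<epsilon> / M" using \<open>y ^ t = M / \<epsilon>\<close> by (simp add: power_divide)
  finally have "(2 / real K) ^ t * M \<le> \<epsilon>" using M by (simp add: field_simps)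
  then have prob: "1 - \<epsilon> \<le> find_prob (adam_set K) n" if "2 \<le> n" for n
    using find_prob_adam_set_ge[OF t K1 that] by (simp add: failure_bound_def M_def c_def G_def)
  have "root_finding K \<epsilon> (adam_set K)"
    unfolding root_finding_def
  proof (intro conjI allI impI)
    show "ereal (1 - \<epsilon>) \<le> liminf (\<lambda>n. ereal (find_prob (adam_set K) n))"
      using prob by (intro Liminf_bounded) (auto simp: eventually_sequentially)
  qed (use adam_set in auto)
  moreover have "ln (real K) \<le> 2 + ln (1 / \<epsilon>) / real t + 100 * 2 ^ 16 * 2 ^ (9 * t)"
  proof -
    have "ln (real K) \<le> ln (3 * y)" using K K1 by (subst ln_le_cancel_iff) auto
    also have "\<dots> = ln 3 + ln M / t + ln (1 / \<epsilon>) / t"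
      using y M \<epsilon> by (simp add: ln_mult y_def ln_powr ln_div diff_divide_distrib)
    also have "ln M = ln (c + 2) + c * (ln 60 + t * ln (32 * real t))"
    proof -
      have "ln G = ln 60 + t * ln (32 * real t)"
      proof -
        have "ln G = ln 60 + ln ((32 * real t) ^ t)"
          unfolding G_def moment_base_def using t by (intro ln_mult_pos) simp_all
        also have "ln ((32 * real t) ^ t) = t * ln (32 * real t)" by (rule ln_realpow)
        finally show ?thesis .
      qed
      then show ?thesis using c G unfolding M_def by (subst ln_mult) (auto simp: ln_realpow c_def)
    qed
    also have "\<dots> / t \<le> (c + 1) + c * (60 + 32 * real t)"
    proof -
      have "(c + 1) * 1 \<le> (c + 1) * real t" using c t by (intro mult_left_mono) auto
      moreover have "ln (c + 2) \<le> (c + 1) * 1" using ln_le_minus_one[of "c + 2"] c by simp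
      ultimately have "ln (c + 2) \<le> (c + 1) * t" by (rule order_trans[rotated])
      moreover have "c * (ln 60 + t * ln (32 * real t)) \<le> c * (60 * t + t * (32 * real t))"
        using ln_le_minus_one[of "32 * real t"] ln_le_minus_one[of "60 :: real"] c t
        by (intro mult_left_mono add_mono) auto
      ultimately have "ln (c + 2) + c * (ln 60 + t * ln (32 * real t)) \<le> ((c + 1) + c * (60 + 32 * real t)) * t"
        by (simp add: algebra_simps)
      then show ?thesis using t by (simp add: divide_le_eq)
    qed
    also have "(c + 1) + c * (60 + 32 * real t) \<le> 100 * (c * real t)"
    proof -
      have "(c + 1) + c * (60 + 32 * real t) = 1 + 61 * c + 32 * (c * real t)" by (simp add: algebra_simps)
      moreover have "c * 1 \<le> c * real t" using c t by (intro mult_left_mono) auto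
      ultimately show ?thesis using c by linarith
    qed
    also have "c * real t \<le> c * 2 ^ t" using c of_nat_less_two_power[of t, where 'a = real] by (intro mult_left_mono) auto
    also have "c * 2 ^ t = 2 ^ 16 * 2 ^ (9 * t)"
      by (simp add: c_def moment_cutoff_def flip: power_add) (simp add: power_add)
    also have "ln 3 \<le> (2 :: real)" using ln_le_minus_one[of "3 :: real"] by simp
    finally show ?thesis by (simp add: algebra_simps)
  qed
  ultimately show ?thesis using that K1 by blast
qed

lemma adam_set_accuracy:
  obtains c :: real where "0 < c"
    "\<And>\<epsilon> :: real. 0 < \<epsilon> \<Longrightarrow> \<epsilon> < 1 / exp 1 \<Longrightarrow>
      \<exists>K. 1 \<le> K \<and> root_finding K \<epsilon> (adam_set K) \<and> real K \<le> exp (c * (ln (1 / \<epsilon>) / ln (ln (1 / \<epsilon>))))"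
proof -
  define C :: real where "C = 100 * 2 ^ 16"
  define c :: real where "c = 38 + 512 * C + exp 18"
  have C: "0 < C" by (simp add: C_def)
  have "0 < c" using C by (simp add: c_def add_pos_pos)
  moreover have "\<exists>K. 1 \<le> K \<and> root_finding K \<epsilon> (adam_set K) \<and> real K \<le> exp (c * (ln (1 / \<epsilon>) / ln (ln (1 / \<epsilon>))))"
    if \<epsilon>: "0 < \<epsilon>" "\<epsilon> < 1 / exp 1" for \<epsilon> :: real
  proof -
    define L where "L = ln (1 / \<epsilon>)"
    define x where "x = L / ln L"
    have "exp 1 < 1 / \<epsilon>" using \<epsilon> by (simp add: field_simps)
    then have "ln (exp 1) < L" unfolding L_def using \<epsilon> by (subst ln_less_cancel_iff) auto
    then have L: "1 < L" by simp
    have lnL: "0 < ln L" "ln L < L" using L ln_less_self[of L] by auto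
    have x1: "1 \<le> x" using lnL by (simp add: x_def field_simps)
    have "\<epsilon> < 1" using \<epsilon>(2) by (rule order.strict_trans) simp
    obtain t :: nat where t: "1 \<le> t" "2 + L / t + C * 2 ^ (9 * t) \<le> c * x"
    \<comment> \<open>With \<open>t\<close> about \<open>ln L / 18\<close> the term \<open>2 ^ (9 * t)\<close> is at most \<open>sqrt L\<close>, and \<open>L / t\<close> is of the right order. For bounded \<open>L\<close> any fixed \<open>t\<close> will do.\<close>
    proof (cases "ln L < 18")
      case True
      have "L = exp (ln L)" using L by simp
      also have "\<dots> \<le> exp 18" using True by simp
      finally have "2 + L + C * 2 ^ 9 \<le> (2 + exp 18 + 512 * C) * 1" by simp
      also have "\<dots> \<le> c * x" using x1 C by (intro mult_mono) (auto simp: c_def add_nonneg_nonneg)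
      finally show ?thesis using that[of 1] by simp
    next
      case False
      define t where "t = nat \<lfloor>ln L / 18\<rfloor>"
      have t1: "1 \<le> t" using False unfolding t_def by (simp add: le_nat_iff le_floor_iff)
      have t: "real t \<le> ln L / 18" "ln L / 18 - 1 \<le> real t" using False unfolding t_def by linarith+
      then have "ln L / 36 \<le> real t" using t1 by simp
      have "0 < real t" using t1 by simp
      then have "L / t \<le> L / (ln L / 36)"
        using \<open>ln L / 36 \<le> real t\<close> L lnL by (intro divide_left_mono mult_pos_pos) linarith+
      then have Lt: "L / t \<le> 36 * x" by (simp add: x_def mult.commute)
      have "(2 :: real) ^ (9 * t) \<le> exp 1 ^ (9 * t)"
        using exp_ge_add_one_self[of 1] by (intro power_mono) auto
      also have "\<dots> = exp (9 * real t)" by (simp add: exp_of_nat_mult[symmetric])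
      also have "\<dots> \<le> exp (ln L / 2)" using t by simp
      also have "\<dots> = sqrt L" using L by (simp add: ln_sqrt[symmetric])
      also have "\<dots> \<le> 2 * x"
      proof -
        have "ln L = 2 * ln (sqrt L)" using L by (simp add: ln_sqrt)
        also have "ln (sqrt L) < sqrt L" using L by (intro ln_less_self) simp
        finally have "sqrt L * ln L \<le> sqrt L * (2 * sqrt L)" using L by (intro mult_left_mono less_imp_le) auto
        also have "\<dots> = 2 * L" using L by simp
        finally show ?thesis using lnL by (simp add: x_def field_simps)
      qed
      finally have "C * 2 ^ (9 * t) \<le> C * (2 * x)" using C by (intro mult_left_mono) auto
      then have "2 + L / t + C * 2 ^ (9 * t) \<le> 2 * x + 36 * x + C * (2 * x)" using Lt x1 by simp
      also have "\<dots> = (38 + 2 * C) * x" by (simp add: algebra_simps)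
      also have "\<dots> \<le> c * x" using x1 C by (intro mult_right_mono) (auto simp: c_def)
      finally show ?thesis using that[of t] t1 by simp
    qed
    obtain K where K: "1 \<le> K" "root_finding K \<epsilon> (adam_set K)"
      "ln (real K) \<le> 2 + ln (1 / \<epsilon>) / real t + 100 * 2 ^ 16 * 2 ^ (9 * t)"
      using adam_set_root_finding[OF \<epsilon>(1) \<open>\<epsilon> < 1\<close> t(1)] .
    then have "ln (real K) \<le> c * x" using t(2) by (simp add: L_def C_def)
    then have "exp (ln (real K)) \<le> exp (c * x)" by (simp only: exp_le_cancel_iff)
    then have "real K \<le> exp (c * x)" using K(1) by simp
    then show ?thesis using K by (auto simp: x_def L_def)
  qed
  ultimately show ?thesis using that by blast
qed

section \<open>The cost of expressions\<close>

fun esize :: "aexp \<Rightarrow> nat" where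
  "esize (Num k) = 1"
| "esize (Mem a) = Suc (esize a)"
| "esize (Plus a b) = Suc (esize a + esize b)"
| "esize (Minus a b) = Suc (esize a + esize b)"
| "esize (Times a b) = Suc (esize a + esize b)"
| "esize (Div a b) = Suc (esize a + esize b)"

fun max_const :: "aexp \<Rightarrow> nat" where
  "max_const (Num k) = k"
| "max_const (Mem a) = max_const a"
| "max_const (Plus a b) = max (max_const a) (max_const b)"
| "max_const (Minus a b) = max (max_const a) (max_const b)"
| "max_const (Times a b) = max (max_const a) (max_const b)"
| "max_const (Div a b) = max (max_const a) (max_const b)"

lemma bits_mono: "k \<le> l \<Longrightarrow> bits k \<le> bits l"
  by (simp add: bits_def floorlog_mono)

lemma bits_le:
  assumes "k < 2 ^ m"
  shows "bits k \<le> Suc m"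
  using assms by (simp add: bits_def floorlog_le_iff)

lemma less_power_bits: "k < 2 ^ (bits k - 1)"
  using floorlog_bounds[of k 2] by (cases "k = 0") (auto simp: bits_def)

lemma bits_power_le:
  assumes "1 \<le> m"
  shows "bits (V ^ m) \<le> m * bits V"
proof -
  have "V ^ m < 2 ^ ((bits V - 1) * m)"
    unfolding power_mult using assms less_power_bits[of V] by (intro power_strict_mono) auto
  then have "bits (V ^ m) \<le> Suc ((bits V - 1) * m)" by (rule bits_le)
  also have "\<dots> \<le> m + (bits V - 1) * m" using assms by simp
  also have "\<dots> = m * bits V" by (simp add: bits_def algebra_simps)
  finally show ?thesis .
qed

lemma esize_pos: "1 \<le> esize e"
  by (cases e) auto

lemma aval_le_power:
  assumes s: "\<And>a. s a \<le> V" and V: "2 \<le> V" and "max_const e \<le> V"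
  shows "aval e s \<le> V ^ esize e"
  using assms(3)
proof (induction e)
  case (Mem a)
  have "V ^ 1 \<le> V ^ Suc (esize a)" using V by (intro power_increasing) auto
  then show ?case using s[of "aval a s"] by (simp add: order_trans)
next
  case (Plus a b)
  have "aval a s + aval b s \<le> V ^ esize a + V ^ esize b" using Plus by (intro add_mono) auto
  also have "\<dots> \<le> V ^ (esize a + esize b) + V ^ (esize a + esize b)"
    using V by (intro add_mono power_increasing) auto
  also have "\<dots> \<le> V * V ^ (esize a + esize b)"
    unfolding mult_2[symmetric] using V by (rule mult_right_mono) simp
  finally show ?case by simp
next
  case (Minus a b)
  have "aval a s - aval b s \<le> V ^ esize a" using Minus by simp
  also have "\<dots> \<le> V ^ Suc (esize a + esize b)" using V by (intro power_increasing) auto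
  finally show ?case by simp
next
  case (Times a b)
  have "aval a s * aval b s \<le> V ^ esize a * V ^ esize b" using Times by (intro mult_mono) auto
  also have "\<dots> = V ^ (esize a + esize b)" by (simp add: power_add)
  also have "\<dots> \<le> V ^ Suc (esize a + esize b)" using V by (intro power_increasing) auto
  finally show ?case by simp
next
  case (Div a b)
  have "aval a s div aval b s \<le> aval a s" by simp
  also have "\<dots> \<le> V ^ esize a" using Div by simp
  also have "\<dots> \<le> V ^ Suc (esize a + esize b)" using V by (intro power_increasing) auto
  finally show ?case by simp
qed auto

lemma bits_aval_le:
  assumes "\<And>a. s a \<le> V" "2 \<le> V" "max_const e \<le> V"
  shows "bits (aval e s) \<le> esize e * bits V"
  using bits_mono[OF aval_le_power[of s V e, OF assms]] bits_power_le[OF esize_pos, of V e] by simp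

text \<open>Values grow at most like \<open>V ^ esize e\<close>, so every intermediate result has at most \<open>esize e\<close> times the digits of \<open>V\<close>. Bounding
  the memory cells by \<open>V\<close> is then all that a cost analysis needs.\<close>

lemma acost_le:
  assumes s: "\<And>a. s a \<le> V" and V: "2 \<le> V" and "max_const e \<le> V"
  shows "acost e s \<le> 2 * (esize e)\<^sup>2 * bits V"
proof -
  have binary: "acost a s + acost b s + bits (aval a s) + bits (aval b s)
      \<le> 2 * (Suc (esize a + esize b))\<^sup>2 * bits V"
    if "acost a s \<le> 2 * (esize a)\<^sup>2 * bits V" "acost b s \<le> 2 * (esize b)\<^sup>2 * bits V"
      "max_const a \<le> V" "max_const b \<le> V" for a b
  proof -
    have "acost a s + acost b s + bits (aval a s) + bits (aval b s)
      \<le> 2 * (esize a)\<^sup>2 * bits V + 2 * (esize b)\<^sup>2 * bits V + esize a * bits V + esize b * bits V"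
      using that bits_aval_le[of s V a, OF s V] bits_aval_le[of s V b, OF s V] by simp
    also have "\<dots> \<le> 2 * (Suc (esize a + esize b))\<^sup>2 * bits V" by (simp add: power2_eq_square algebra_simps)
    finally show ?thesis .
  qed
  show ?thesis
    using assms(3)
  proof (induction e)
    case (Num k)
    then show ?case using bits_mono[of k V] by simp
  next
    case (Mem a)
    have "acost (Mem a) s \<le> 2 * (esize a)\<^sup>2 * bits V + esize a * bits V + bits V"
      using Mem bits_aval_le[of s V a, OF s V] bits_mono[OF s[of "aval a s"]] by simp
    also have "\<dots> \<le> 2 * (esize (Mem a))\<^sup>2 * bits V" by (simp add: power2_eq_square algebra_simps)
    finally show ?case .
  qed (simp_all add: binary)
qed

section \<open>Memory layout and counting loops\<close>

text \<open>The input occupies the addresses up to \<open>n * n + n\<close>, so even the registers need addresses relative to this number. They are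
  followed by the distance matrix and by the array of keys. The verdicts are written into the cells \<open>1, \<dots>, n\<close>.\<close>

definition nE :: aexp where "nE = Mem (Num 0)"
definition baseE :: aexp where "baseE = Plus (Times nE nE) nE"
definition regA :: "nat \<Rightarrow> aexp" where "regA r = Plus baseE (Num r)"
definition reg :: "nat \<Rightarrow> aexp" where "reg r = Mem (regA r)"
definition cellE :: "aexp \<Rightarrow> aexp \<Rightarrow> aexp" where "cellE i j = Plus (Times i nE) j"
definition distA :: "aexp \<Rightarrow> aexp \<Rightarrow> aexp" where "distA i j = Plus (Plus baseE (Num 9)) (cellE i j)"
definition keyA :: "aexp \<Rightarrow> aexp" where "keyA i = Plus (Plus baseE (Num 9)) (Plus baseE i)"
text \<open>Truncated subtraction makes comparisons available as arithmetic, and the program can do without conditionals.\<close>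

definition eqE :: "aexp \<Rightarrow> aexp \<Rightarrow> aexp" where "eqE a b = Minus (Num 1) (Plus (Minus a b) (Minus b a))"
definition lessE :: "aexp \<Rightarrow> aexp \<Rightarrow> aexp" where "lessE a b = Minus (Num 1) (Minus (Num 1) (Minus b a))"

lemmas expr_defs = nE_def baseE_def regA_def reg_def cellE_def distA_def keyA_def eqE_def lessE_def

lemma aval_eqE [simp]: "aval (eqE a b) s = (if aval a s = aval b s then 1 else 0)"
  by (auto simp: eqE_def)

lemma aval_lessE [simp]: "aval (lessE a b) s = (if aval a s < aval b s then 1 else 0)"
  by (auto simp: lessE_def)

text \<open>Register \<open>r\<close> counts down from \<open>n\<close>, so that the loop test is a test for zero, and it is \<open>0\<close> again after the loop.\<close>

definition For :: "nat \<Rightarrow> com \<Rightarrow> com" where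
  "For r c = Seq (Assign (regA r) nE) (WhileNZ (reg r) (Seq c (Assign (regA r) (Minus (reg r) (Num 1)))))"

text \<open>Registers, distance matrix, keys, and verdicts.\<close>

type_synonym memory = "(nat \<Rightarrow> nat) \<times> (nat \<Rightarrow> nat \<Rightarrow> nat) \<times> (nat \<Rightarrow> nat) \<times> (nat \<Rightarrow> nat)"

lemma cell_range:
  fixes n u v :: nat
  assumes "u \<in> {1..n}" "v \<in> {1..n}"
  shows "n < u * n + v" "u * n + v \<le> n * n + n"
proof -
  have "n \<le> u * n" using assms by (cases u) auto
  moreover have "u * n \<le> n * n" using assms by (intro mult_right_mono) auto
  moreover have "1 \<le> v" "v \<le> n" using assms by auto
  ultimately show "n < u * n + v" "u * n + v \<le> n * n + n" by linarith+
qed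

lemma cell_inj:
  fixes n u v :: nat
  assumes "v \<in> {1..n}" "v' \<in> {1..n}"
  shows "u * n + v = u' * n + v' \<longleftrightarrow> u = u' \<and> v = v'"
proof -
  have "u = u' \<and> v = v'" if eq: "u * n + v = u' * n + v'"
  proof -
    have "\<not> x < y" if "x * n + a = y * n + b" "a \<in> {1..n}" "b \<in> {1..n}" for x y a b
    proof
      assume "x < y"
      then have "Suc x * n \<le> y * n" by (intro mult_right_mono) auto
      then show False using that by simp
    qed
    from this[OF eq assms] this[OF eq[symmetric] assms(2,1)] have "u = u'" by simp
    then show ?thesis using eq by simp
  qed
  then show ?thesis by auto
qed

locale ram =
  fixes n :: nat and T :: edges
  assumes n_pos: "1 \<le> n"
begin

definition V :: nat where "V = (n + 9) ^ (n + 9)"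

text \<open>Covers every assignment and every loop test of the program, see \<open>small_cost\<close>.\<close>

definition unit_cost :: nat where "unit_cost = 10 ^ 6 * bits V"

definition adj_bit :: "nat \<Rightarrow> nat \<Rightarrow> nat" where "adj_bit u v = (if {u, v} \<in> T then 1 else 0)"

definition rep :: "memory \<Rightarrow> store \<Rightarrow> bool" where
  "rep X s \<longleftrightarrow> (case X of (R, d, f, g) \<Rightarrow>
     s 0 = n \<and> (\<forall>a. s a \<le> V) \<and>
     (\<forall>u\<in>{1..n}. s u = g u) \<and>
     (\<forall>u\<in>{1..n}. \<forall>v\<in>{1..n}. s (u * n + v) = adj_bit u v) \<and>
     (\<forall>r\<in>{1..8}. s (n * n + n + r) = R r) \<and>
     (\<forall>u\<in>{1..n}. \<forall>v\<in>{1..n}. s (n * n + n + 9 + (u * n + v)) = d u v) \<and>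
     (\<forall>u\<in>{1..n}. s (n * n + n + 9 + (n * n + n + u)) = f u))"

text \<open>Total correctness between two memory contents, with a cost of at most \<open>a * n ^ p\<close> units. As the programs are
  deterministic and built from counting loops, single contents can take the place of assertions.\<close>

definition runs :: "com \<Rightarrow> nat \<Rightarrow> nat \<Rightarrow> memory \<Rightarrow> memory \<Rightarrow> bool" where
  "runs c a p X Y \<longleftrightarrow> (\<forall>s. rep X s \<longrightarrow> (\<exists>t s'. exec c s t s' \<and> t \<le> a * n ^ p * unit_cost \<and> rep Y s'))"

lemma rep_cong:
  assumes "rep (R, d, f, g) s"
    and "\<And>r. r \<in> {1..8} \<Longrightarrow> R r = R' r" "\<And>u v. u \<in> {1..n} \<Longrightarrow> v \<in> {1..n} \<Longrightarrow> d u v = d' u v"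
    "\<And>u. u \<in> {1..n} \<Longrightarrow> f u = f' u" "\<And>u. u \<in> {1..n} \<Longrightarrow> g u = g' u"
  shows "rep (R', d', f', g') s"
  using assms unfolding rep_def by simp

lemma runs_cong:
  assumes "runs c a p X (R, d, f, g)"
    and "\<And>r. r \<in> {1..8} \<Longrightarrow> R r = R' r" "\<And>u v. u \<in> {1..n} \<Longrightarrow> v \<in> {1..n} \<Longrightarrow> d u v = d' u v"
    "\<And>u. u \<in> {1..n} \<Longrightarrow> f u = f' u" "\<And>u. u \<in> {1..n} \<Longrightarrow> g u = g' u"
  shows "runs c a p X (R', d', f', g')"
  unfolding runs_def
proof (intro allI impI)
  fix s assume "rep X s"
  then obtain t s' where *: "exec c s t s'" "t \<le> a * n ^ p * unit_cost" "rep (R, d, f, g) s'"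
    using assms(1) unfolding runs_def by blast
  have "rep (R', d', f', g') s'" by (rule rep_cong[OF *(3)]) (use assms(2-5) in auto)
  then show "\<exists>t s'. exec c s t s' \<and> t \<le> a * n ^ p * unit_cost \<and> rep (R', d', f', g') s'"
    using * by blast
qed

lemma V_ge: "9 \<le> V" "n + 9 \<le> V"
proof -
  have "(n + 9) ^ 1 \<le> (n + 9) ^ (n + 9)" by (rule power_increasing) auto
  then show V: "n + 9 \<le> V" by (simp only: V_def power_one_right)
  then show "9 \<le> V" by simp
qed

lemma rep_aval:
  assumes "rep (R, d, f, g) s"
  shows "aval nE s = n" "aval baseE s = n * n + n"
    "aval (regA r) s = n * n + n + r"
    "r \<in> {1..8} \<Longrightarrow> aval (reg r) s = R r"
    "aval (cellE i j) s = aval i s * n + aval j s"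
    "aval (distA i j) s = n * n + n + 9 + (aval i s * n + aval j s)"
    "aval (keyA i) s = n * n + n + 9 + (n * n + n + aval i s)"
    "aval i s \<in> {1..n} \<Longrightarrow> aval j s \<in> {1..n} \<Longrightarrow> aval (Mem (cellE i j)) s = adj_bit (aval i s) (aval j s)"
    "aval i s \<in> {1..n} \<Longrightarrow> aval j s \<in> {1..n} \<Longrightarrow> aval (Mem (distA i j)) s = d (aval i s) (aval j s)"
    "aval i s \<in> {1..n} \<Longrightarrow> aval (Mem (keyA i)) s = f (aval i s)"
  using assms unfolding rep_def by (simp_all add: expr_defs)

lemma rep_bound:
  assumes "rep (R, d, f, g) s"
  shows "s a \<le> V"
    "u \<in> {1..n} \<Longrightarrow> v \<in> {1..n} \<Longrightarrow> d u v \<le> V" "u \<in> {1..n} \<Longrightarrow> f u \<le> V" "u \<in> {1..n} \<Longrightarrow> g u \<le> V"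
  using assms unfolding rep_def prod.case by metis+

definition small :: "aexp \<Rightarrow> bool" where
  "small e \<longleftrightarrow> esize e \<le> 400 \<and> max_const e \<le> 9"

lemma small_cost:
  assumes "rep X s" "small e"
  shows "acost e s + bits (aval e s) \<le> 400000 * bits V"
proof -
  have s: "\<And>a. s a \<le> V" using assms(1) by (cases X) (auto intro: rep_bound)
  have e: "esize e \<le> 400" "max_const e \<le> V" using assms(2) V_ge by (auto simp: small_def)
  have "acost e s \<le> 2 * (esize e)\<^sup>2 * bits V" using V_ge by (intro acost_le s e) auto
  also have "\<dots> \<le> 2 * 400\<^sup>2 * bits V" using e by (intro mult_mono power_mono) auto
  finally have 1: "acost e s \<le> 320000 * bits V" by simp
  have "bits (aval e s) \<le> esize e * bits V" using V_ge by (intro bits_aval_le s e) auto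
  also have "\<dots> \<le> 400 * bits V" using e by (intro mult_right_mono) auto
  finally show ?thesis using 1 by simp
qed

lemma runs_Assign:
  assumes small: "small a" "small b"
    and upd: "\<And>s. rep X s \<Longrightarrow> rep Y (s(aval a s := aval b s))"
  shows "runs (Assign a b) 1 0 X Y"
  unfolding runs_def
proof (intro allI impI exI conjI)
  fix s assume X: "rep X s"
  show "exec (Assign a b) s (acost a s + acost b s + bits (aval a s) + bits (aval b s)) (s(aval a s := aval b s))"
    by (rule exec.Assign)
  show "acost a s + acost b s + bits (aval a s) + bits (aval b s) \<le> 1 * n ^ 0 * unit_cost"
    using small_cost[OF X small(1)] small_cost[OF X small(2)] by (simp add: unit_cost_def)
  show "rep Y (s(aval a s := aval b s))" by (rule upd[OF X])
qed

lemma repD: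
  assumes "rep (R, d, f, g) s"
  shows "s 0 = n" "s a \<le> V" "u \<in> {1..n} \<Longrightarrow> s u = g u"
    "u \<in> {1..n} \<Longrightarrow> v \<in> {1..n} \<Longrightarrow> s (u * n + v) = adj_bit u v"
    "r \<in> {1..8} \<Longrightarrow> s (n * n + n + r) = R r"
    "u \<in> {1..n} \<Longrightarrow> v \<in> {1..n} \<Longrightarrow> s (n * n + n + 9 + (u * n + v)) = d u v"
    "u \<in> {1..n} \<Longrightarrow> s (n * n + n + 9 + (n * n + n + u)) = f u"
  using assms unfolding rep_def prod.case by blast+

lemma repI:
  assumes "s 0 = n" "\<And>a. s a \<le> V" "\<And>u. u \<in> {1..n} \<Longrightarrow> s u = g u"
    "\<And>u v. u \<in> {1..n} \<Longrightarrow> v \<in> {1..n} \<Longrightarrow> s (u * n + v) = adj_bit u v"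
    "\<And>r. r \<in> {1..8} \<Longrightarrow> s (n * n + n + r) = R r"
    "\<And>u v. u \<in> {1..n} \<Longrightarrow> v \<in> {1..n} \<Longrightarrow> s (n * n + n + 9 + (u * n + v)) = d u v"
    "\<And>u. u \<in> {1..n} \<Longrightarrow> s (n * n + n + 9 + (n * n + n + u)) = f u"
  shows "rep (R, d, f, g) s"
  using assms unfolding rep_def prod.case by blast

text \<open>One write, seen through the layout. The four cases below only have to check which address is hit.\<close>

lemma rep_write:
  assumes s: "rep (R, d, f, g) s" and x: "x \<le> V" and A: "A \<noteq> 0"
    and adj: "\<And>u v. u \<in> {1..n} \<Longrightarrow> v \<in> {1..n} \<Longrightarrow> u * n + v \<noteq> A"
  shows "rep (\<lambda>r. if n * n + n + r = A then x else R r,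
      \<lambda>u v. if n * n + n + 9 + (u * n + v) = A then x else d u v,
      \<lambda>u. if n * n + n + 9 + (n * n + n + u) = A then x else f u,
      \<lambda>u. if u = A then x else g u) (s(A := x))"
  by (rule repI) (use repD[OF s] x A adj in \<open>simp_all add: fun_upd_def del: One_nat_def\<close>)

lemma rep_reg:
  assumes "rep (R, d, f, g) s" "x \<le> V" and r: "r \<in> {1..8}"
  shows "rep (R(r := x), d, f, g) (s(n * n + n + r := x))"
proof (rule rep_cong[OF rep_write[OF assms(1,2)]])
  fix u v assume "u \<in> {1..n}" "v \<in> {1..n}"
  then show "u * n + v \<noteq> n * n + n + r" using cell_range[of u n v] r by auto
qed (use r in auto)

lemma rep_dist:
  assumes "rep (R, d, f, g) s" "x \<le> V" and i: "i \<in> {1..n}" "j \<in> {1..n}"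
  shows "rep (R, d(i := (d i)(j := x)), f, g) (s(n * n + n + 9 + (i * n + j) := x))"
proof (rule rep_cong[OF rep_write[OF assms(1,2)]])
  fix u v assume "u \<in> {1..n}" "v \<in> {1..n}"
  then show "u * n + v \<noteq> n * n + n + 9 + (i * n + j)"
    "(if n * n + n + 9 + (u * n + v) = n * n + n + 9 + (i * n + j) then x else d u v) = (d(i := (d i)(j := x))) u v"
    using cell_range[of u n v] cell_inj[OF _ i(2), of v u i] by auto
qed (use cell_range[OF i] in auto)

lemma rep_key:
  assumes "rep (R, d, f, g) s" "x \<le> V" and i: "i \<in> {1..n}"
  shows "rep (R, d, f(i := x), g) (s(n * n + n + 9 + (n * n + n + i) := x))"
proof (rule rep_cong[OF rep_write[OF assms(1,2)]])
  fix u v assume "u \<in> {1..n}" "v \<in> {1..n}"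
  then show "u * n + v \<noteq> n * n + n + 9 + (n * n + n + i)"
    "(if n * n + n + 9 + (u * n + v) = n * n + n + 9 + (n * n + n + i) then x else d u v) = d u v"
    using cell_range[of u n v] i by auto
qed (use i in auto)

lemma rep_out:
  assumes "rep (R, d, f, g) s" "x \<le> V" and i: "i \<in> {1..n}"
  shows "rep (R, d, f, g(i := x)) (s(i := x))"
proof (rule rep_cong[OF rep_write[OF assms(1,2)]])
  fix u v assume "u \<in> {1..n}" "v \<in> {1..n}"
  then show "u * n + v \<noteq> i" using cell_range[of u n v] i by auto
qed (use i in auto)

lemma runs_reg:
  assumes i: "i \<in> {1..8}" and small: "small b"
    and val: "\<And>s. rep (R, d, f, g) s \<Longrightarrow> aval b s = x" and x: "x \<le> V"
  shows "runs (Assign (regA i) b) 1 0 (R, d, f, g) (R(i := x), d, f, g)"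
proof (rule runs_Assign[OF _ small])
  fix s assume s: "rep (R, d, f, g) s"
  show "rep (R(i := x), d, f, g) (s(aval (regA i) s := aval b s))"
    using rep_reg[OF s x] i by (simp add: rep_aval[OF s] val[OF s])
qed (use i in \<open>simp add: small_def expr_defs\<close>)

lemma runs_dist:
  assumes i: "i \<in> {1..8}" "j \<in> {1..8}" "R i \<in> {1..n}" "R j \<in> {1..n}" and small: "small b"
    and val: "\<And>s. rep (R, d, f, g) s \<Longrightarrow> aval b s = x" and x: "x \<le> V"
  shows "runs (Assign (distA (reg i) (reg j)) b) 1 0 (R, d, f, g) (R, d(R i := (d (R i))(R j := x)), f, g)"
proof (rule runs_Assign[OF _ small])
  fix s assume s: "rep (R, d, f, g) s"
  show "rep (R, d(R i := (d (R i))(R j := x)), f, g) (s(aval (distA (reg i) (reg j)) s := aval b s))"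
    using rep_dist[OF s x] i by (simp add: rep_aval[OF s] val[OF s])
qed (use i in \<open>simp add: small_def expr_defs\<close>)

lemma runs_key:
  assumes i: "i \<in> {1..8}" "R i \<in> {1..n}" and small: "small b"
    and val: "\<And>s. rep (R, d, f, g) s \<Longrightarrow> aval b s = x" and x: "x \<le> V"
  shows "runs (Assign (keyA (reg i)) b) 1 0 (R, d, f, g) (R, d, f(R i := x), g)"
proof (rule runs_Assign[OF _ small])
  fix s assume s: "rep (R, d, f, g) s"
  show "rep (R, d, f(R i := x), g) (s(aval (keyA (reg i)) s := aval b s))"
    using rep_key[OF s x] i by (simp add: rep_aval[OF s] val[OF s])
qed (use i in \<open>simp add: small_def expr_defs\<close>)

lemma runs_out:
  assumes i: "i \<in> {1..8}" "R i \<in> {1..n}" and small: "small b"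
    and val: "\<And>s. rep (R, d, f, g) s \<Longrightarrow> aval b s = x" and x: "x \<le> V"
  shows "runs (Assign (reg i) b) 1 0 (R, d, f, g) (R, d, f, g(R i := x))"
proof (rule runs_Assign[OF _ small])
  fix s assume s: "rep (R, d, f, g) s"
  show "rep (R, d, f, g(R i := x)) (s(aval (reg i) s := aval b s))"
    using rep_out[OF s x] i by (simp add: rep_aval[OF s] val[OF s])
qed (use i in \<open>simp add: small_def expr_defs\<close>)

lemma runs_Seq:
  assumes "runs c1 a p X Y" "runs c2 b q Y Z" "p \<le> m" "q \<le> m"
  shows "runs (Seq c1 c2) (a + b) m X Z"
  unfolding runs_def
proof (intro allI impI)
  fix s assume "rep X s"
  then obtain t1 s1 where 1: "exec c1 s t1 s1" "t1 \<le> a * n ^ p * unit_cost" "rep Y s1"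
    using assms(1) unfolding runs_def by blast
  then obtain t2 s2 where 2: "exec c2 s1 t2 s2" "t2 \<le> b * n ^ q * unit_cost" "rep Z s2"
    using assms(2) unfolding runs_def by blast
  have "t1 \<le> a * n ^ m * unit_cost" "t2 \<le> b * n ^ m * unit_cost"
    using 1(2) 2(2) assms(3,4) n_pos
    by (meson le_trans mult_le_mono power_increasing order_refl)+
  then have "t1 + t2 \<le> (a + b) * n ^ m * unit_cost" by (simp add: algebra_simps)
  then show "\<exists>t s'. exec (Seq c1 c2) s t s' \<and> t \<le> (a + b) * n ^ m * unit_cost \<and> rep Z s'"
    using exec.Seq[OF 1(1) 2(1)] 2(3) by blast
qed

text \<open>The contents are indexed by the counter, so they are traversed from index \<open>n\<close> down to index \<open>0\<close>. Register \<open>r\<close> holds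
  the index itself, hence the updates of \<open>R\<close> at \<open>r\<close>.\<close>

lemma runs_For:
  assumes r: "r \<in> {1..8}"
    and body: "\<And>j. 1 \<le> j \<Longrightarrow> j \<le> n \<Longrightarrow>
      runs c a p ((R j)(r := j), d j, f j, g j) ((R (j - 1))(r := j), d (j - 1), f (j - 1), g (j - 1))"
  shows "runs (For r c) (a + 4) (Suc p) (R n, d n, f n, g n) ((R 0)(r := 0), d 0, f 0, g 0)"
proof -
  let ?X = "\<lambda>j. ((R j)(r := j), d j, f j, g j)"
  let ?W = "WhileNZ (reg r) (Seq c (Assign (regA r) (Minus (reg r) (Num 1))))"
  have small_reg: "small (reg r)" "small (Minus (reg r) (Num 1))" "small nE"
    using r by (auto simp: small_def expr_defs)
  have test: "acost (reg r) s + bits (aval (reg r) s) \<le> unit_cost" if "rep X s" for X s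
    using small_cost[OF that small_reg(1)] by (simp add: unit_cost_def)
  have loop: "\<exists>t s'. exec ?W s t s' \<and> t \<le> (j * (a * n ^ p + 2) + 1) * unit_cost \<and> rep (?X 0) s'"
    if "j \<le> n" "rep (?X j) s" for j s
    using that
  proof (induction j arbitrary: s)
    case 0
    have "aval (reg r) s = 0" using rep_aval(4)[OF 0(2) r] by simp
    from exec.WhileFalse[of "reg r" s, OF this] show ?case using test[OF 0(2)] 0(2) by auto
  next
    case (Suc j)
    have val: "aval (reg r) s \<noteq> 0" using rep_aval(4)[OF Suc.prems(2) r] by simp
    obtain t1 s1 where 1: "exec c s t1 s1" "t1 \<le> a * n ^ p * unit_cost"
      "rep ((R j)(r := Suc j), d j, f j, g j) s1"
    proof -
      have "runs c a p (?X (Suc j)) ((R j)(r := Suc j), d j, f j, g j)"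
        using body[of "Suc j"] Suc.prems(1) by simp
      then show thesis using Suc.prems(2) that unfolding runs_def by blast
    qed
    have "runs (Assign (regA r) (Minus (reg r) (Num 1))) 1 0 ((R j)(r := Suc j), d j, f j, g j)
       (((R j)(r := Suc j))(r := j), d j, f j, g j)"
    proof (rule runs_reg[OF r small_reg(2)])
      show "aval (Minus (reg r) (Num 1)) s = j" if "rep ((R j)(r := Suc j), d j, f j, g j) s" for s
        using rep_aval(4)[OF that r] by simp
      show "j \<le> V" using V_ge Suc.prems by simp
    qed
    then obtain t2 s2 where 2: "exec (Assign (regA r) (Minus (reg r) (Num 1))) s1 t2 s2" "t2 \<le> unit_cost"
      "rep (?X j) s2"
      using 1(3) unfolding runs_def by auto
    obtain t3 s3 where 3: "exec ?W s2 t3 s3" "t3 \<le> (j * (a * n ^ p + 2) + 1) * unit_cost" "rep (?X 0) s3"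
      using Suc.IH[OF Suc_leD[OF Suc.prems(1)] 2(3)] by blast
    have "exec ?W s (acost (reg r) s + bits (aval (reg r) s) + (t1 + t2) + t3) s3"
      by (rule exec.WhileTrue[OF val exec.Seq[OF 1(1) 2(1)] 3(1)])
    moreover have "acost (reg r) s + bits (aval (reg r) s) + (t1 + t2) + t3
       \<le> (Suc j * (a * n ^ p + 2) + 1) * unit_cost"
      using test[OF Suc.prems(2)] 1(2) 2(2) 3(2) by (simp add: algebra_simps)
    ultimately show ?case using 3(3) by blast
  qed
  have start: "runs (Assign (regA r) nE) 1 0 (R n, d n, f n, g n) (?X n)"
    using V_ge by (intro runs_reg r small_reg) (auto simp: rep_aval)
  show ?thesis
    unfolding runs_def For_def
  proof (intro allI impI)
    fix s assume "rep (R n, d n, f n, g n) s"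
    then obtain t1 s1 where 1: "exec (Assign (regA r) nE) s t1 s1" "t1 \<le> unit_cost" "rep (?X n) s1"
      using start unfolding runs_def by auto
    obtain t2 s2 where 2: "exec ?W s1 t2 s2" "t2 \<le> (n * (a * n ^ p + 2) + 1) * unit_cost" "rep (?X 0) s2"
      using loop[OF order_refl 1(3)] by blast
    define m where "m = n * n ^ p"
    have "n * 1 \<le> n * n ^ p" using n_pos by (intro mult_le_mono) auto
    then have "n \<le> m" "1 \<le> m" using n_pos by (simp_all add: m_def)
    moreover have "n * (a * n ^ p + 2) + 1 + 1 = a * m + 2 * n + 2" "(a + 4) * n ^ Suc p = a * m + 4 * m"
      by (simp_all add: m_def algebra_simps)
    ultimately have "n * (a * n ^ p + 2) + 1 + 1 \<le> (a + 4) * n ^ Suc p" by linarith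
    then have "(n * (a * n ^ p + 2) + 1 + 1) * unit_cost \<le> (a + 4) * n ^ Suc p * unit_cost"
      by (rule mult_right_mono) simp
    then have "t1 + t2 \<le> (a + 4) * n ^ Suc p * unit_cost" using 1(2) 2(2) by (simp add: algebra_simps)
    then show "\<exists>t s'. exec (Seq (Assign (regA r) nE) ?W) s t s' \<and> t \<le> (a + 4) * n ^ Suc p * unit_cost
        \<and> rep ((R 0)(r := 0), d 0, f 0, g 0) s'"
      using exec.Seq[OF 1(1) 2(1)] 2(3) by auto
  qed
qed

end

section \<open>The program\<close>

text \<open>In round \<open>k = n + 1 - r\<^sub>1\<close> a pair whose entry is still \<open>0\<close> gets the entry \<open>k + 1\<close> if some neighbour of its second vertex has
  entry \<open>k\<close>. Updating in place is harmless, since an entry that has become \<open>k + 1\<close> is not mistaken for \<open>k\<close>.\<close>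

definition visitE :: aexp where
  "visitE =
     Plus (Mem (distA (reg 2) (reg 3)))
       (Times (Plus (Minus (Plus nE (Num 1)) (reg 1)) (Num 1))
         (Times (eqE (Mem (distA (reg 2) (reg 3))) (Num 0))
           (Times (eqE (Mem (distA (reg 2) (reg 4))) (Minus (Plus nE (Num 1)) (reg 1)))
             (Mem (cellE (reg 4) (reg 3))))))"

abbreviation visit :: com where
  "visit \<equiv> Assign (distA (reg 2) (reg 3)) visitE"

definition bfs :: com where
  "bfs = For 1 (For 2 (For 3 (For 4 visit)))"

definition betweenE :: aexp where
  "betweenE = Plus (reg 5) (eqE (Plus (Mem (distA (reg 1) (reg 3))) (Num 1))
     (Plus (Mem (distA (reg 1) (reg 2))) (Mem (distA (reg 2) (reg 3)))))"

abbreviation count_between :: com where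
  "count_between \<equiv> For 3 (Assign (regA 5) betweenE)"

abbreviation scale_key :: com where
  "scale_key \<equiv> Seq (Assign (keyA (reg 1)) (Times (Mem (keyA (reg 1))) (reg 5))) (Assign (regA 5) (Num 0))"

abbreviation complete_key :: com where
  "complete_key \<equiv> Assign (keyA (reg 1)) (Plus (Times (Mem (keyA (reg 1))) (Plus nE (Num 1))) (reg 1))"

abbreviation write_key :: com where
  "write_key \<equiv> Seq (Assign (keyA (reg 1)) (Num 1)) (Seq (For 2 (Seq count_between scale_key)) complete_key)"

definition keys :: com where
  "keys = For 1 write_key"

definition countE :: aexp where
  "countE = Plus (reg 5) (lessE (Mem (keyA (reg 2))) (Mem (keyA (reg 1))))"

abbreviation count_smaller :: com where
  "count_smaller \<equiv> For 2 (Assign (regA 5) countE)"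

abbreviation write_verdict :: com where
  "write_verdict \<equiv> Seq count_smaller (Seq (Assign (reg 1) (Minus (reg 7) (reg 5))) (Assign (regA 5) (Num 0)))"

text \<open>Writing \<open>K\<close> minus the rank, truncated, leaves a nonzero number exactly at the vertices of rank below \<open>K\<close>.\<close>

definition emit :: com where
  "emit = For 1 write_verdict"

text \<open>\<open>K\<close> must be saved, because its cell is that of the verdict on vertex \<open>1\<close>.\<close>

definition setup_memory :: com where
  "setup_memory = Seq (Assign (regA 7) (Mem (Num 1))) (For 1 (Assign (distA (reg 1) (reg 1)) (Num 1)))"

definition adam_program :: com where
  "adam_program = Seq setup_memory (Seq bfs (Seq keys emit))"

context ram
begin

text \<open>The distance matrix after \<open>k\<close> rounds.\<close>

definition partial_level :: "nat \<Rightarrow> nat \<Rightarrow> nat \<Rightarrow> nat" where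
  "partial_level k u v =
     (if \<exists>i\<le>k. (u, v) \<in> adjacency n T ^^ i then Suc (LEAST i. (u, v) \<in> adjacency n T ^^ i) else 0)"

text \<open>The effect of round \<open>k\<close> on the distance matrix.\<close>

definition extend :: "nat \<Rightarrow> (nat \<Rightarrow> nat \<Rightarrow> nat) \<Rightarrow> nat \<Rightarrow> nat \<Rightarrow> nat" where
  "extend k d u v =
     (if d u v = 0 \<and> (\<exists>w\<in>{1..n}. d u w = k \<and> adj_bit w v = 1) then Suc k else d u v)"

lemma partial_level_0: "partial_level 0 u v = (if u = v then 1 else 0)"
proof -
  have "(LEAST i. (v, v) \<in> adjacency n T ^^ i) = 0" by (rule Least_eq_0) simp
  then show ?thesis by (auto simp: partial_level_def)
qed

lemma partial_level_eq_Suc: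
  assumes "partial_level k u v = Suc i"
  shows "(u, v) \<in> adjacency n T ^^ i"
  using assms by (auto simp: partial_level_def split: if_splits intro: LeastI)

lemma partial_level_Suc:
  assumes uv: "u \<in> {1..n}" "v \<in> {1..n}"
  shows "extend (Suc k) (partial_level k) u v = partial_level (Suc k) u v"
proof (cases "\<exists>i\<le>k. (u, v) \<in> adjacency n T ^^ i")
  case True
  then have "\<exists>i\<le>Suc k. (u, v) \<in> adjacency n T ^^ i" using le_SucI by blast
  then show ?thesis using True by (simp add: extend_def partial_level_def)
next
  case False
  have hit: "(\<exists>w\<in>{1..n}. partial_level k u w = Suc k \<and> adj_bit w v = 1) \<longleftrightarrow> (u, v) \<in> adjacency n T ^^ Suc k"
  proof
    assume "\<exists>w\<in>{1..n}. partial_level k u w = Suc k \<and> adj_bit w v = 1"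
    then obtain w where w: "w \<in> {1..n}" "partial_level k u w = Suc k" "{w, v} \<in> T"
      by (auto simp: adj_bit_def split: if_splits)
    then have "(w, v) \<in> adjacency n T" using uv by (simp add: adjacency_def)
    then show "(u, v) \<in> adjacency n T ^^ Suc k" using partial_level_eq_Suc[OF w(2)] by auto
  next
    assume "(u, v) \<in> adjacency n T ^^ Suc k"
    then obtain w where w: "(u, w) \<in> adjacency n T ^^ k" "(w, v) \<in> adjacency n T" by auto
    have "(LEAST i. (u, w) \<in> adjacency n T ^^ i) = k"
    proof (rule Least_equality)
      show "(u, w) \<in> adjacency n T ^^ k" by (rule w(1))
    next
      fix i assume i: "(u, w) \<in> adjacency n T ^^ i"
      then have "(u, v) \<in> adjacency n T ^^ Suc i" using w(2) by auto
      then have "\<not> Suc i \<le> k" using False by blast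
      then show "k \<le> i" by simp
    qed
    then have "partial_level k u w = Suc k" using w(1) by (auto simp: partial_level_def)
    then show "\<exists>w\<in>{1..n}. partial_level k u w = Suc k \<and> adj_bit w v = 1"
      using w(2) by (auto simp: adjacency_def adj_bit_def)
  qed
  have "(LEAST i. (u, v) \<in> adjacency n T ^^ i) = Suc k" if "(u, v) \<in> adjacency n T ^^ Suc k"
  proof (rule Least_equality)
    show "(u, v) \<in> adjacency n T ^^ Suc k" by (rule that)
  next
    fix i assume "(u, v) \<in> adjacency n T ^^ i"
    then have "\<not> i \<le> k" using False by blast
    then show "Suc k \<le> i" by simp
  qed
  moreover have "(\<exists>i\<le>Suc k. (u, v) \<in> adjacency n T ^^ i) \<longleftrightarrow> (u, v) \<in> adjacency n T ^^ Suc k"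
    using False le_Suc_eq by blast
  moreover have "partial_level k u v = 0" using False by (simp add: partial_level_def)
  moreover have "partial_level (Suc k) u v = (if (u, v) \<in> adjacency n T ^^ Suc k then Suc (Suc k) else 0)"
    using calculation by (simp add: partial_level_def[of "Suc k"] del: relpow.simps)
  ultimately show ?thesis using hit by (simp add: extend_def del: relpow.simps)
qed

lemma partial_level_n: "partial_level n = level n T"
  by (intro ext) (simp add: partial_level_def level_def)

lemma small_visitE: "small visitE"
  by (simp add: small_def visitE_def expr_defs)

lemma runs_visit:
  assumes R: "R 1 \<in> {1..n}" "R 2 = u" "R 3 = v" "R 4 = w" "u \<in> {1..n}" "v \<in> {1..n}" "w \<in> {1..n}"
  shows "runs visit 1 0 (R, d, f, g)
    (R, d(u := (d u)(v := if d u v = 0 \<and> d u w = Suc n - R 1 \<and> adj_bit w v = 1 then Suc (Suc n - R 1) else d u v)), f, g)"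
    (is "runs _ _ _ _ (R, d(u := (d u)(v := ?x)), f, g)")
proof (cases "\<exists>s. rep (R, d, f, g) s")
  case True
  then obtain s0 where s0: "rep (R, d, f, g) s0" by blast
  have "d u v \<le> V" using rep_bound(2)[OF s0] R by auto
  then have x: "?x \<le> V" using V_ge R(1) by auto
  have "aval visitE s = ?x" if s: "rep (R, d, f, g) s" for s
  proof -
    note va = rep_aval[OF s]
    have r: "aval (reg 1) s = R 1" "aval (reg 2) s = u" "aval (reg 3) s = v" "aval (reg 4) s = w"
      using R by (simp_all add: va)
    show ?thesis
      using R r by (auto simp: visitE_def va adj_bit_def simp del: aval.simps(2))
  qed
  then show ?thesis
    using runs_dist[of 2 3 R visitE d f g ?x] R small_visitE x by auto
next
  case False
  then show ?thesis by (simp add: runs_def)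
qed

lemma extend_eq_iff:
  assumes "1 \<le> k"
  shows "extend k d u v = k \<longleftrightarrow> d u v = k"
  using assms by (auto simp: extend_def)

lemma runs_visit_loop:
  assumes R: "R 1 \<in> {1..n}" "R 2 = u" "R 3 = v" "R 4 = 0" "u \<in> {1..n}" "v \<in> {1..n}"
  shows "runs (For 4 visit) 5 1 (R, d, f, g)
    (R, d(u := (d u)(v := extend (Suc n - R 1) d u v)), f, g)"
proof -
  define k where "k = Suc n - R 1"
  have k: "1 \<le> k" using R(1) by (auto simp: k_def)
  define hit where "hit j \<longleftrightarrow> (\<exists>w\<in>{j<..n}. d u w = k \<and> adj_bit w v = 1)" for j
  define D where "D j = d(u := (d u)(v := if d u v = 0 \<and> hit j then Suc k else d u v))" for j
  have "runs (For 4 visit) (1 + 4) (Suc 0) (R, D n, f, g) (R(4 := 0), D 0, f, g)"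
  proof (rule runs_For)
    fix j assume j: "1 \<le> j" "j \<le> n"
    have "{j - Suc 0<..n} = insert j {j<..n}" using j by auto
    then have hit_step: "hit (j - Suc 0) \<longleftrightarrow> hit j \<or> d u j = k \<and> adj_bit j v = 1"
      by (auto simp: hit_def)
    have kk: "Suc n - (R(4 := j)) 1 = k" by (simp add: k_def)
    have "runs visit 1 0 (R(4 := j), D j, f, g)
      (R(4 := j), (D j)(u := (D j u)(v := if D j u v = 0 \<and> D j u j = k \<and> adj_bit j v = 1 then Suc k else D j u v)), f, g)"
      by (rule runs_visit[of "R(4 := j)" u v j "D j" f g, unfolded kk]) (use R j in auto)
    then show "runs visit 1 0 (R(4 := j), D j, f, g) (R(4 := j), D (j - 1), f, g)"
    proof (rule runs_cong)
      fix x y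
      show "((D j)(u := (D j u)(v := if D j u v = 0 \<and> D j u j = k \<and> adj_bit j v = 1 then Suc k else D j u v))) x y
        = D (j - 1) x y"
        using k hit_step by (cases "d u v = 0"; cases "hit j"; cases "j = v") (auto simp: D_def)
    qed auto
  qed simp
  moreover have "D n = d" by (auto simp: D_def hit_def fun_eq_iff)
  moreover have "D 0 = d(u := (d u)(v := extend k d u v))"
  proof -
    have "{0<..n} = {1..n}" by auto
    then show ?thesis by (simp add: D_def hit_def extend_def)
  qed
  moreover have "R(4 := 0) = R" using R(4) by auto
  ultimately show ?thesis by (simp add: k_def)
qed

lemma runs_row_loop:
  assumes R: "R 1 \<in> {1..n}" "R 2 = u" "R 3 = 0" "R 4 = 0" "u \<in> {1..n}"
  shows "runs (For 3 (For 4 visit)) 9 2 (R, d, f, g)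
    (R, d(u := extend (Suc n - R 1) d u), f, g)"
proof -
  define k where "k = Suc n - R 1"
  have k: "1 \<le> k" using R(1) by (auto simp: k_def)
  define D where "D j = d(u := \<lambda>v. if v \<in> {j<..n} then extend k d u v else d u v)" for j
  have "runs (For 3 (For 4 visit)) (5 + 4) (Suc 1) (R, D n, f, g) (R(3 := 0), D 0, f, g)"
  proof (rule runs_For)
    fix j assume j: "1 \<le> j" "j \<le> n"
    \<comment> \<open>The entries changed so far went from \<open>0\<close> to \<open>k + 1\<close>, so the set of entries equal to \<open>k\<close> is the old one.\<close>
    have new: "extend k (D j) u j = extend k d u j"
    proof -
      have "D j u j = d u j" by (simp add: D_def)
      moreover have "D j u w = k \<longleftrightarrow> d u w = k" for w
        using extend_eq_iff[OF k, of d u w] by (simp add: D_def)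
      ultimately show ?thesis by (simp add: extend_def)
    qed
    have "runs (For 4 visit) 5 1 (R(3 := j), D j, f, g)
      (R(3 := j), (D j)(u := (D j u)(j := extend k (D j) u j)), f, g)"
      using runs_visit_loop[of "R(3 := j)" u j "D j" f g] R j by (simp add: k_def)
    then show "runs (For 4 visit) 5 1 (R(3 := j), D j, f, g) (R(3 := j), D (j - 1), f, g)"
      unfolding new by (rule runs_cong) (use j in \<open>auto simp: D_def\<close>)
  qed simp
  then have "runs (For 3 (For 4 visit)) 9 2 (R, D n, f, g) (R(3 := 0), D 0, f, g)"
    by (simp add: numeral_2_eq_2)
  moreover have "D n = d" by (auto simp: D_def fun_eq_iff)
  ultimately have "runs (For 3 (For 4 visit)) 9 2 (R, d, f, g) (R(3 := 0), D 0, f, g)"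
    by simp
  then show ?thesis by (rule runs_cong) (use R in \<open>auto simp: D_def k_def\<close>)
qed

lemma runs_round_loop:
  assumes R: "R 1 \<in> {1..n}" "R 2 = 0" "R 3 = 0" "R 4 = 0"
  shows "runs (For 2 (For 3 (For 4 visit))) 13 3 (R, d, f, g)
    (R, extend (Suc n - R 1) d, f, g)"
proof -
  define k where "k = Suc n - R 1"
  define D where "D j u = (if u \<in> {j<..n} then extend k d u else d u)" for j u
  have "runs (For 2 (For 3 (For 4 visit))) (9 + 4) (Suc 2) (R, D n, f, g) (R(2 := 0), D 0, f, g)"
  proof (rule runs_For)
    fix j assume j: "1 \<le> j" "j \<le> n"
    have new: "extend k (D j) j = extend k d j" by (intro ext) (simp add: D_def extend_def)
    have "runs (For 3 (For 4 visit)) 9 2 (R(2 := j), D j, f, g)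
      (R(2 := j), (D j)(j := extend k (D j) j), f, g)"
      using runs_row_loop[of "R(2 := j)" j "D j" f g] R j by (simp add: k_def)
    then show "runs (For 3 (For 4 visit)) 9 2 (R(2 := j), D j, f, g) (R(2 := j), D (j - 1), f, g)"
      unfolding new by (rule runs_cong) (use j in \<open>auto simp: D_def\<close>)
  qed simp
  then have "runs (For 2 (For 3 (For 4 visit))) 13 3 (R, D n, f, g) (R(2 := 0), D 0, f, g)"
    by (simp add: numeral_3_eq_3 numeral_2_eq_2)
  moreover have "D n = d" by (auto simp: D_def fun_eq_iff)
  ultimately have "runs (For 2 (For 3 (For 4 visit))) 13 3 (R, d, f, g) (R(2 := 0), D 0, f, g)"
    by simp
  then show ?thesis by (rule runs_cong) (use R in \<open>auto simp: D_def k_def\<close>)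
qed

lemma runs_bfs:
  assumes R: "R 1 = 0" "R 2 = 0" "R 3 = 0" "R 4 = 0"
  shows "runs bfs 17 4 (R, partial_level 0, f, g) (R, level n T, f, g)"
proof -
  define D where "D j = partial_level (n - j)" for j
  have "runs bfs (13 + 4) (Suc 3) (R, D n, f, g) (R(1 := 0), D 0, f, g)"
    unfolding bfs_def
  proof (rule runs_For)
    fix j assume j: "1 \<le> j" "j \<le> n"
    have "runs (For 2 (For 3 (For 4 visit))) 13 3 (R(1 := j), D j, f, g)
      (R(1 := j), extend (Suc n - (R(1 := j)) 1) (D j), f, g)"
      using R j by (intro runs_round_loop) auto
    then show "runs (For 2 (For 3 (For 4 visit))) 13 3 (R(1 := j), D j, f, g) (R(1 := j), D (j - 1), f, g)"
    proof (rule runs_cong)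
      have e: "Suc n - j = Suc (n - j)" "n - (j - 1) = Suc (n - j)" using j by auto
      show "extend (Suc n - (R(1 := j)) 1) (D j) u v = D (j - 1) u v" if "u \<in> {1..n}" "v \<in> {1..n}" for u v
        using partial_level_Suc[OF that, of "n - j"] e by (simp add: D_def)
    qed auto
  qed simp
  moreover have "Suc 3 = 4" by simp
  moreover have "R(1 := 0) = R" using R by auto
  ultimately show ?thesis by (simp add: D_def partial_level_n)
qed

definition between :: "nat \<Rightarrow> (nat \<Rightarrow> nat \<Rightarrow> nat) \<Rightarrow> nat \<Rightarrow> nat \<Rightarrow> nat" where
  "between j d u w = card {x \<in> {j<..n}. Suc (d u x) = d u w + d w x}"

lemma card_Collect_greaterThanAtMost:
  assumes "1 \<le> j" "j \<le> n"
  shows "card {x \<in> {j - 1<..n}. P x} = card {x \<in> {j<..n}. P x} + (if P j then 1 else 0)"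
proof -
  have ins: "{j - 1<..n} = insert j {j<..n}" using assms by auto
  have "{x \<in> {j - 1<..n}. P x} = (if P j then insert j {x \<in> {j<..n}. P x} else {x \<in> {j<..n}. P x})"
    unfolding ins by auto
  then show ?thesis by simp
qed

lemma card_Collect_le: "card {x \<in> {j<..n}. P x} \<le> n"
proof -
  have "card {x \<in> {j<..n}. P x} \<le> card {1..n}" by (rule card_mono) auto
  then show ?thesis by simp
qed

lemma small_keys: "small betweenE" "small (Times (Mem (keyA (reg 1))) (reg 5))"
  "small (Plus (Times (Mem (keyA (reg 1))) (Plus nE (Num 1))) (reg 1))" "small (Num 0)" "small (Num 1)"
  by (simp_all add: small_def betweenE_def expr_defs)

lemma power_n_le_V:
  assumes "a \<le> n ^ m" "m \<le> n"
  shows "a \<le> V" "a * Suc n + n \<le> V"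
proof -
  have "n ^ m \<le> (n + 9) ^ n"
    by (rule order_trans[OF power_mono power_increasing]) (use assms in auto)
  then have a: "a \<le> (n + 9) ^ n" using assms by simp
  have "a * Suc n + n \<le> (n + 9) ^ n * Suc n + (n + 9) ^ n * n"
    using a by (intro add_mono mult_right_mono) auto
  also have "\<dots> \<le> (n + 9) ^ n * (n + 9) ^ 2"
    unfolding distrib_left[symmetric] by (intro mult_left_mono) (auto simp: power2_eq_square algebra_simps)
  also have "\<dots> \<le> V" unfolding V_def power_add[symmetric] by (intro power_increasing) auto
  finally show "a * Suc n + n \<le> V" .
  then show "a \<le> V" by simp
qed

lemma runs_between_loop:
  assumes R: "R 1 = u" "R 2 = w" "R 3 = 0" "R 5 = 0" "u \<in> {1..n}" "w \<in> {1..n}"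
  shows "runs count_between 5 1 (R, d, f, g) (R(5 := between 0 d u w), d, f, g)"
proof -
  have "runs count_between (1 + 4) (Suc 0) (R(5 := between n d u w), d, f, g)
     ((R(5 := between 0 d u w))(3 := 0), d, f, g)"
  proof (rule runs_For)
    fix j assume j: "1 \<le> j" "j \<le> n"
    let ?R = "(R(5 := between j d u w))(3 := j)"
    have "runs (Assign (regA 5) betweenE) 1 0 (?R, d, f, g) (?R(5 := between (j - 1) d u w), d, f, g)"
    proof (rule runs_reg[OF _ small_keys(1)])
      fix s assume s: "rep (?R, d, f, g) s"
      note va = rep_aval[OF s]
      have r: "aval (reg 1) s = u" "aval (reg 2) s = w" "aval (reg 3) s = j" "aval (reg 5) s = between j d u w"
        using R by (simp_all add: va)
      show "aval betweenE s = between (j - 1) d u w"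
        using R j r unfolding between_def card_Collect_greaterThanAtMost[OF j]
        by (simp add: betweenE_def va del: aval.simps(2))
    next
      show "between (j - 1) d u w \<le> V"
        unfolding between_def by (rule order_trans[OF card_Collect_le]) (use V_ge(2) in simp)
    qed simp
    moreover have "?R(5 := between (j - 1) d u w) = (R(5 := between (j - 1) d u w))(3 := j)" by auto
    ultimately show "runs (Assign (regA 5) betweenE) 1 0 (?R, d, f, g) ((R(5 := between (j - 1) d u w))(3 := j), d, f, g)"
      by simp
  qed simp
  moreover have "R(5 := between n d u w) = R" using R by (auto simp: between_def)
  moreover have "(R(5 := between 0 d u w))(3 := 0) = R(5 := between 0 d u w)" using R by auto
  ultimately show ?thesis by simp
qed

lemma runs_product_loop:
  assumes R: "R 1 = u" "R 2 = 0" "R 3 = 0" "R 5 = 0" "u \<in> {1..n}" and fu: "f u = 1"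
  shows "runs (For 2 (Seq count_between scale_key)) 11 2 (R, d, f, g)
      (R, d, f(u := \<Prod>w\<in>{1..n}. between 0 d u w), g)"
proof -
  define P where "P j = (\<Prod>w\<in>{j<..n}. between 0 d u w)" for j
  have P_le: "P j \<le> n ^ (n - j)" for j
  proof -
    have "P j \<le> (\<Prod>w\<in>{j<..n}. n)" unfolding P_def between_def by (intro prod_mono conjI card_Collect_le) simp
    then show ?thesis by simp
  qed
  have "runs (For 2 (Seq count_between scale_key)) (7 + 4) (Suc 1) (R, d, f(u := P n), g) (R(2 := 0), d, f(u := P 0), g)"
  proof (rule runs_For)
    fix j assume j: "1 \<le> j" "j \<le> n"
    let ?R = "R(2 := j)" and ?b = "between 0 d u j" and ?f = "f(u := P j)"
    have "{j - Suc 0<..n} = insert j {j<..n}" using j by auto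
    then have P_step: "P (j - Suc 0) = P j * ?b" by (simp add: P_def mult.commute)
    have 1: "runs count_between 5 1 (?R, d, ?f, g) (?R(5 := ?b), d, ?f, g)"
      using R j by (intro runs_between_loop) auto
    have 2: "runs (Assign (keyA (reg 1)) (Times (Mem (keyA (reg 1))) (reg 5))) 1 0 (?R(5 := ?b), d, ?f, g)
      (?R(5 := ?b), d, ?f((?R(5 := ?b)) 1 := P (j - 1)), g)"
    proof (rule runs_key[OF _ _ small_keys(2)])
      fix s assume s: "rep (?R(5 := ?b), d, ?f, g) s"
      note va = rep_aval[OF s]
      have r: "aval (reg 1) s = u" "aval (reg 5) s = ?b" using R by (simp_all add: va)
      show "aval (Times (Mem (keyA (reg 1))) (reg 5)) s = P (j - 1)"
        using R r by (simp add: va P_step del: aval.simps(2))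
    next
      show "P (j - 1) \<le> V" by (rule power_n_le_V(1)[OF P_le]) simp
    qed (use R in auto)
    have 3: "runs (Assign (regA 5) (Num 0)) 1 0 (?R(5 := ?b), d, ?f((?R(5 := ?b)) 1 := P (j - 1)), g)
      (?R(5 := ?b, 5 := 0), d, ?f((?R(5 := ?b)) 1 := P (j - 1)), g)"
      by (rule runs_reg[OF _ small_keys(4)]) auto
    have "runs (Seq count_between scale_key) (5 + (1 + 1)) 1 (?R, d, ?f, g)
      (?R(5 := ?b, 5 := 0), d, ?f((?R(5 := ?b)) 1 := P (j - 1)), g)"
      by (rule runs_Seq[OF 1 runs_Seq[OF 2 3]]) auto
    moreover have "?R(5 := ?b, 5 := 0) = ?R" using R by auto
    moreover have "?f((?R(5 := ?b)) 1 := P (j - 1)) = f(u := P (j - 1))" using R by auto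
    ultimately show "runs (Seq count_between scale_key) 7 1 (?R, d, ?f, g) (?R, d, f(u := P (j - 1)), g)"
      by simp
  qed simp
  moreover have "f(u := P n) = f" using fu by (auto simp: P_def)
  moreover have "R(2 := 0) = R" using R by auto
  moreover have "{0<..n} = {1..n}" by auto
  ultimately show ?thesis by (simp add: P_def numeral_2_eq_2)
qed

lemma runs_keys:
  assumes R: "R 1 = 0" "R 2 = 0" "R 3 = 0" "R 5 = 0"
  shows "runs keys 17 3 (R, level n T, f, g) (R, level n T, rank_key n T, g)"
proof -
  let ?d = "level n T"
  define F where "F j u = (if u \<in> {j<..n} then rank_key n T u else f u)" for j u
  have "runs keys (13 + 4) (Suc 2) (R, ?d, F n, g) (R(1 := 0), ?d, F 0, g)"
    unfolding keys_def
  proof (rule runs_For)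
    fix j assume j: "1 \<le> j" "j \<le> n"
    let ?R = "R(1 := j)" and ?p = "\<Prod>w\<in>{1..n}. between 0 ?d j w"
    have p: "?p = branch_prod {1..n} ?d j"
    proof -
      have "{0<..n} = {1..n}" by auto
      then show ?thesis by (simp add: branch_prod_def between_def)
    qed
    have p_le: "?p \<le> n ^ n"
    proof -
      have "?p \<le> (\<Prod>w\<in>{1..n}. n)" unfolding between_def by (intro prod_mono conjI card_Collect_le) simp
      then show ?thesis by simp
    qed
    have 1: "runs (Assign (keyA (reg 1)) (Num 1)) 1 0 (?R, ?d, F j, g) (?R, ?d, (F j)(?R 1 := 1), g)"
      using R j V_ge by (intro runs_key small_keys) auto
    have 2: "runs (For 2 (Seq count_between scale_key)) 11 2 (?R, ?d, (F j)(?R 1 := 1), g)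
       (?R, ?d, ((F j)(?R 1 := 1))(j := ?p), g)"
      using R j by (intro runs_product_loop) auto
    have 3: "runs complete_key 1 0
      (?R, ?d, ((F j)(?R 1 := 1))(j := ?p), g)
      (?R, ?d, ((F j)(?R 1 := 1))(j := ?p, ?R 1 := rank_key n T j), g)"
    proof (rule runs_key[OF _ _ small_keys(3)])
      fix s assume s: "rep (?R, ?d, ((F j)(?R 1 := 1))(j := ?p), g) s"
      note va = rep_aval[OF s]
      have r: "aval (reg 1) s = j" using R by (simp add: va)
      have "aval (Plus (Times (Mem (keyA (reg 1))) (Plus nE (Num 1))) (reg 1)) s = ?p * Suc n + j"
        using j r by (simp add: va del: aval.simps(2))
      then show "aval (Plus (Times (Mem (keyA (reg 1))) (Plus nE (Num 1))) (reg 1)) s = rank_key n T j"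
        unfolding rank_key_def p .
    next
      show "rank_key n T j \<le> V"
        using power_n_le_V(2)[OF p_le order_refl] j unfolding rank_key_def p by linarith
    qed (use j in auto)
    have "runs write_key (1 + (11 + 1)) 2 (?R, ?d, F j, g) (?R, ?d, ((F j)(?R 1 := 1))(j := ?p, ?R 1 := rank_key n T j), g)"
      by (rule runs_Seq[OF 1 runs_Seq[OF 2 3]]) auto
    then have "runs write_key 13 2 (?R, ?d, F j, g) (?R, ?d, (F j)(j := rank_key n T j), g)" by simp
    then show "runs write_key 13 2 (?R, ?d, F j, g) (?R, ?d, F (j - 1), g)"
      by (rule runs_cong) (use j in \<open>auto simp: F_def\<close>)
  qed simp
  moreover have "F n = f" by (auto simp: F_def fun_eq_iff)
  ultimately have "runs keys 17 3 (R, ?d, f, g) (R(1 := 0), ?d, F 0, g)" by (simp add: numeral_3_eq_3 numeral_2_eq_2)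
  then show ?thesis by (rule runs_cong) (use R in \<open>auto simp: F_def\<close>)
qed

lemma small_emit: "small countE" "small (Minus (reg 7) (reg 5))"
  by (simp_all add: small_def countE_def expr_defs)

lemma runs_count_loop:
  assumes R: "R 1 = u" "R 2 = 0" "R 5 = 0" "u \<in> {1..n}"
  shows "runs count_smaller 5 1 (R, d, f, g) (R(5 := card {v \<in> {1..n}. f v < f u}), d, f, g)"
proof -
  define C where "C j = card {v \<in> {j<..n}. f v < f u}" for j
  have "runs count_smaller (1 + 4) (Suc 0) (R(5 := C n), d, f, g) ((R(5 := C 0))(2 := 0), d, f, g)"
  proof (rule runs_For)
    fix j assume j: "1 \<le> j" "j \<le> n"
    let ?R = "(R(5 := C j))(2 := j)"
    have "runs (Assign (regA 5) countE) 1 0 (?R, d, f, g) (?R(5 := C (j - 1)), d, f, g)"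
    proof (rule runs_reg[OF _ small_emit(1)])
      fix s assume s: "rep (?R, d, f, g) s"
      note va = rep_aval[OF s]
      have r: "aval (reg 1) s = u" "aval (reg 2) s = j" "aval (reg 5) s = C j"
        using R by (simp_all add: va)
      show "aval countE s = C (j - 1)"
        using R j r unfolding C_def card_Collect_greaterThanAtMost[OF j]
        by (simp add: countE_def va del: aval.simps(2))
    next
      show "C (j - 1) \<le> V"
        unfolding C_def by (rule order_trans[OF card_Collect_le]) (use V_ge(2) in simp)
    qed simp
    moreover have "?R(5 := C (j - 1)) = (R(5 := C (j - 1)))(2 := j)" by auto
    ultimately show "runs (Assign (regA 5) countE) 1 0 (?R, d, f, g) ((R(5 := C (j - 1)))(2 := j), d, f, g)" by simp
  qed simp
  moreover have "R(5 := C n) = R" using R by (auto simp: C_def)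
  moreover have "(R(5 := C 0))(2 := 0) = R(5 := C 0)" using R by auto
  moreover have "{0<..n} = {1..n}" by auto
  ultimately show ?thesis by (simp add: C_def)
qed

lemma runs_emit:
  assumes R: "R 1 = 0" "R 2 = 0" "R 5 = 0" "R 7 = K" "K \<le> n"
  shows "runs emit 11 2 (R, d, f, g) (R, d, f, \<lambda>u. K - card {v \<in> {1..n}. f v < f u})"
proof -
  define G where "G j u = (if u \<in> {j<..n} then K - card {v \<in> {1..n}. f v < f u} else g u)" for j u
  have "runs emit (7 + 4) (Suc 1) (R, d, f, G n) (R(1 := 0), d, f, G 0)"
    unfolding emit_def
  proof (rule runs_For)
    fix j assume j: "1 \<le> j" "j \<le> n"
    let ?R = "R(1 := j)" and ?c = "card {v \<in> {1..n}. f v < f j}"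
    have 1: "runs count_smaller 5 1 (?R, d, f, G j) (?R(5 := ?c), d, f, G j)"
      using R j by (intro runs_count_loop) auto
    have 2: "runs (Assign (reg 1) (Minus (reg 7) (reg 5))) 1 0 (?R(5 := ?c), d, f, G j)
      (?R(5 := ?c), d, f, (G j)((?R(5 := ?c)) 1 := K - ?c))"
    proof (rule runs_out[OF _ _ small_emit(2)])
      fix s assume s: "rep (?R(5 := ?c), d, f, G j) s"
      show "aval (Minus (reg 7) (reg 5)) s = K - ?c" using R by (simp add: rep_aval[OF s])
    next
      show "K - ?c \<le> V" using R V_ge by simp
    qed (use j in auto)
    have 3: "runs (Assign (regA 5) (Num 0)) 1 0 (?R(5 := ?c), d, f, (G j)((?R(5 := ?c)) 1 := K - ?c))
      (?R(5 := ?c, 5 := 0), d, f, (G j)((?R(5 := ?c)) 1 := K - ?c))"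
      by (rule runs_reg[OF _ small_keys(4)]) auto
    have "runs write_verdict (5 + (1 + 1)) 1 (?R, d, f, G j)
      (?R(5 := ?c, 5 := 0), d, f, (G j)((?R(5 := ?c)) 1 := K - ?c))"
      by (rule runs_Seq[OF 1 runs_Seq[OF 2 3]]) auto
    then have "runs write_verdict 7 1 (?R, d, f, G j)
      (?R(5 := ?c, 5 := 0), d, f, (G j)((?R(5 := ?c)) 1 := K - ?c))" by simp
    then show "runs write_verdict 7 1 (?R, d, f, G j) (?R, d, f, G (j - 1))"
      by (rule runs_cong) (use j R in \<open>auto simp: G_def\<close>)
  qed simp
  moreover have "G n = g" by (auto simp: G_def fun_eq_iff)
  ultimately have "runs emit 11 2 (R, d, f, g) (R(1 := 0), d, f, G 0)" by (simp add: numeral_2_eq_2)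
  then show ?thesis by (rule runs_cong) (use R in \<open>auto simp: G_def\<close>)
qed

lemma runs_setup_memory:
  assumes g: "g 1 = K" "K \<le> n" and R: "R 1 = 0" and d: "\<And>u v. d u v = 0"
  shows "runs setup_memory 6 1 (R, d, f, g) (R(7 := K), partial_level 0, f, g)"
proof -
  let ?R = "R(7 := K)"
  have 1: "runs (Assign (regA 7) (Mem (Num 1))) 1 0 (R, d, f, g) (?R, d, f, g)"
  proof (rule runs_reg)
    show "small (Mem (Num 1))" by (simp add: small_def)
    show "aval (Mem (Num 1)) s = K" if "rep (R, d, f, g) s" for s
      using repD(3)[OF that, of 1] n_pos g by simp
    show "K \<le> V" using g V_ge by simp
  qed simp
  define D where "D j u v = (if u = v \<and> u \<in> {j<..n} then 1 else (0::nat))" for j u v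
  have "runs (For 1 (Assign (distA (reg 1) (reg 1)) (Num 1))) (1 + 4) (Suc 0) (?R, D n, f, g) (?R(1 := 0), D 0, f, g)"
  proof (rule runs_For)
    fix j assume j: "1 \<le> j" "j \<le> n"
    have "runs (Assign (distA (reg 1) (reg 1)) (Num 1)) 1 0 (?R(1 := j), D j, f, g)
      (?R(1 := j), (D j)((?R(1 := j)) 1 := (D j ((?R(1 := j)) 1))((?R(1 := j)) 1 := 1)), f, g)"
      using j V_ge by (intro runs_dist small_keys) auto
    then show "runs (Assign (distA (reg 1) (reg 1)) (Num 1)) 1 0 (?R(1 := j), D j, f, g) (?R(1 := j), D (j - 1), f, g)"
      by (rule runs_cong) (use j in \<open>auto simp: D_def\<close>)
  qed simp
  moreover have "D n = d" using d by (auto simp: D_def fun_eq_iff)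
  ultimately have 2: "runs (For 1 (Assign (distA (reg 1) (reg 1)) (Num 1))) 5 1 (?R, d, f, g) (?R(1 := 0), D 0, f, g)"
    by simp
  have "runs setup_memory (1 + 5) 1 (R, d, f, g) (?R(1 := 0), D 0, f, g)"
    unfolding setup_memory_def by (rule runs_Seq[OF 1 2]) auto
  then have "runs setup_memory 6 1 (R, d, f, g) (?R(1 := 0), D 0, f, g)" by simp
  then show ?thesis by (rule runs_cong) (use R in \<open>auto simp: D_def partial_level_0\<close>)
qed

lemma rep_tree_input:
  assumes "K \<le> n"
  shows "rep (\<lambda>_. 0, \<lambda>_ _. 0, \<lambda>_. 0, \<lambda>u. if u = 1 then K else 0) (tree_input K n T)"
proof (rule repI)
  have out: "tree_input K n T a = 0" if "n * n + n < a" for a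
  proof -
    have "\<not> (\<exists>u\<in>{1..n}. \<exists>v\<in>{1..n}. a = u * n + v \<and> {u, v} \<in> T)"
      using cell_range(2)[of _ n] that by fastforce
    then show ?thesis using that n_pos by (auto simp: tree_input_def)
  qed
  show "tree_input K n T 0 = n" by (simp add: tree_input_def)
  show "tree_input K n T a \<le> V" for a using assms V_ge by (auto simp: tree_input_def)
  show "tree_input K n T u = (if u = 1 then K else 0)" if "u \<in> {1..n}" for u
  proof -
    have "\<not> (\<exists>u'\<in>{1..n}. \<exists>v\<in>{1..n}. u = u' * n + v \<and> {u', v} \<in> T)"
      using cell_range(1)[of _ n] that by fastforce
    then show ?thesis using that by (auto simp: tree_input_def)
  qed
  show "tree_input K n T (u * n + v) = adj_bit u v" if uv: "u \<in> {1..n}" "v \<in> {1..n}" for u v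
  proof -
    have "(\<exists>u'\<in>{1..n}. \<exists>v'\<in>{1..n}. u * n + v = u' * n + v' \<and> {u', v'} \<in> T) \<longleftrightarrow> {u, v} \<in> T"
    proof
      assume "\<exists>u'\<in>{1..n}. \<exists>v'\<in>{1..n}. u * n + v = u' * n + v' \<and> {u', v'} \<in> T"
      then obtain u' v' where "v' \<in> {1..n}" "u * n + v = u' * n + v'" "{u', v'} \<in> T" by blast
      then show "{u, v} \<in> T" using cell_inj[OF uv(2), of v' u u'] by simp
    qed (use uv in blast)
    moreover have "u * n + v \<noteq> 0" "u * n + v \<noteq> 1" using cell_range(1)[OF uv] n_pos by auto
    ultimately show ?thesis unfolding tree_input_def adj_bit_def by (simp only: if_False)
  qed
  show "tree_input K n T (n * n + n + r) = 0" if "r \<in> {1..8}" for r using that by (intro out) auto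
  show "tree_input K n T (n * n + n + 9 + (u * n + v)) = 0" for u v by (intro out) auto
  show "tree_input K n T (n * n + n + 9 + (n * n + n + u)) = 0" for u by (intro out) auto
qed

lemma runs_adam_program:
  assumes "K \<le> n"
  shows "runs adam_program 51 4 (\<lambda>_. 0, \<lambda>_ _. 0, \<lambda>_. 0, \<lambda>u. if u = 1 then K else 0)
    ((\<lambda>_. 0)(7 := K), level n T, rank_key n T, \<lambda>u. K - card {v \<in> {1..n}. rank_key n T v < rank_key n T u})"
proof -
  let ?R = "(\<lambda>_. 0 :: nat)(7 := K)"
  have 1: "runs setup_memory 6 1 (\<lambda>_. 0, \<lambda>_ _. 0, \<lambda>_. 0, \<lambda>u. if u = 1 then K else 0)
     (?R, partial_level 0, \<lambda>_. 0, \<lambda>u. if u = 1 then K else 0)"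
    using assms by (intro runs_setup_memory) auto
  have 2: "runs bfs 17 4 (?R, partial_level 0, \<lambda>_. 0, \<lambda>u. if u = 1 then K else 0)
     (?R, level n T, \<lambda>_. 0, \<lambda>u. if u = 1 then K else 0)"
    by (rule runs_bfs) auto
  have 3: "runs keys 17 3 (?R, level n T, \<lambda>_. 0, \<lambda>u. if u = 1 then K else 0)
     (?R, level n T, rank_key n T, \<lambda>u. if u = 1 then K else 0)"
    by (rule runs_keys) auto
  have 4: "runs emit 11 2 (?R, level n T, rank_key n T, \<lambda>u. if u = 1 then K else 0)
     (?R, level n T, rank_key n T, \<lambda>u. K - card {v \<in> {1..n}. rank_key n T v < rank_key n T u})"
    using assms by (intro runs_emit) auto
  have "runs adam_program (6 + (17 + (17 + 11))) 4 (\<lambda>_. 0, \<lambda>_ _. 0, \<lambda>_. 0, \<lambda>u. if u = 1 then K else 0)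
    (?R, level n T, rank_key n T, \<lambda>u. K - card {v \<in> {1..n}. rank_key n T v < rank_key n T u})"
    unfolding adam_program_def
    by (rule runs_Seq[OF 1 runs_Seq[OF 2 runs_Seq[OF 3 4, of 4], of 4]]) auto
  then show ?thesis by simp
qed

text \<open>The bound \<open>V\<close> has \<open>O(n log n)\<close> digits.\<close>

lemma unit_cost_le: "unit_cost \<le> 10 ^ 9 * n ^ 2"
proof -
  have "n + 9 < 2 ^ (n + 9)" by simp
  then have "bits (n + 9) \<le> Suc (n + 9)" by (rule bits_le)
  then have "(n + 9) * bits (n + 9) \<le> (n + 9) * (n + 10)" by (intro mult_left_mono) auto
  then have "bits V \<le> (n + 9) * (n + 10)"
    using bits_power_le[of "n + 9" "n + 9"] unfolding V_def by linarith
  also have "\<dots> \<le> (10 * n) * (11 * n)" using n_pos by (intro mult_mono) auto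
  also have "\<dots> \<le> 10 ^ 3 * n ^ 2" by (simp add: power2_eq_square)
  finally have "10 ^ 6 * bits V \<le> 10 ^ 6 * (10 ^ 3 * n ^ 2)" by (intro mult_left_mono) auto
  then show ?thesis by (simp add: unit_cost_def)
qed

lemma adam_program_correct:
  assumes "K \<le> n"
  shows "\<exists>t s. exec adam_program (tree_input K n T) t s \<and> t \<le> 51 * 10 ^ 9 * n ^ 6
    \<and> vertex_output n s = adam_set K n T"
proof -
  obtain t s where ts: "exec adam_program (tree_input K n T) t s" "t \<le> 51 * n ^ 4 * unit_cost"
    "rep ((\<lambda>_. 0)(7 := K), level n T, rank_key n T, \<lambda>u. K - card {v \<in> {1..n}. rank_key n T v < rank_key n T u}) s"
    using runs_adam_program[OF assms] rep_tree_input[OF assms] unfolding runs_def by blast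
  have "t \<le> 51 * n ^ 4 * (10 ^ 9 * n ^ 2)"
    using ts(2) mult_left_mono[OF unit_cost_le, of "51 * n ^ 4"] by linarith
  also have "\<dots> = 51 * 10 ^ 9 * n ^ 6" by (simp add: power_add[symmetric])
  finally have "t \<le> 51 * 10 ^ 9 * n ^ 6" .
  moreover have "vertex_output n s = adam_set K n T"
    using repD(3)[OF ts(3)] by (auto simp: vertex_output_def adam_set_def)
  ultimately show ?thesis using ts(1) by blast
qed

end

lemma poly_time_adam_set: "poly_time_computes adam_program adam_set"
  unfolding poly_time_computes_def
proof (rule exI[of _ "51 * 10 ^ 9"], rule exI[of _ 6], intro allI impI)
  fix K n :: nat and T
  assume "1 \<le> K" "K \<le> n"
  then interpret ram n T by unfold_locales simp
  show "\<exists>t s. exec adam_program (tree_input K n T) t s \<and> t \<le> (51 * 10 ^ 9) * n ^ 6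
    \<and> vertex_output n s = adam_set K n T"
    by (rule adam_program_correct[OF \<open>K \<le> n\<close>])
qed

section \<open>The two bounds\<close>

theorem theorem1:
  shows "\<exists>c c' :: real. c > 0 \<and> c' > 0 \<and>
    (\<forall>(\<epsilon>::real) (K::nat). 0 < \<epsilon> \<longrightarrow> \<epsilon> < 1 / exp 1 \<longrightarrow> 1 \<le> K \<longrightarrow>
       (\<exists>H. root_finding K \<epsilon> H) \<longrightarrow>
       real K \<ge> exp (c * sqrt (ln (1 / \<epsilon>)))) \<and>
    (\<exists>P A. poly_time_computes P A \<and>
       (\<forall>\<epsilon>::real. 0 < \<epsilon> \<longrightarrow> \<epsilon> < 1 / exp 1 \<longrightarrow>
          (\<exists>K::nat. 1 \<le> K \<and> root_finding K \<epsilon> (A K) \<and>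
             real K \<le> exp (c' * (ln (1 / \<epsilon>) / ln (ln (1 / \<epsilon>)))))))"
proof -
  obtain c' :: real where c': "0 < c'"
    "\<And>\<epsilon> :: real. 0 < \<epsilon> \<Longrightarrow> \<epsilon> < 1 / exp 1 \<Longrightarrow>
      \<exists>K. 1 \<le> K \<and> root_finding K \<epsilon> (adam_set K) \<and> real K \<le> exp (c' * (ln (1 / \<epsilon>) / ln (ln (1 / \<epsilon>))))"
    by (rule adam_set_accuracy) blast
  show ?thesis
  proof (rule exI[of _ "1 / 4"], rule exI[of _ c'], intro conjI allI impI)
    fix \<epsilon> :: real and K :: nat
    assume "0 < \<epsilon>" "\<epsilon> < 1 / exp 1" "1 \<le> K" "\<exists>H. root_finding K \<epsilon> H"
    then show "exp (1 / 4 * sqrt (ln (1 / \<epsilon>))) \<le> real K"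
      using root_finding_lower_bound by blast
  next
    show "\<exists>P A. poly_time_computes P A \<and>
       (\<forall>\<epsilon>::real. 0 < \<epsilon> \<longrightarrow> \<epsilon> < 1 / exp 1 \<longrightarrow>
          (\<exists>K::nat. 1 \<le> K \<and> root_finding K \<epsilon> (A K) \<and>
             real K \<le> exp (c' * (ln (1 / \<epsilon>) / ln (ln (1 / \<epsilon>))))))"
      using poly_time_adam_set c'(2) by blast
  qed (use c'(1) in simp_all)
qed

end
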